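(* For every irrational $x\in[0,1)$ write its continued fraction expansion as $x=[a_1(x),a_2(x),\ldots]$ with partial quotients $a_n(x)\in\mathbb{N}$, and let $q_n(x)$ be the denominator of the $n$-th convergent $p_n(x)/q_n(x)=[a_1(x),\ldots,a_n(x)]$. Define the convergence exponent $$\tau(x):=\inf\Big\{s\ge 0:\ \sum_{n\ge1}a_n(x)^{-s}<\infty\Big\}\in[0,+\infty]$$ (with $\inf\emptyset=+\infty$). For $0\le\alpha\le\infty$ and $\beta\ge0$ let $$G(\alpha,\beta)=\Big\{x\in[0,1)\setminus\mathbb{Q}:\ \tau(x)=\alpha\ \text{and}\ \limsup_{n\to\infty}\frac{\log(a_n(x)a_{n+1}(x))}{\log q_n(x)}\ge\beta\Big\},$$ $$E(\alpha,\beta)=\Big\{x\in[0,1)\setminus\mathbb{Q}:\ \tau(x)=\alpha\ \text{and}\ \limsup_{n\to\infty}\frac{\log(a_n(x)a_{n+1}(x))}{\log q_n(x)}=\beta\Big\}.$$ Then for any $0\le\alpha\le\infty$ and $\beta\ge0$, $$\dim_H G(\alpha,\beta)=\dim_H E(\alpha,\beta)=\begin{cases}\dfrac{2}{\beta+2}, & \alpha=\infty,\\[2mm] \dfrac{2}{\beta+2+\sqrt{\beta^2+4}}, & 0\le\alpha<\infty,\end{cases}$$ where $\dim_H$ denotes Hausdorff dimension.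
   Context: The partial quotients are positive integers and $q_n$ satisfy $q_{-1}=0$, $q_0=1$, $q_n=a_nq_{n-1}+q_{n-2}$ for $n\ge1$. *)

theory Defs
  imports "HOL-Analysis.Analysis"
begin

section \<open>Hausdorff dimension\<close>

text \<open>
  The \<open>s\<close>-th power of the diameter, with the usual conventions for \<open>s = 0\<close>: a nonempty set
  contributes \<open>1\<close> (also a singleton, whereas \<open>0 powr 0 = 0\<close> in the library), and the empty set
  contributes \<open>0\<close> for every \<open>s\<close>. It is only meant for bounded sets, since \<^const>\<open>diameter\<close> is
  unspecified on unbounded ones.
\<close>

definition diam_pow :: "real \<Rightarrow> 'a::metric_space set \<Rightarrow> real" where
  "diam_pow s U = (if U = {} then 0 else if s = 0 then 1 else diameter U powr s)"

definition hausdorff_content :: "real \<Rightarrow> real \<Rightarrow> 'a::metric_space set \<Rightarrow> ennreal" where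
  "hausdorff_content \<delta> s A =
     (INF U \<in> {U :: nat \<Rightarrow> 'a set. A \<subseteq> (\<Union>i. U i) \<and> (\<forall>i. bounded (U i) \<and> diameter (U i) \<le> \<delta>)}.
        (\<Sum>i. ennreal (diam_pow s (U i))))"

text \<open>The supremum over \<open>\<delta>\<close> is the limit as \<open>\<delta>\<close> decreases to \<open>0\<close>.\<close>

definition hausdorff_measure :: "real \<Rightarrow> 'a::metric_space set \<Rightarrow> ennreal" where
  "hausdorff_measure s A = (SUP \<delta> \<in> {0<..}. hausdorff_content \<delta> s A)"

definition hausdorff_dim :: "'a::metric_space set \<Rightarrow> ereal" where
  "hausdorff_dim A = Inf {ereal s | s. 0 \<le> s \<and> hausdorff_measure s A = 0}"


section \<open>Continued fractions\<close>

text \<open>The partial quotients of an irrational \<open>x\<close> in the unit interval are read off from the orbit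
  of \<open>x\<close> under the Gauss map.\<close>

definition gauss_map :: "real \<Rightarrow> real" where
  "gauss_map x = frac (1 / x)"

text \<open>Partial quotients are indexed from \<open>1\<close>; the value at index \<open>0\<close> is meaningless.\<close>

definition cf_quot :: "real \<Rightarrow> nat \<Rightarrow> nat" where
  "cf_quot x n = nat \<lfloor>1 / (gauss_map ^^ (n - 1)) x\<rfloor>"

text \<open>Numerators and denominators of the convergents of \<open>[a 1, a 2, \<dots>]\<close>. The recurrences start
  from \<open>p\<^sub>-\<^sub>1 = 1\<close>, \<open>p\<^sub>0 = 0\<close> and \<open>q\<^sub>-\<^sub>1 = 0\<close>, \<open>q\<^sub>0 = 1\<close>, so that \<open>p\<^sub>1 = 1\<close> and \<open>q\<^sub>1 = a 1\<close>.\<close>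

fun cf_num :: "(nat \<Rightarrow> nat) \<Rightarrow> nat \<Rightarrow> nat" where
  "cf_num a 0 = 0"
| "cf_num a (Suc 0) = 1"
| "cf_num a (Suc (Suc n)) = a (Suc (Suc n)) * cf_num a (Suc n) + cf_num a n"

fun cf_den :: "(nat \<Rightarrow> nat) \<Rightarrow> nat \<Rightarrow> nat" where
  "cf_den a 0 = 1"
| "cf_den a (Suc 0) = a 1"
| "cf_den a (Suc (Suc n)) = a (Suc (Suc n)) * cf_den a (Suc n) + cf_den a n"

text \<open>The finite continued fraction \<open>1 / (a\<^sub>1 + 1 / (a\<^sub>2 + \<dots> + 1 / (a\<^sub>n + t)))\<close>; the value
  \<open>[a\<^sub>1, \<dots>, a\<^sub>n]\<close> is the case \<open>t = 0\<close>.\<close>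

definition cf_eval :: "nat list \<Rightarrow> real \<Rightarrow> real" where
  "cf_eval as t = foldr (\<lambda>a t. 1 / (real a + t)) as t"

lemma cf_den_ge:
  assumes "\<And>i. i \<ge> 1 \<Longrightarrow> a i > 0"
  shows "cf_den a n > 0 \<and> cf_den a (Suc n) \<ge> Suc n"
proof (induction n)
  case 0
  then show ?case using assms[of 1] by simp
next
  case (Suc n)
  have "a (Suc (Suc n)) * cf_den a (Suc n) \<ge> 1 * cf_den a (Suc n)"
    using assms[of "Suc (Suc n)"] by (intro mult_right_mono) auto
  then have "cf_den a (Suc (Suc n)) \<ge> cf_den a (Suc n) + cf_den a n" by simp
  with Suc show ?case by linarith
qed

lemma cf_eval_eq:
  fixes t :: real
  assumes "\<And>i. i \<ge> 1 \<Longrightarrow> a i > 0" "t \<ge> 0"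
  shows "cf_eval (map a [1..<Suc (Suc n)]) t =
    (cf_num a (Suc n) + t * cf_num a n) / (cf_den a (Suc n) + t * cf_den a n)"
  using assms(2)
proof (induction n arbitrary: t)
  case 0
  then show ?case by (simp add: cf_eval_def)
next
  case (Suc n)
  let ?b = "real (a (Suc (Suc n))) + t"
  have b: "?b > 0" using assms(1)[of "Suc (Suc n)"] Suc.prems by (simp add: add_pos_nonneg)
  have "cf_eval (map a [1..<Suc (Suc (Suc n))]) t = cf_eval (map a [1..<Suc (Suc n)]) (1 / ?b)"
    by (simp add: cf_eval_def)
  also have "\<dots> = (cf_num a (Suc n) + 1 / ?b * cf_num a n) / (cf_den a (Suc n) + 1 / ?b * cf_den a n)"
    using b by (intro Suc.IH) simp
  also have "\<dots> = (?b * (cf_num a (Suc n) + 1 / ?b * cf_num a n)) /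
                   (?b * (cf_den a (Suc n) + 1 / ?b * cf_den a n))"
    using b by simp
  also have "?b * (cf_num a (Suc n) + 1 / ?b * cf_num a n) =
      cf_num a (Suc (Suc n)) + t * cf_num a (Suc n)"
    using b by (simp add: field_simps)
  also have "?b * (cf_den a (Suc n) + 1 / ?b * cf_den a n) =
      cf_den a (Suc (Suc n)) + t * cf_den a (Suc n)"
    using b by (simp add: field_simps)
  finally show ?case .
qed

theorem cf_convergent:
  assumes "\<And>i. i \<ge> 1 \<Longrightarrow> a i > 0" "n \<ge> 1"
  shows "real (cf_num a n) / real (cf_den a n) = cf_eval (map a [1..<Suc n]) 0"
  using cf_eval_eq[of a 0 "n - 1"] assms by (cases n) auto

lemma cf_det:
  "int (cf_num a (Suc n)) * int (cf_den a n) - int (cf_num a n) * int (cf_den a (Suc n)) = (-1) ^ n"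
proof (induction n)
  case 0
  then show ?case by simp
next
  case (Suc n)
  then show ?case by (simp add: algebra_simps)
qed

theorem cf_coprime: "coprime (cf_num a n) (cf_den a n)"
proof -
  have "int d dvd (-1) ^ n" if "d dvd cf_num a n" "d dvd cf_den a n" for d
    using that unfolding cf_det[of a n, symmetric]
    by (intro dvd_diff) (auto simp flip: of_nat_mult)
  then have "is_unit d" if "d dvd cf_num a n" "d dvd cf_den a n" for d
    using that by (cases "even n") (auto simp: zdvd1_eq)
  then show ?thesis by (rule coprimeI)
qed

lemma gauss_map_irrational:
  assumes "x \<in> {0..<1} - \<rat>"
  shows "gauss_map x \<in> {0..<1} - \<rat>"
proof -
  have x: "x \<notin> \<rat>" using assms by simp
  have "1 / x \<notin> \<rat>"
  proof
    assume "1 / x \<in> \<rat>"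
    then have "1 / (1 / x) \<in> \<rat>" by (rule Rats_divide[OF Rats_1])
    moreover have "1 / (1 / x) = x" by (simp only: divide_divide_eq_right mult_1 div_by_1)
    ultimately show False using x by simp
  qed
  moreover have "frac (1 / x) + of_int \<lfloor>1 / x\<rfloor> = 1 / x" by (simp add: frac_def)
  ultimately have "frac (1 / x) \<notin> \<rat>"
    by (metis Rats_add Rats_of_int)
  then show ?thesis by (simp add: gauss_map_def frac_lt_1)
qed

lemma gauss_map_funpow_irrational:
  "x \<in> {0..<1} - \<rat> \<Longrightarrow> (gauss_map ^^ n) x \<in> {0..<1} - \<rat>"
proof (induction n)
  case (Suc n)
  then show ?case using gauss_map_irrational by simp
qed simp

lemma floor_inverse_ge_1:
  assumes "y \<in> {0..<1} - \<rat>"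
  shows "\<lfloor>1 / y\<rfloor> \<ge> 1"
proof -
  have "y \<noteq> 0" using assms by auto
  then show ?thesis using assms by (auto simp: le_floor_iff field_simps)
qed

theorem cf_quot_pos:
  assumes "x \<in> {0..<1} - \<rat>"
  shows "cf_quot x n > 0"
  using floor_inverse_ge_1[OF gauss_map_funpow_irrational[OF assms, of "n - 1"]]
  by (simp add: cf_quot_def)

lemma cf_eval_quot:
  assumes "x \<in> {0..<1} - \<rat>"
  shows "x = cf_eval (map (cf_quot x) [1..<Suc n]) ((gauss_map ^^ n) x)"
proof (induction n)
  case 0
  then show ?case by (simp add: cf_eval_def)
next
  case (Suc n)
  let ?y = "(gauss_map ^^ n) x"
  have "\<lfloor>1 / ?y\<rfloor> \<ge> 1"
    using floor_inverse_ge_1 gauss_map_funpow_irrational[OF assms] by blast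
  then have "real (cf_quot x (Suc n)) = real_of_int \<lfloor>1 / ?y\<rfloor>"
    unfolding cf_quot_def diff_Suc_1 by (intro of_nat_nat) linarith
  then have "real (cf_quot x (Suc n)) + gauss_map ?y = 1 / ?y"
    by (simp add: gauss_map_def frac_def)
  then have "1 / (real (cf_quot x (Suc n)) + (gauss_map ^^ Suc n) x) = ?y" by simp
  with Suc show ?case by (simp add: cf_eval_def)
qed

theorem cf_convergents_tendsto:
  assumes x: "x \<in> {0..<1} - \<rat>"
  shows "(\<lambda>n. real (cf_num (cf_quot x) n) / real (cf_den (cf_quot x) n)) \<longlonglongrightarrow> x"
proof -
  define p q where "p = (\<lambda>n. real (cf_num (cf_quot x) n))" and "q = (\<lambda>n. real (cf_den (cf_quot x) n))"
  have pos: "\<And>i. i \<ge> 1 \<Longrightarrow> cf_quot x i > 0" using cf_quot_pos[OF x] by simp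
  have q: "q n > 0" "q (Suc n) \<ge> Suc n" for n
    using cf_den_ge[of "cf_quot x" n] pos by (auto simp: q_def simp del: cf_den.simps)
  have bound: "\<bar>p (Suc n) / q (Suc n) - x\<bar> \<le> 1 / real (Suc n)" for n
  proof -
    define t where "t = (gauss_map ^^ Suc n) x"
    have t: "0 \<le> t" "t < 1"
      using gauss_map_funpow_irrational[OF x, of "Suc n"] by (auto simp: t_def)
    define Q where "Q = q (Suc n) + t * q n"
    have Q: "Q \<ge> q (Suc n)" "Q > 0"
      using q[of n] q(1)[of "Suc n"] t by (auto simp: Q_def add_pos_nonneg)
    have "x = (p (Suc n) + t * p n) / Q"
      using cf_eval_quot[OF x, of "Suc n"] cf_eval_eq[of "cf_quot x" t n] pos t
      by (simp add: p_def q_def Q_def t_def)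
    then have "p (Suc n) / q (Suc n) - x = (p (Suc n) * Q - (p (Suc n) + t * p n) * q (Suc n)) / (q (Suc n) * Q)"
      using Q q(1)[of "Suc n"] by (simp only: diff_frac_eq)
    also have "p (Suc n) * Q - (p (Suc n) + t * p n) * q (Suc n) = t * (p (Suc n) * q n - p n * q (Suc n))"
      by (simp add: algebra_simps Q_def)
    also have "p (Suc n) * q n - p n * q (Suc n) = (-1) ^ n"
      using arg_cong[OF cf_det[of "cf_quot x" n], of real_of_int]
      by (simp add: p_def q_def del: cf_num.simps cf_den.simps)
    finally have "\<bar>p (Suc n) / q (Suc n) - x\<bar> = t / (q (Suc n) * Q)"
      using Q q(1)[of "Suc n"] t by (simp add: abs_mult)
    also have "\<dots> \<le> 1 / real (Suc n)"
    proof (rule frac_le)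
      have "real (Suc n) * 1 \<le> q (Suc n) * Q"
        using q(2)[of n] Q by (intro mult_mono) auto
      then show "real (Suc n) \<le> q (Suc n) * Q" by simp
    qed (use t in auto)
    finally show ?thesis .
  qed
  have "(\<lambda>n. p (Suc n) / q (Suc n) - x) \<longlonglongrightarrow> 0"
    by (rule Lim_null_comparison[OF _ LIMSEQ_inverse_real_of_nat])
       (use bound in \<open>auto simp: field_simps\<close>)
  then have "(\<lambda>n. p (Suc n) / q (Suc n)) \<longlonglongrightarrow> x" by (simp add: LIM_zero_iff)
  then show ?thesis unfolding p_def q_def by (rule LIMSEQ_imp_Suc)
qed


section \<open>Convergence exponent and the level sets\<close>

definition conv_exponent :: "real \<Rightarrow> ereal" where
  "conv_exponent x =
     Inf {ereal s | s. 0 \<le> s \<and> summable (\<lambda>n. real (cf_quot x (Suc n)) powr (- s))}"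

text \<open>At the finitely many \<open>n\<close> with \<open>q\<^sub>n = 1\<close> the quotient below is \<open>0\<close> by the library's convention
  on division; the limes superior is not affected.\<close>

definition log_growth :: "real \<Rightarrow> ereal" where
  "log_growth x = limsup (\<lambda>n. ereal
     (ln (real (cf_quot x n * cf_quot x (Suc n))) / ln (real (cf_den (cf_quot x) n))))"

definition G_set :: "ereal \<Rightarrow> real \<Rightarrow> real set" where
  "G_set \<alpha> \<beta> = {x \<in> {0..<1} - \<rat>. conv_exponent x = \<alpha> \<and> log_growth x \<ge> ereal \<beta>}"

definition E_set :: "ereal \<Rightarrow> real \<Rightarrow> real set" where
  "E_set \<alpha> \<beta> = {x \<in> {0..<1} - \<rat>. conv_exponent x = \<alpha> \<and> log_growth x = ereal \<beta>}"

end

theory Submission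
  imports Defs "HOL-Real_Asymp.Real_Asymp"
begin

text \<open>
  The event \<open>a\<^sub>n a\<^sub>n\<^sub>+\<^sub>1 \<ge> q\<^sub>n powr b\<close> confines \<open>x\<close> to a short piece of a cylinder: of order \<open>n\<close>,
  or already of order \<open>n - 1\<close> if \<open>a\<^sub>n\<close> itself is a large power of \<open>q\<^sub>n\<^sub>-\<^sub>1\<close>. The upper bounds come
  from optimising the threshold between both covers. If \<open>\<alpha> = \<infinity>\<close> one sums over all words; if
  \<open>\<alpha> < \<infinity>\<close> then \<open>a\<^sub>n \<longlonglongrightarrow> \<infinity>\<close>, only words with large digits matter, and the sum over the words
  converges for every exponent above \<open>1\<close> instead of \<open>2\<close>.

  The lower bounds use mass distributions on trees of digits. For \<open>\<alpha> = \<infinity>\<close> the digits are bounded,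
  with masses close to the lengths of the cylinders, except that at very sparse positions the next
  digit is about \<open>q powr \<beta>\<close>. For \<open>\<alpha> < \<infinity>\<close>, let \<open>u\<close> be the positive root of \<open>u\<^sup>2 = \<beta> u + 1\<close>: in two
  out of three consecutive positions the digits are about \<open>q powr (u - 1)\<close>, so that
  \<open>q\<^sub>n\<^sub>+\<^sub>1\<close> is about \<open>q\<^sub>n powr u\<close>, and the product of these two digits is about
  \<open>q powr (u - 1 / u) = q powr \<beta>\<close>. Uniform mass on them gives the dimension \<open>1 / (1 + u)\<close>.
\<close>

section \<open>Continued fractions and finite words\<close>

text \<open>The exponents arise as follows. Let q be the denominator before the digit a. If a \<ge>
  q powr c, the cover of order n costs q powr (- s * (2 + c)). For smaller a, the cover of order n +
  1 costs a powr (- s * (1 + b)) * q powr (- s * (2 + b)), and this has to be summed over a. For s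
  above 2 / (\<beta> + 2) one has s * (1 + \<beta>) > 1, so this sum converges and the threshold
  costs nothing. Near 1 / (1 + u) one has s * (1 + \<beta>) < 1: the sum diverges and is cut at q
  powr c. The two covers then have the same critical exponent exactly for c = u - 1, and equating
  them is the equation u^2 = \<beta> * u + 1. From below, about q powr (u - 1) consecutive children
  of a word with denominator q fill a length of about q powr (- 1 - u), while the word has mass
  about 1 / q; this is the exponent 1 / (1 + u). The obstacle is the convergence exponent: for
  \<beta> > 0, digits of this size at every position would force it to be 0. The slow digits at
  every third position restore it without affecting the growth exponent.\<close>

text \<open>Words are reversed: the latest partial quotient comes first, so that for the word of
  \<open>a\<^sub>1, \<dots>, a\<^sub>n\<close> the values of \<open>den\<close> and \<open>pden\<close> are \<open>q\<^sub>n\<close> and \<open>q\<^sub>n\<^sub>-\<^sub>1\<close>.\<close>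

fun den :: "nat list \<Rightarrow> nat" where
  "den [] = 1"
| "den [a] = a"
| "den (a # b # w) = a * den (b # w) + den w"

text \<open>The value 0 at the empty word is the initial value q_{-1} = 0, so that
  \<open>den_Cons\<close> needs no case distinction.\<close>

definition pden :: "nat list \<Rightarrow> nat" where
  "pden w = (if w = [] then 0 else den (tl w))"

lemma den_Cons: "den (a # w) = a * den w + pden w"
  by (cases w) (auto simp: pden_def)

lemma pden_Nil [simp]: "pden [] = 0" and pden_Cons [simp]: "pden (a # w) = den w"
  by (auto simp: pden_def)

declare den.simps(2,3) [simp del]

text \<open>With the latest digit first, a new digit substitutes \<open>1 / (a + t)\<close> for the
  tail. A word thus acts as the Moebius map t to (p_n + t p_{n-1}) / (q_n + t q_{n-1}).\<close>

primrec word_val :: "nat list \<Rightarrow> real \<Rightarrow> real" where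
  "word_val [] t = t"
| "word_val (a # w) t = word_val w (1 / (real a + t))"

primrec cf_word :: "(nat \<Rightarrow> nat) \<Rightarrow> nat \<Rightarrow> nat list" where
  "cf_word a 0 = []"
| "cf_word a (Suc n) = a (Suc n) # cf_word a n"

lemma length_cf_word [simp]: "length (cf_word a n) = n"
  by (induction n) auto

lemma cf_word_add: "cf_word a (n + m) = cf_word (\<lambda>i. a (i + n)) m @ cf_word a n"
  by (induction m) (auto simp: add.commute)

lemma word_val_append: "word_val (u @ w) t = word_val w (word_val u t)"
  by (induction u arbitrary: t) auto

lemma set_cf_word: "set (cf_word a n) = a ` {1..n}"
  by (induction n) (auto simp: atLeastAtMostSuc_conv)

lemma den_cf_word: "den (cf_word a n) = cf_den a n"
  by (induction a n rule: cf_den.induct) (auto simp: den.simps)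

section \<open>Growth of denominators\<close>

lemma den_pos:
  assumes "0 \<notin> set w"
  shows "den w > 0"
  using assms by (induction w) (auto simp: den_Cons)

lemma pden_le_den:
  assumes "0 \<notin> set w"
  shows "pden w \<le> den w"
proof (cases w)
  case (Cons a v)
  then have "den v \<le> a * den v" using assms by (cases a) auto
  then show ?thesis unfolding Cons pden_Cons den_Cons by linarith
qed simp

lemma den_ge_mult: "a * den w \<le> den (a # w)"
  by (simp add: den_Cons)

lemma den_le_mult:
  assumes "0 \<notin> set w"
  shows "den (a # w) \<le> (a + 1) * den w"
  using pden_le_den[OF assms] by (simp add: den_Cons)

lemma real_den_le_mult:
  assumes "0 \<notin> set w"
  shows "real (den (a # w)) \<le> (real a + 1) * real (den w)"
  using den_le_mult[OF assms, of a] by (metis of_nat_1 of_nat_add of_nat_le_iff of_nat_mult)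

lemma den_mono_Cons:
  assumes "0 \<notin> set (a # w)"
  shows "den w \<le> den (a # w)"
proof -
  have "den w \<le> a * den w" using assms by (cases a) auto
  then show ?thesis using den_ge_mult[of a w] by linarith
qed

lemma length_le_den:
  assumes "0 \<notin> set w"
  shows "length w \<le> den w"
  using assms
proof (induction w)
  case (Cons a w)
  show ?case
  proof (cases w)
    case Nil
    then show ?thesis using Cons.prems by (auto simp: den_Cons)
  next
    case (Cons b v)
    then have "pden w > 0" using den_pos[of v] \<open>0 \<notin> set (a # w)\<close> by auto
    moreover have "den w \<le> a * den w"
      using \<open>0 \<notin> set (a # w)\<close> by (cases a) auto
    moreover have "length w \<le> den w" using Cons.IH \<open>0 \<notin> set (a # w)\<close> by simp
    ultimately show ?thesis unfolding den_Cons list.size by linarith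
  qed
qed simp

section \<open>Contraction and separation of the values of words\<close>

lemma word_val_bounds:
  fixes t :: real
  assumes "0 \<notin> set w" "0 \<le> t" "t \<le> 1"
  shows "0 \<le> word_val w t \<and> word_val w t \<le> 1"
  using assms
proof (induction w arbitrary: t)
  case (Cons a w)
  have "real a \<ge> 1" using Cons.prems by (cases a) auto
  then show ?case using Cons by simp
qed auto

text \<open>The Moebius map of a word has determinant 1 or -1, so only denominators survive in a
  difference. In the induction the factors a + t and a + t' cancel, and numerators never
  appear.\<close>

lemma word_val_diff:
  fixes t t' :: real
  assumes "0 \<notin> set w" "0 \<le> t" "0 \<le> t'"
  shows "\<bar>word_val w t - word_val w t'\<bar> =
    \<bar>t - t'\<bar> / ((den w + t * pden w) * (den w + t' * pden w))"
  using assms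
proof (induction w arbitrary: t t')
  case (Cons a w)
  have a: "real a \<ge> 1" using Cons.prems by (cases a) auto
  let ?Q = "real (den w)" and ?P = "real (pden w)"
  have Q: "?Q > 0" using den_pos[of w] Cons.prems by simp
  have pos: "real a + t > 0" "real a + t' > 0" using a Cons.prems by auto
  have "\<bar>word_val (a # w) t - word_val (a # w) t'\<bar> =
      \<bar>1 / (a + t) - 1 / (a + t')\<bar> / ((?Q + 1 / (a + t) * ?P) * (?Q + 1 / (a + t') * ?P))"
    using Cons.IH[of "1 / (a + t)" "1 / (a + t')"] Cons.prems pos by simp
  also have "1 / (a + t) - 1 / (a + t') = (t' - t) / ((a + t) * (a + t'))"
    using pos by (simp add: divide_simps)
  also have "\<bar>(t' - t) / ((a + t) * (a + t'))\<bar> = \<bar>t - t'\<bar> / ((a + t) * (a + t'))"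
    using pos by (simp add: abs_mult abs_minus_commute)
  also have "?Q + 1 / (a + t) * ?P = (den (a # w) + t * pden (a # w)) / (a + t)"
    using pos by (simp add: den_Cons field_simps)
  also have "?Q + 1 / (a + t') * ?P = (den (a # w) + t' * pden (a # w)) / (a + t')"
    using pos by (simp add: den_Cons field_simps)
  finally show ?case using pos by simp
qed simp

lemma word_val_diff_le:
  fixes t t' :: real
  assumes "0 \<notin> set w" "0 \<le> t" "0 \<le> t'" "\<bar>t - t'\<bar> \<le> d"
  shows "\<bar>word_val w t - word_val w t'\<bar> \<le> d / real (den w) ^ 2"
proof -
  have Q: "real (den w) > 0" using den_pos[OF assms(1)] by simp
  have "\<bar>t - t'\<bar> / ((den w + t * pden w) * (den w + t' * pden w)) \<le> d / (real (den w) * real (den w))"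
    using Q assms by (intro frac_le mult_mono mult_pos_pos) auto
  then show ?thesis using word_val_diff[OF assms(1-3)] by (simp add: power2_eq_square)
qed

text \<open>The coordinate y = 1 / t is the next digit plus its tail. In it, distances between
  children of one word are governed by the differences of their digits.\<close>

lemma word_val_separation:
  fixes y y' :: real
  assumes w: "0 \<notin> set w" and y: "1 \<le> y" "1 \<le> y'"
  shows "\<bar>word_val w (1 / y) - word_val w (1 / y')\<bar> \<ge>
    \<bar>y - y'\<bar> / (real (den w) ^ 2 * ((y + 1) * (y' + 1)))"
proof -
  let ?Q = "real (den w)" and ?P = "real (pden w)"
  have Q: "?Q > 0" "?P \<le> ?Q" using den_pos[OF w] pden_le_den[OF w] by auto
  have "\<bar>word_val w (1 / y) - word_val w (1 / y')\<bar> =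
    \<bar>1 / y - 1 / y'\<bar> / ((?Q + 1 / y * ?P) * (?Q + 1 / y' * ?P))"
    using word_val_diff[OF w, of "1 / y" "1 / y'"] y by simp
  also have "1 / y - 1 / y' = (y' - y) / (y * y')" using y by (simp add: divide_simps)
  also have "\<bar>(y' - y) / (y * y')\<bar> = \<bar>y - y'\<bar> / (y * y')"
    using y by (simp add: abs_mult abs_minus_commute)
  also have "?Q + 1 / y * ?P = (?Q * y + ?P) / y" using y by (simp add: field_simps)
  also have "?Q + 1 / y' * ?P = (?Q * y' + ?P) / y'" using y by (simp add: field_simps)
  also have "\<bar>y - y'\<bar> / (y * y') / ((?Q * y + ?P) / y * ((?Q * y' + ?P) / y')) =
      \<bar>y - y'\<bar> / ((?Q * y + ?P) * (?Q * y' + ?P))"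
    using y by simp
  also have "\<dots> \<ge> \<bar>y - y'\<bar> / ((?Q * (y + 1)) * (?Q * (y' + 1)))"
    using y Q by (intro divide_left_mono mult_mono mult_pos_pos)
      (auto simp: algebra_simps intro!: add_nonneg_pos)
  finally show ?thesis by (simp add: power2_eq_square mult_ac)
qed

section \<open>Gauss orbits and the realisation of digit sequences\<close>

abbreviation gauss_orbit :: "nat \<Rightarrow> real \<Rightarrow> real" where
  "gauss_orbit n \<equiv> gauss_map ^^ n"

lemma gauss_orbit_bounds:
  assumes "x \<in> {0..<1} - \<rat>"
  shows "0 < gauss_orbit n x" "gauss_orbit n x < 1"
  using gauss_map_funpow_irrational[OF assms, of n] by (force simp: less_le)+

lemma inverse_gauss_orbit:
  assumes x: "x \<in> {0..<1} - \<rat>"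
  shows "1 / gauss_orbit n x = cf_quot x (Suc n) + gauss_orbit (Suc n) x"
proof -
  let ?y = "gauss_orbit n x"
  have "\<lfloor>1 / ?y\<rfloor> \<ge> 1"
    using floor_inverse_ge_1 gauss_map_funpow_irrational[OF x] by blast
  then have "real (cf_quot x (Suc n)) = real_of_int \<lfloor>1 / ?y\<rfloor>"
    unfolding cf_quot_def diff_Suc_1 by (intro of_nat_nat) linarith
  then show ?thesis by (simp add: gauss_map_def frac_def)
qed

lemma word_val_cf_word:
  assumes x: "x \<in> {0..<1} - \<rat>"
  shows "word_val (cf_word (cf_quot x) n) (gauss_orbit n x) = x"
proof (induction n)
  case (Suc n)
  have "1 / (cf_quot x (Suc n) + gauss_orbit (Suc n) x) = gauss_orbit n x"
    unfolding inverse_gauss_orbit[OF x, symmetric] by simp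
  then show ?case using Suc by (simp del: funpow.simps)
qed simp

lemma zero_notin_cf_word:
  assumes x: "x \<in> {0..<1} - \<rat>"
  shows "0 \<notin> set (cf_word (cf_quot x) n)"
proof
  assume "0 \<in> set (cf_word (cf_quot x) n)"
  then obtain i where "cf_quot x i = 0" unfolding set_cf_word by auto
  then show False using cf_quot_pos[OF x, of i] by simp
qed

lemma gauss_orbit_le:
  assumes x: "x \<in> {0..<1} - \<rat>"
  shows "gauss_orbit n x \<le> 1 / cf_quot x (Suc n)"
    and "gauss_orbit n x \<ge> 1 / (real (cf_quot x (Suc n)) + 1)"
proof -
  let ?t = "gauss_orbit n x" and ?a = "real (cf_quot x (Suc n))"
  have t: "?t > 0" "1 / ?t \<ge> ?a" "1 / ?t \<le> ?a + 1"
    using inverse_gauss_orbit[OF x, of n] gauss_orbit_bounds[OF x, of n]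
      gauss_orbit_bounds[OF x, of "Suc n"] by auto
  have a: "?a > 0" using cf_quot_pos[OF x] by simp
  show "?t \<le> 1 / ?a" "?t \<ge> 1 / (?a + 1)"
    using t a by (auto simp: field_simps)
qed

text \<open>The Gauss map performs a step of the Euclidean algorithm: r / m goes to (m mod r) /
  r.\<close>

lemma gauss_orbit_rational_vanishes:
  fixes r m :: nat
  assumes "r < m"
  shows "\<exists>n. gauss_orbit n (real r / real m) = 0"
  using assms
proof (induction m arbitrary: r rule: less_induct)
  case (less m)
  show ?case
  proof (cases "r = 0")
    case True
    then show ?thesis by (intro exI[of _ 0]) simp
  next
    case False
    have "real m / real r = of_int (int (m div r)) + real (m mod r) / real r"
      using False by (simp add: field_simps flip: of_nat_mult of_nat_add)
    moreover have "real (m mod r) / real r < 1" using False by simp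
    ultimately have "gauss_map (real r / real m) = real (m mod r) / real r"
      by (simp add: gauss_map_def frac_unique_iff)
    moreover obtain n where "gauss_orbit n (real (m mod r) / real r) = 0"
      using less.IH[of r "m mod r"] less.prems False by auto
    ultimately have "gauss_orbit (Suc n) (real r / real m) = 0"
      by (simp only: funpow_Suc_right o_apply)
    then show ?thesis by blast
  qed
qed

text \<open>The limits \<open>X k\<close> belonging to all shifted digit sequences are built
  together. The relation X k = 1 / (a (Suc k) + X (Suc k)) makes the Gauss map act on them as the
  shift; since no \<open>X k\<close> vanishes, \<open>X 0\<close> is irrational.\<close>

lemma cf_digits_realizable:
  assumes a: "\<And>n. n \<ge> 1 \<Longrightarrow> a n > 0"
  obtains x where "x \<in> {0..<1} - \<rat>" "\<And>n. n \<ge> 1 \<Longrightarrow> cf_quot x n = a n"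
proof -
  define v where "v k n = word_val (cf_word (\<lambda>i. a (i + k)) n) 0" for k n
  have pos: "0 \<notin> set (cf_word (\<lambda>i. a (i + k)) n)" for k n
    using a by (auto simp: set_cf_word) (metis le_add1 less_irrefl trans_le_add1)
  have v01: "0 \<le> v k n" "v k n \<le> 1" for k n
    using word_val_bounds[OF pos, of 0 k n] by (auto simp: v_def)
  have v_add: "v k (n + m) = word_val (cf_word (\<lambda>i. a (i + k)) n) (v (k + n) m)" for k n m
    unfolding v_def by (subst cf_word_add) (simp add: word_val_append add_ac)
  have v_Suc: "v k (Suc m) = 1 / (a (Suc k) + v (Suc k) m)" for k m
    using v_add[of k 1 m] by simp
  have "Cauchy (v k)" for k
    unfolding Cauchy_altdef2
  proof (intro allI impI)
    fix e :: real assume "e > 0"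
    then obtain N where N: "N > 0" "1 / real N < e"
      using ex_inverse_of_nat_less[of e] by (auto simp: inverse_eq_divide)
    \<comment> \<open>Both values lie in the cylinder of the first \<open>N\<close> digits. Its
      length is at most 1 / N whatever the digits are, since denominators grow at least
      linearly.\<close>
    have near: "\<bar>v k N - v k m\<bar> < e" if "m \<ge> N" for m
    proof -
      have m: "m = N + (m - N)" using that by simp
      have "\<bar>v k N - v k m\<bar> \<le> 1 / real (den (cf_word (\<lambda>i. a (i + k)) N)) ^ 2"
        unfolding v_def[of k N] by (subst m, subst v_add)
          (use v01[of "k + N" "m - N"] in \<open>intro word_val_diff_le[OF pos]; simp\<close>)
      also have "\<dots> \<le> 1 / real N"
      proof -
        have "real N \<le> real (den (cf_word (\<lambda>i. a (i + k)) N))"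
          using length_le_den[OF pos[of k N]] by simp
        also have "\<dots> \<le> real (den (cf_word (\<lambda>i. a (i + k)) N)) ^ 2"
          using den_pos[OF pos[of k N]] by (simp add: power2_eq_square)
        finally show ?thesis using N by (intro frac_le) auto
      qed
      finally show ?thesis using N by simp
    qed
    show "\<exists>N. \<forall>n\<ge>N. dist (v k n) (v k N) < e"
      using near by (auto simp: dist_real_def abs_minus_commute intro!: exI[of _ N])
  qed
  then have lim: "v k \<longlonglongrightarrow> lim (v k)" for k
    by (simp add: Cauchy_convergent_iff convergent_LIMSEQ_iff)
  define X where "X k = lim (v k)" for k
  have X01: "0 \<le> X k" "X k \<le> 1" for k
    using lim[of k] v01[of k] unfolding X_def
    by (auto intro: LIMSEQ_le_const LIMSEQ_le_const2)
  have apos: "real (a (Suc k)) \<ge> 1" for k using a[of "Suc k"] by simp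
  have X_step: "X k = 1 / (a (Suc k) + X (Suc k))" for k
  proof (rule LIMSEQ_unique)
    show "(\<lambda>m. v k (Suc m)) \<longlonglongrightarrow> X k" using lim[of k] unfolding X_def by (rule LIMSEQ_Suc)
    show "(\<lambda>m. v k (Suc m)) \<longlonglongrightarrow> 1 / (a (Suc k) + X (Suc k))"
      unfolding v_Suc using lim[of "Suc k"] X01[of "Suc k"] apos[of k] unfolding X_def
      by (intro tendsto_intros) auto
  qed
  have Xpos: "0 < X k" for k
    using X_step[of k] X01[of "Suc k"] apos[of k] by auto
  \<comment> \<open>The digit may be 1; strictness comes from the positive tail
    \<open>X (Suc k)\<close>.\<close>
  have Xlt: "X k < 1" for k
    using Xpos[of "Suc k"] apos[of k] by (subst X_step) simp
  have inv: "1 / X k = a (Suc k) + X (Suc k)" for k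
    by (subst X_step) simp
  have gauss: "gauss_map (X k) = X (Suc k)" for k
    unfolding gauss_map_def inv using X01[of "Suc k"] Xlt[of "Suc k"]
    by (simp add: frac_unique_iff)
  have orbit: "gauss_orbit n (X 0) = X n" for n
    by (induction n) (auto simp: gauss)
  have irr: "X 0 \<notin> \<rat>"
  proof
    assume "X 0 \<in> \<rat>"
    then obtain r m where rm: "\<bar>X 0\<bar> = real r / real m" "m \<noteq> 0"
      by (rule Rats_abs_nat_div_natE)
    then have "X 0 = real r / real m" using Xpos[of 0] by simp
    moreover from this have "r < m" using Xlt[of 0] rm by simp
    ultimately obtain n where "gauss_orbit n (X 0) = 0"
      using gauss_orbit_rational_vanishes by metis
    then show False using orbit[of n] Xpos[of n] by simp
  qed
  have quot: "cf_quot (X 0) n = a n" if "n \<ge> 1" for n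
  proof -
    from \<open>n \<ge> 1\<close> obtain k where k: "n = Suc k" by (cases n) auto
    have "\<lfloor>real (a (Suc k)) + X (Suc k)\<rfloor> = int (a (Suc k))"
      using X01[of "Suc k"] Xlt[of "Suc k"] by (simp add: floor_eq_iff)
    then show ?thesis by (simp add: cf_quot_def k orbit inv)
  qed
  show thesis
  proof (rule that)
    show "X 0 \<in> {0..<1} - \<rat>" using irr Xpos[of 0] Xlt[of 0] by simp
  qed (rule quot)
qed

section \<open>Null sets for Hausdorff measures\<close>

lemma diam_pow_nonneg: "0 \<le> diam_pow s U"
  by (auto simp: diam_pow_def)

lemma hausdorff_content_le:
  assumes "A \<subseteq> (\<Union>i. U i)" "\<And>i. bounded (U i)" "\<And>i. diameter (U i) \<le> \<delta>"
  shows "hausdorff_content \<delta> s A \<le> (\<Sum>i. ennreal (diam_pow s (U i)))"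
  unfolding hausdorff_content_def using assms by (intro INF_lower) auto

lemma hausdorff_measure_mono:
  assumes "A \<subseteq> B"
  shows "hausdorff_measure s A \<le> hausdorff_measure s B"
  unfolding hausdorff_measure_def hausdorff_content_def
  by (intro SUP_subset_mono subset_refl INF_superset_mono order_refl) (use assms in auto)

lemma hausdorff_measure_zero_cover:
  assumes "hausdorff_measure s A = 0" "\<delta> > 0" "\<epsilon> > (0::ennreal)"
  obtains U :: "nat \<Rightarrow> _ set" where "A \<subseteq> (\<Union>i. U i)" "\<And>i. bounded (U i)"
    "\<And>i. diameter (U i) \<le> \<delta>" "(\<Sum>i. ennreal (diam_pow s (U i))) < \<epsilon>"
proof -
  have "hausdorff_content \<delta> s A \<le> hausdorff_measure s A"
    unfolding hausdorff_measure_def using assms by (intro SUP_upper) auto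
  then have "hausdorff_content \<delta> s A < \<epsilon>" using assms by simp
  then show thesis unfolding hausdorff_content_def Inf_less_iff using that by auto
qed

text \<open>For positive \<open>s\<close> the mesh of the covers is controlled by the sum.\<close>

lemma hausdorff_measure_eq_zeroI:
  assumes s: "s > 0"
    and cover: "\<And>\<epsilon>. \<epsilon> > (0::real) \<Longrightarrow> \<exists>U::nat \<Rightarrow> 'a::metric_space set. A \<subseteq> (\<Union>i. U i) \<and>
      (\<forall>i. bounded (U i)) \<and> (\<Sum>i. ennreal (diam_pow s (U i))) \<le> ennreal \<epsilon>"
  shows "hausdorff_measure s A = 0"
proof -
  have "hausdorff_content \<delta> s A \<le> 0" if \<delta>: "\<delta> > 0" for \<delta>
  proof (rule ennreal_le_epsilon)
    fix e :: real assume e: "e > 0"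
    \<comment> \<open>The cap \<open>\<delta> powr s\<close> bounds every single term of the sum,
      hence every diameter by \<delta>.\<close>
    define \<epsilon> where "\<epsilon> = min e (\<delta> powr s)"
    have \<epsilon>: "\<epsilon> > 0" using e \<delta> by (simp add: \<epsilon>_def)
    obtain U :: "nat \<Rightarrow> 'a set" where U: "A \<subseteq> (\<Union>i. U i)" "\<And>i. bounded (U i)"
      "(\<Sum>i. ennreal (diam_pow s (U i))) \<le> ennreal \<epsilon>" using cover[OF \<epsilon>] by auto
    have "diameter (U i) \<le> \<delta>" for i
    proof (cases "U i = {}")
      case False
      have "ennreal (diam_pow s (U i)) \<le> ennreal \<epsilon>"
        using U(3) sum_le_suminf[of "\<lambda>i. ennreal (diam_pow s (U i))" "{i}"] by (auto intro: order_trans)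
      then have "diameter (U i) powr s \<le> \<delta> powr s"
        using False s \<epsilon> by (simp add: diam_pow_def \<epsilon>_def)
      then show ?thesis using s \<delta> by (meson not_le powr_less_mono2 less_imp_le)
    qed (use \<delta> in auto)
    then have "hausdorff_content \<delta> s A \<le> ennreal \<epsilon>"
      using hausdorff_content_le[of A U \<delta> s] U by auto
    also have "\<dots> \<le> 0 + ennreal e" unfolding \<epsilon>_def by (simp add: ennreal_leI)
    finally show "hausdorff_content \<delta> s A \<le> 0 + ennreal e" .
  qed
  then have "hausdorff_measure s A \<le> 0"
    unfolding hausdorff_measure_def by (intro SUP_least) auto
  then show ?thesis by simp
qed

lemma hausdorff_measure_empty:
  assumes "s > 0"
  shows "hausdorff_measure s {} = 0"
proof (rule hausdorff_measure_eq_zeroI[OF assms])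
  fix \<epsilon> :: real
  show "\<exists>U::nat \<Rightarrow> 'a set. {} \<subseteq> (\<Union>i. U i) \<and> (\<forall>i. bounded (U i)) \<and>
      (\<Sum>i. ennreal (diam_pow s (U i))) \<le> ennreal \<epsilon>"
    by (intro exI[of _ "\<lambda>_. {}"]) (simp add: diam_pow_def)
qed

lemma hausdorff_measure_UN_eq_zero:
  fixes A :: "nat \<Rightarrow> 'a::metric_space set"
  assumes s: "s > 0" and null: "\<And>i. hausdorff_measure s (A i) = 0"
  shows "hausdorff_measure s (\<Union>i. A i) = 0"
proof (rule hausdorff_measure_eq_zeroI[OF s])
  fix \<epsilon> :: real assume \<epsilon>: "\<epsilon> > 0"
  have "\<exists>U::nat \<Rightarrow> 'a set. A i \<subseteq> (\<Union>j. U j) \<and> (\<forall>j. bounded (U j)) \<and>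
     (\<Sum>j. ennreal (diam_pow s (U j))) < ennreal (\<epsilon> * (1 / 2) ^ Suc i)" for i
  proof -
    have pos: "0 < ennreal (\<epsilon> * (1 / 2) ^ Suc i)" using \<epsilon> by (simp add: ennreal_zero_less_divide)
    show ?thesis
      by (rule hausdorff_measure_zero_cover[OF null[of i] zero_less_one pos]) blast
  qed
  then obtain U :: "nat \<Rightarrow> nat \<Rightarrow> 'a set" where U: "\<And>i. A i \<subseteq> (\<Union>j. U i j)"
    "\<And>i j. bounded (U i j)"
    "\<And>i. (\<Sum>j. ennreal (diam_pow s (U i j))) < ennreal (\<epsilon> * (1 / 2) ^ Suc i)" by metis
  define V where "V k = (case prod_decode k of (i, j) \<Rightarrow> U i j)" for k
  have "(\<Union>i. A i) \<subseteq> (\<Union>k. V k)"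
  proof
    fix x assume "x \<in> (\<Union>i. A i)"
    then obtain i j where "x \<in> U i j" using U(1) by blast
    then have "x \<in> V (prod_encode (i, j))" by (simp add: V_def)
    then show "x \<in> (\<Union>k. V k)" by blast
  qed
  moreover have "bounded (V k)" for k by (auto simp: V_def U split: prod.split)
  moreover have "(\<Sum>k. ennreal (diam_pow s (V k))) \<le> ennreal \<epsilon>"
  proof -
    have "(\<Sum>k. ennreal (diam_pow s (V k))) =
        (\<Sum>k. (\<lambda>(i, j). ennreal (diam_pow s (U i j))) (prod_decode k))"
      by (simp add: V_def split_beta)
    also have "\<dots> = (\<Sum>i. \<Sum>j. ennreal (diam_pow s (U i j)))"
      by (rule suminf_ennreal_2dimen) auto
    also have "\<dots> \<le> (\<Sum>i. ennreal (\<epsilon> * (1 / 2) ^ Suc i))"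
      using U(3) by (intro suminf_le) (auto intro: less_imp_le)
    also have "\<dots> = ennreal \<epsilon>"
      using \<epsilon> sums_mult[OF power_half_series, of \<epsilon>] by (intro suminf_ennreal_eq) auto
    finally show ?thesis .
  qed
  ultimately show "\<exists>U::nat \<Rightarrow> 'a set. (\<Union>i. A i) \<subseteq> (\<Union>i. U i) \<and> (\<forall>i. bounded (U i)) \<and>
      (\<Sum>i. ennreal (diam_pow s (U i))) \<le> ennreal \<epsilon>" by blast
qed

text \<open>Applied to words, to fix an initial part of the expansion, and to \<open>bool\<close>,
  to combine two kinds of covers.\<close>

lemma hausdorff_measure_UN_countable_eq_zero:
  fixes A :: "'i::countable \<Rightarrow> 'a::metric_space set"
  assumes "s > 0" "\<And>i. hausdorff_measure s (A i) = 0"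
  shows "hausdorff_measure s (\<Union>i. A i) = 0"
proof -
  have "(\<Union>i. A i) = (\<Union>k. A (from_nat k))" by (metis UNIV_I surj_from_nat image_image)
  then show ?thesis using hausdorff_measure_UN_eq_zero[of s "\<lambda>k. A (from_nat k)"] assms by simp
qed

text \<open>The convergence half of the Borel-Cantelli lemma for Hausdorff measures: a point in
  infinitely many \<open>E i\<close> is still covered after finitely many indices are removed, and
  the remaining sums are arbitrarily small. Bounds on finite sums suit index sets of words, which
  have no natural order.\<close>

lemma hausdorff_measure_limsup_eq_zero:
  fixes E :: "'i::countable \<Rightarrow> 'a::metric_space set" and f :: "'i \<Rightarrow> real"
  assumes s: "s > 0" and bounded: "\<And>i. bounded (E i)" and f: "\<And>i. diam_pow s (E i) \<le> f i"
    and sum: "\<And>F. finite F \<Longrightarrow> sum f F \<le> B"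
    and inf: "\<And>x. x \<in> A \<Longrightarrow> infinite {i. x \<in> E i}"
  shows "hausdorff_measure s A = 0"
proof (rule hausdorff_measure_eq_zeroI[OF s])
  fix \<epsilon> :: real assume \<epsilon>: "\<epsilon> > 0"
  have f0: "0 \<le> f i" for i using f[of i] diam_pow_nonneg[of s "E i"] by linarith
  define S where "S = (SUP F\<in>{F. finite F}. sum f F)"
  have bdd: "bdd_above (sum f ` {F. finite F})" using sum by (auto simp: bdd_above_def)
  have ne: "{F::'i set. finite F} \<noteq> {}" by auto
  have "S - \<epsilon> < S" using \<epsilon> by simp
  \<comment> \<open>A finite sum within \<epsilon> of the supremum leaves at most \<epsilon> for any
    finite set disjoint from it.\<close>
  then obtain F0 where F0: "finite F0" "S - \<epsilon> < sum f F0"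
    unfolding S_def less_cSUP_iff[OF ne bdd] by auto
  have tail: "sum f F \<le> \<epsilon>" if "finite F" "F \<inter> F0 = {}" for F
  proof -
    have "sum f (F \<union> F0) \<le> S" unfolding S_def using that F0 bdd by (intro cSUP_upper) auto
    then show ?thesis using that F0 by (simp add: sum.union_disjoint)
  qed
  \<comment> \<open>The sets outside \<open>F0\<close> are enumerated through \<open>to_nat\<close>;
    at all other indices the empty set contributes 0.\<close>
  define U where "U k = (if k \<in> to_nat ` (- F0) then E (from_nat k) else {})" for k
  have "A \<subseteq> (\<Union>k. U k)"
  proof
    fix x assume "x \<in> A"
    then obtain i where "i \<notin> F0" "x \<in> E i"
      using inf[of x] F0(1) by (metis (mono_tags, lifting) finite_subset mem_Collect_eq subsetI)
    then have "x \<in> U (to_nat i)" by (auto simp: U_def)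
    then show "x \<in> (\<Union>k. U k)" by blast
  qed
  moreover have "bounded (U k)" for k by (simp add: U_def bounded)
  moreover have "(\<Sum>k. ennreal (diam_pow s (U k))) \<le> ennreal \<epsilon>"
  proof -
    have "(\<Sum>k<n. diam_pow s (U k)) \<le> \<epsilon>" for n
    proof -
      define F where "F = {i. i \<notin> F0 \<and> to_nat i < n}"
      have "inj_on to_nat F" by (meson inj_to_nat inj_on_subset subset_UNIV)
      moreover have "to_nat ` F \<subseteq> {..<n}" by (auto simp: F_def)
      ultimately have finF: "finite F" using finite_subset finite_imageD by blast
      have "(\<Sum>k<n. diam_pow s (U k)) = (\<Sum>k\<in>to_nat ` F. diam_pow s (U k))"
        by (intro sum.mono_neutral_right) (auto simp: F_def U_def diam_pow_def)
      also have "\<dots> = (\<Sum>i\<in>F. diam_pow s (E i))"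
        using \<open>inj_on to_nat F\<close> by (subst sum.reindex) (auto simp: U_def F_def intro!: sum.cong)
      also have "\<dots> \<le> sum f F" using f by (intro sum_mono) auto
      also have "\<dots> \<le> \<epsilon>" using finF by (intro tail) (auto simp: F_def)
      finally show ?thesis .
    qed
    then have "(\<Sum>k<n. ennreal (diam_pow s (U k))) \<le> ennreal \<epsilon>" for n
      by (subst sum_ennreal) (auto simp: diam_pow_nonneg intro: ennreal_leI)
    then show ?thesis by (intro suminf_le_const) auto
  qed
  ultimately show "\<exists>U::nat \<Rightarrow> 'a set. A \<subseteq> (\<Union>i. U i) \<and> (\<forall>i. bounded (U i)) \<and>
      (\<Sum>i. ennreal (diam_pow s (U i))) \<le> ennreal \<epsilon>" by blast
qed

text \<open>The exponent 0 is treated apart because every nonempty set has \<open>diam_pow\<close> 1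
  there; afterwards only positive exponents occur.\<close>

lemma hausdorff_measure_0_nonempty:
  fixes A :: "'a::metric_space set"
  assumes "A \<noteq> {}"
  shows "hausdorff_measure 0 A \<noteq> 0"
proof
  assume "hausdorff_measure 0 A = 0"
  then obtain U :: "nat \<Rightarrow> 'a set" where U: "A \<subseteq> (\<Union>i. U i)" "\<And>i. bounded (U i)"
    "\<And>i. diameter (U i) \<le> 1" "(\<Sum>i. ennreal (diam_pow 0 (U i))) < 1"
    using hausdorff_measure_zero_cover[of 0 A 1 1] by auto
  obtain i where "U i \<noteq> {}" using U(1) assms by blast
  then have "ennreal (diam_pow 0 (U i)) = 1" by (simp add: diam_pow_def)
  then show False using ennreal_suminf_lessD[OF U(4), of i] by simp
qed

section \<open>From measures to the dimension\<close>

lemma hausdorff_dim_mono: "A \<subseteq> B \<Longrightarrow> hausdorff_dim A \<le> hausdorff_dim B"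
  unfolding hausdorff_dim_def
proof (rule Inf_superset_mono, clarify)
  fix s assume "A \<subseteq> B" "0 \<le> s" "hausdorff_measure s B = 0"
  then show "\<exists>s'. ereal s = ereal s' \<and> 0 \<le> s' \<and> hausdorff_measure s' A = 0"
    using hausdorff_measure_mono[of A B s] by (intro exI[of _ s]) simp
qed

text \<open>The upper limit \<open>t'\<close> restricts the test to exponents close to
  \<open>t\<close>. In the finite case this supplies s * (1 + \<beta>) < 1.\<close>

lemma hausdorff_dim_leI:
  assumes "t < t'" "0 \<le> t" "\<And>s. t < s \<Longrightarrow> s < t' \<Longrightarrow> hausdorff_measure s A = 0"
  shows "hausdorff_dim A \<le> ereal t"
proof (rule ereal_le_epsilon2)
  fix e :: real assume e: "0 < e"
  define s where "s = min (t + e) ((t + t') / 2)"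
  have s: "t < s" "s < t'" "s \<le> t + e" using e assms by (auto simp: s_def min_def field_simps)
  have "hausdorff_dim A \<le> ereal s"
    unfolding hausdorff_dim_def using s assms by (intro Inf_lower) auto
  also have "\<dots> \<le> ereal t + ereal e" using s by simp
  finally show "hausdorff_dim A \<le> ereal t + ereal e" .
qed

lemma hausdorff_dim_geI:
  assumes "A \<noteq> {}" "\<And>s. 0 < s \<Longrightarrow> s < t \<Longrightarrow> hausdorff_measure s A \<noteq> 0"
  shows "ereal t \<le> hausdorff_dim A"
  unfolding hausdorff_dim_def
proof (rule Inf_greatest, clarify)
  fix s assume s: "0 \<le> s" "hausdorff_measure s A = 0"
  show "ereal t \<le> ereal s"
    using hausdorff_measure_0_nonempty[OF assms(1)] assms(2)[of s] s
    by (cases "s = 0"; cases "s < t") auto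
qed

lemma hausdorff_dim_ge_if_measure_nonzero:
  assumes "t > 0" "\<And>s. 0 < s \<Longrightarrow> s < t \<Longrightarrow> hausdorff_measure s A \<noteq> 0"
  shows "ereal t \<le> hausdorff_dim A"
proof (rule hausdorff_dim_geI[OF _ assms(2)])
  show "A \<noteq> {}"
    using assms(2)[of "t / 2"] hausdorff_measure_empty[of "t / 2"] assms(1) by auto
qed

section \<open>Covers by cylinders with large products of partial quotients\<close>

text \<open>The index is shifted so that the word of order \<open>n\<close> precedes both digits of
  the product: it is the word from which both covers start.\<close>

lemma log_growth_frequently:
  assumes x: "x \<in> {0..<1} - \<rat>" and b: "ereal b < log_growth x"
  shows "infinite {n. real (cf_quot x (Suc n) * cf_quot x (Suc (Suc n)))
      \<ge> real (cf_den (cf_quot x) (Suc n)) powr b}" (is "infinite ?N")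
proof
  assume "finite ?N"
  then obtain m where m: "\<And>n. n \<ge> m \<Longrightarrow> n \<notin> ?N"
    by (metis finite_nat_set_iff_bounded not_less)
  let ?f = "\<lambda>n. ln (real (cf_quot x n * cf_quot x (Suc n))) / ln (real (cf_den (cf_quot x) n))"
  \<comment> \<open>From index 2 on the denominator exceeds 1, so its logarithm is positive and may
    be multiplied across.\<close>
  have "?f n \<le> b" if n: "n \<ge> m + 2" for n
  proof -
    obtain k where k: "n = Suc k" "k \<ge> m" using n by (cases n) auto
    let ?q = "real (cf_den (cf_quot x) n)" and ?p = "real (cf_quot x n * cf_quot x (Suc n))"
    have "n \<le> cf_den (cf_quot x) n"
      using length_le_den[OF zero_notin_cf_word[OF x, of n]] by (simp add: den_cf_word)
    then have q: "?q > 1" using n by linarith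
    have p: "?p > 0" using cf_quot_pos[OF x] by simp
    have "?p < ?q powr b" using m[of k] k by (simp add: not_le del: cf_den.simps)
    then have "ln ?p < ln (?q powr b)" using p q by (subst ln_less_cancel_iff) auto
    also have "\<dots> = b * ln ?q" using q by (simp add: ln_powr)
    finally show ?thesis using q by (simp add: divide_le_eq del: of_nat_mult)
  qed
  then have "log_growth x \<le> ereal b"
    unfolding log_growth_def by (intro Limsup_bounded eventually_sequentiallyI[of "m + 2"]) auto
  then show False using b by simp
qed

lemma diam_pow_le:
  fixes E :: "'a::real_normed_vector set"
  assumes s: "s > 0" and D: "\<And>x y. x \<in> E \<Longrightarrow> y \<in> E \<Longrightarrow> dist x y \<le> D"
  shows "diam_pow s E \<le> D powr s"
proof (cases "E = {}")
  case False
  then obtain x where x: "x \<in> E" by auto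
  have "diameter E \<le> D"
    using False D by (intro diameter_le) (auto simp: dist_norm)
  moreover have "bounded E" unfolding bounded_any_center[where a = x] using D x by auto
  then have "0 \<le> diameter E" by (rule diameter_ge_0)
  ultimately show ?thesis using False s by (auto simp: diam_pow_def intro: powr_mono2)
qed (auto simp: diam_pow_def)

text \<open>A point of the cylinder is \<open>word_val w t\<close> with t its Gauss orbit.
  Restricting t to (0, d] leaves an interval of length at most d / q^2.\<close>

lemma diam_pow_cylinder_le:
  assumes s: "s > 0" and w: "0 \<notin> set w"
    and E: "\<And>x. x \<in> E \<Longrightarrow> x \<in> {0..<1} - \<rat> \<and> cf_word (cf_quot x) (length w) = w \<and>
      gauss_orbit (length w) x \<le> d"
  shows "diam_pow s E \<le> (d / real (den w) ^ 2) powr s"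
proof (rule diam_pow_le[OF s])
  fix x y assume xy: "x \<in> E" "y \<in> E"
  let ?t = "gauss_orbit (length w)"
  have t: "0 < ?t x" "?t x \<le> d" "0 < ?t y" "?t y \<le> d"
    using E[OF xy(1)] E[OF xy(2)] gauss_orbit_bounds by auto
  have "x = word_val w (?t x)" "y = word_val w (?t y)"
    using word_val_cf_word[of x "length w"] word_val_cf_word[of y "length w"] E[OF xy(1)] E[OF xy(2)]
    by auto
  then have "dist x y = \<bar>word_val w (?t x) - word_val w (?t y)\<bar>" by (simp add: dist_real_def)
  also have "\<dots> \<le> d / real (den w) ^ 2" using t by (intro word_val_diff_le[OF w]) auto
  finally show "dist x y \<le> d / real (den w) ^ 2" .
qed

lemma sum_powr_bounded:
  assumes "\<kappa> > (0::real)"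
  obtains Z where "\<And>F. finite F \<Longrightarrow> (\<Sum>a\<in>F. real a powr (- 1 - \<kappa>)) \<le> Z"
proof (rule that)
  fix F :: "nat set" assume "finite F"
  have "summable (\<lambda>a. real a powr (- 1 - \<kappa>))" using assms by (subst summable_real_powr_iff) auto
  then show "(\<Sum>a\<in>F. real a powr (- 1 - \<kappa>)) \<le> (\<Sum>a. real a powr (- 1 - \<kappa>))"
    using \<open>finite F\<close> by (intro sum_le_suminf) auto
qed

text \<open>In the cover of order \<open>n + 1\<close> the factor \<open>a powr (- 1 - \<kappa>)\<close> is split off to sum over the last digit
  \<open>a \<le> q powr c\<close>; bounding the rest costs the factor \<open>q powr (c * (1 + \<kappa> - s * (1 + b)))\<close>.\<close>

lemma hausdorff_measure_large_products_eq_zero: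
  fixes W :: "nat list set" and b c \<kappa> s \<sigma> B :: real
  assumes s: "s > 0" and c: "c \<ge> 0" and \<kappa>: "\<kappa> > 0" and b: "2 + b \<ge> 0"
    and e: "s * (1 + b) \<le> 1 + \<kappa>"
    and \<sigma>1: "\<sigma> \<le> s * (2 + c)" and \<sigma>2: "\<sigma> \<le> s * (2 + b) - c * (1 + \<kappa> - s * (1 + b))"
    and W: "\<And>w. w \<in> W \<Longrightarrow> 0 \<notin> set w"
    and sum: "\<And>F. finite F \<Longrightarrow> F \<subseteq> W \<Longrightarrow> (\<Sum>w\<in>F. real (den w) powr (- \<sigma>)) \<le> B"
    and A: "\<And>x. x \<in> A \<Longrightarrow> x \<in> {0..<1} - \<rat>"
    and inf: "\<And>x. x \<in> A \<Longrightarrow> infinite {n. cf_word (cf_quot x) n \<in> W \<and>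
      real (cf_quot x (Suc n) * cf_quot x (Suc (Suc n))) \<ge> real (cf_den (cf_quot x) (Suc n)) powr b}"
  shows "hausdorff_measure s A = 0"
proof -
  define I where "I x = {n. cf_word (cf_quot x) n \<in> W \<and>
      real (cf_quot x (Suc n) * cf_quot x (Suc (Suc n))) \<ge> real (cf_den (cf_quot x) (Suc n)) powr b}" for x
  \<comment> \<open>\<open>H\<close> collects the positions where the next digit alone reaches the
    threshold. There the cover of order \<open>n\<close> is used, elsewhere the one of order
    \<open>n + 1\<close>.\<close>
  define H where "H x = {n. real (cf_quot x (Suc n)) \<ge> real (cf_den (cf_quot x) n) powr c}" for x
  define A1 where "A1 = {x\<in>A. infinite (I x \<inter> H x)}"
  define A2 where "A2 = {x\<in>A. infinite (I x - H x)}"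
  have Q1: "real (den w) \<ge> 1" if "w \<in> W" for w using den_pos[OF W[OF that]] by linarith
  have B: "0 \<le> B" using sum[of "{}"] by simp
  define E1 where "E1 w = {x \<in> {0..<1} - \<rat>. w \<in> W \<and> cf_word (cf_quot x) (length w) = w \<and>
      real (cf_quot x (Suc (length w))) \<ge> real (den w) powr c}" for w
  have bounded: "bounded S" if "S \<subseteq> {0..<1::real} - \<rat>" for S
    by (rule bounded_subset[of "{0..1}"]) (use that in auto)
  have "hausdorff_measure s A1 = 0"
  proof (rule hausdorff_measure_limsup_eq_zero[OF s])
    let ?f = "\<lambda>w. if w \<in> W then real (den w) powr (- \<sigma>) else 0"
    show "bounded (E1 w)" for w by (rule bounded) (auto simp: E1_def)
    show "diam_pow s (E1 w) \<le> ?f w" for w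
    proof (cases "w \<in> W")
      case True
      have "diam_pow s (E1 w) \<le> (1 / real (den w) powr c / real (den w) ^ 2) powr s"
      proof (rule diam_pow_cylinder_le[OF s W[OF True]])
        fix x assume x: "x \<in> E1 w"
        then have "gauss_orbit (length w) x \<le> 1 / real (cf_quot x (Suc (length w)))"
          unfolding E1_def by (intro gauss_orbit_le(1)) auto
        also have "\<dots> \<le> 1 / real (den w) powr c"
          using x Q1[OF True] cf_quot_pos[of x "Suc (length w)"]
          by (intro divide_left_mono) (auto simp: E1_def intro!: mult_pos_pos)
        finally show "x \<in> {0..<1} - \<rat> \<and> cf_word (cf_quot x) (length w) = w \<and>
            gauss_orbit (length w) x \<le> 1 / real (den w) powr c" using x by (auto simp: E1_def)
      qed
      also have "1 / real (den w) powr c / real (den w) ^ 2 = real (den w) powr (- (2 + c))"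
        using Q1[OF True] by (simp add: powr_minus powr_diff powr_add powr_numeral field_simps)
      also have "\<dots> powr s = real (den w) powr (- (s * (2 + c)))"
        by (simp add: powr_powr algebra_simps)
      also have "\<dots> \<le> real (den w) powr (- \<sigma>)"
        using Q1[OF True] \<sigma>1 by (intro powr_mono) auto
      finally show ?thesis using True by simp
    next
      case False
      then show ?thesis by (simp add: E1_def diam_pow_def)
    qed
    show "sum ?f F \<le> B" if "finite F" for F
    proof -
      have "sum ?f F = (\<Sum>w\<in>F \<inter> W. real (den w) powr (- \<sigma>))"
        using that by (simp add: sum.inter_restrict)
      then show ?thesis using sum[of "F \<inter> W"] that by simp
    qed
    show "infinite {w. x \<in> E1 w}" if x: "x \<in> A1" for x
    proof -
      have "inj (cf_word (cf_quot x))" by (metis injI length_cf_word)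
      then have "infinite (cf_word (cf_quot x) ` (I x \<inter> H x))"
        using x by (simp add: A1_def finite_image_iff inj_on_subset)
      moreover have "cf_word (cf_quot x) ` (I x \<inter> H x) \<subseteq> {w. x \<in> E1 w}"
        using x A by (auto simp: E1_def I_def H_def A1_def den_cf_word)
      ultimately show ?thesis using finite_subset by blast
    qed
  qed
  obtain Z where Z: "\<And>F. finite F \<Longrightarrow> (\<Sum>a\<in>F. real a powr (- 1 - \<kappa>)) \<le> Z"
    using sum_powr_bounded[OF \<kappa>] by blast
  \<comment> \<open>The pair (a, w) is a cylinder of order n + 1 whose last digit stays below the
    threshold; the digit after it is then at least the \<open>b\<close>-th power of the new
    denominator divided by a.\<close>
  define E2 where "E2 p = {x \<in> {0..<1} - \<rat>. snd p \<in> W \<and> fst p > 0 \<and>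
      cf_word (cf_quot x) (Suc (length (snd p))) = fst p # snd p \<and> real (fst p) \<le> real (den (snd p)) powr c \<and>
      real (fst p * cf_quot x (Suc (Suc (length (snd p))))) \<ge> real (den (fst p # snd p)) powr b}" for p
  have "hausdorff_measure s A2 = 0"
  proof (rule hausdorff_measure_limsup_eq_zero[OF s])
    let ?g = "\<lambda>w. if w \<in> W then real (den w) powr (- \<sigma>) else 0"
    let ?f = "\<lambda>p. real (fst p) powr (- 1 - \<kappa>) * ?g (snd p)"
    show "bounded (E2 p)" for p by (rule bounded) (auto simp: E2_def)
    show "diam_pow s (E2 p) \<le> ?f p" for p
    proof (cases "snd p \<in> W \<and> fst p > 0 \<and> real (fst p) \<le> real (den (snd p)) powr c")
      case True
      obtain a w where p: "p = (a, w)" by (cases p)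
      have w: "w \<in> W" and a: "a > 0" "real a \<le> real (den w) powr c" using True p by auto
      let ?Q = "real (den w)" and ?R = "real (den (a # w))"
      have 0: "0 \<notin> set (a # w)" using W[OF w] a by auto
      have R: "?R \<ge> real a * ?Q" using den_ge_mult[of a w] by (simp flip: of_nat_mult)
      have R0: "?R > 0" using den_pos[OF 0] by simp
      have "diam_pow s (E2 p) \<le> (real a / ?R powr b / ?R ^ 2) powr s"
      proof (rule diam_pow_cylinder_le[OF s 0])
        fix x assume x: "x \<in> E2 p"
        have "gauss_orbit (length (a # w)) x \<le> 1 / real (cf_quot x (Suc (length (a # w))))"
          using x unfolding E2_def by (intro gauss_orbit_le(1)) auto
        \<comment> \<open>Expanding by \<open>a\<close> brings in the product of two neighbouring
          digits, which is bounded below by \<open>?R powr b\<close>.\<close>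
        also have "\<dots> = real a / real (a * cf_quot x (Suc (length (a # w))))"
          using a by simp
        also have "\<dots> \<le> real a / ?R powr b"
          using x R0 by (intro divide_left_mono) (auto simp: E2_def p intro!: mult_pos_pos cf_quot_pos a)
        finally show "x \<in> {0..<1} - \<rat> \<and> cf_word (cf_quot x) (length (a # w)) = a # w \<and>
            gauss_orbit (length (a # w)) x \<le> real a / ?R powr b"
          using x unfolding E2_def p by simp
      qed
      also have "real a / ?R powr b / ?R ^ 2 = real a * ?R powr (- (2 + b))"
        using R0 by (simp add: powr_minus powr_diff powr_add powr_numeral field_simps)
      also have "(real a * ?R powr (- (2 + b))) powr s \<le> (real a * (real a * ?Q) powr (- (2 + b))) powr s"
        using R a b s Q1[OF w] by (intro powr_mono2 mult_left_mono powr_mono2') (auto intro!: mult_pos_pos)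
      also have "\<dots> = real a powr s * ((real a * ?Q) powr (- (2 + b))) powr s"
        using a by (simp add: powr_mult)
      also have "((real a * ?Q) powr (- (2 + b))) powr s = (real a * ?Q) powr (- (s * (2 + b)))"
        by (simp add: powr_powr algebra_simps)
      also have "\<dots> = real a powr (- (s * (2 + b))) * ?Q powr (- (s * (2 + b)))"
        by (simp add: powr_mult)
      also have "real a powr s * \<dots> = real a powr (s - s * (2 + b)) * ?Q powr (- (s * (2 + b)))"
        by (simp add: algebra_simps flip: powr_add)
      also have "real a powr (s - s * (2 + b)) = real a powr (- 1 - \<kappa>) * real a powr (1 + \<kappa> - s * (1 + b))"
        by (simp add: algebra_simps flip: powr_add)
      finally have "diam_pow s (E2 p) \<le> real a powr (- 1 - \<kappa>) *
          real a powr (1 + \<kappa> - s * (1 + b)) * ?Q powr (- (s * (2 + b)))" .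
      \<comment> \<open>The middle exponent is nonnegative by \<open>e\<close>, so \<open>a\<close>
        may be replaced there by its upper bound \<open>?Q powr c\<close>.\<close>
      also have "\<dots> \<le> real a powr (- 1 - \<kappa>) *
          (?Q powr c) powr (1 + \<kappa> - s * (1 + b)) * ?Q powr (- (s * (2 + b)))"
        using a e by (intro mult_left_mono mult_right_mono powr_mono2) auto
      also have "(?Q powr c) powr (1 + \<kappa> - s * (1 + b)) = ?Q powr (c * (1 + \<kappa> - s * (1 + b)))"
        by (rule powr_powr)
      also have "real a powr (- 1 - \<kappa>) * ?Q powr (c * (1 + \<kappa> - s * (1 + b))) * ?Q powr (- (s * (2 + b)))
          = real a powr (- 1 - \<kappa>) * ?Q powr (c * (1 + \<kappa> - s * (1 + b)) - s * (2 + b))"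
        by (simp only: mult.assoc powr_add[symmetric]) simp
      also have "\<dots> \<le> real a powr (- 1 - \<kappa>) * ?Q powr (- \<sigma>)"
        using Q1[OF w] \<sigma>2 by (intro mult_left_mono powr_mono) auto
      finally show ?thesis using w p by simp
    next
      case False
      then have "E2 p = {}" by (auto simp: E2_def)
      then show ?thesis by (simp add: diam_pow_def)
    qed
    show "sum ?f F \<le> Z * B" if "finite F" for F
    proof -
      \<comment> \<open>Enlarging \<open>F\<close> to a product of projections lets the sum factor
        into one over digits and one over words.\<close>
      have "sum ?f F \<le> (\<Sum>p\<in>fst ` F \<times> snd ` F. ?f p)"
        using that by (intro sum_mono2 subset_fst_snd) auto
      also have "\<dots> = (\<Sum>a\<in>fst ` F. real a powr (- 1 - \<kappa>)) * (\<Sum>w\<in>snd ` F. ?g w)"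
        by (simp add: sum_product sum.cartesian_product split_beta)
      also have "\<dots> \<le> Z * B"
      proof (intro mult_mono)
        have "(\<Sum>w\<in>snd ` F. ?g w) = (\<Sum>w\<in>snd ` F \<inter> W. real (den w) powr (- \<sigma>))"
          using that by (simp add: sum.inter_restrict)
        then show "(\<Sum>w\<in>snd ` F. ?g w) \<le> B" using sum[of "snd ` F \<inter> W"] that by simp
        show "(\<Sum>a\<in>fst ` F. real a powr (- 1 - \<kappa>)) \<le> Z" using that by (intro Z) simp
        show "0 \<le> Z" using Z[of "{}"] by simp
        show "0 \<le> (\<Sum>w\<in>snd ` F. ?g w)" by (intro sum_nonneg) simp
      qed
      finally show ?thesis .
    qed
    show "infinite {p. x \<in> E2 p}" if x: "x \<in> A2" for x
    proof -
      let ?h = "\<lambda>n. (cf_quot x (Suc n), cf_word (cf_quot x) n)"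
      have "inj ?h"
      proof (rule injI)
        fix m n assume "?h m = ?h n"
        then have "length (cf_word (cf_quot x) m) = length (cf_word (cf_quot x) n)" by simp
        then show "m = n" by simp
      qed
      then have "infinite (?h ` (I x - H x))"
        using x by (simp add: A2_def finite_image_iff inj_on_subset)
      moreover have "?h ` (I x - H x) \<subseteq> {p. x \<in> E2 p}"
      proof clarify
        fix n assume n: "n \<in> I x" "n \<notin> H x"
        have irr: "x \<in> {0..<1} - \<rat>" using x A by (auto simp: A2_def)
        show "x \<in> E2 (cf_quot x (Suc n), cf_word (cf_quot x) n)"
          using n irr cf_quot_pos[OF irr, of "Suc n"] den_cf_word[of "cf_quot x" "Suc n"]
          by (simp add: E2_def I_def H_def den_cf_word del: cf_den.simps)
      qed
      ultimately show ?thesis using finite_subset by blast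
    qed
  qed
  moreover have "A \<subseteq> (\<Union>i. if i then A1 else A2)"
  proof
    fix x assume x: "x \<in> A"
    have "infinite ((I x \<inter> H x) \<union> (I x - H x))" using inf[OF x] by (simp add: I_def Int_Diff_Un)
    then have "x \<in> A1 \<or> x \<in> A2" using x by (auto simp: A1_def A2_def)
    then show "x \<in> (\<Union>i. if i then A1 else A2)" by (auto simp: UNIV_bool)
  qed
  moreover have "hausdorff_measure s (\<Union>i. if i then A1 else A2) = 0"
    using \<open>hausdorff_measure s A1 = 0\<close> \<open>hausdorff_measure s A2 = 0\<close>
    by (intro hausdorff_measure_UN_countable_eq_zero[OF s]) auto
  ultimately show ?thesis by (metis hausdorff_measure_mono le_zero_eq)
qed

section \<open>Upper bounds\<close>

text \<open>The sum over the words of length n is at most q ^ n times the value at the empty word. A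
  finite set of words uses finitely many digits and bounded lengths, so a geometric series dominates
  it.\<close>

lemma sum_words_le_geometric:
  fixes g :: "'a list \<Rightarrow> real"
  assumes nonneg: "\<And>w. 0 \<le> g w" and q: "0 \<le> q" "q < 1"
    and step: "\<And>X w. finite X \<Longrightarrow> X \<subseteq> D \<Longrightarrow> w \<in> lists D \<Longrightarrow> (\<Sum>a\<in>X. g (a # w)) \<le> q * g w"
    and F: "finite F" "F \<subseteq> lists D"
  shows "sum g F \<le> g [] / (1 - q)"
proof -
  define X where "X = (\<Union>w\<in>F. set w)"
  have X: "finite X" "X \<subseteq> D" using F by (auto simp: X_def)
  define N where "N = Max (length ` F)"
  define L where "L n = {w. set w \<subseteq> X \<and> length w = n}" for n
  have finL: "finite (L n)" for n unfolding L_def using X(1) by (rule finite_lists_length_eq)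
  have level: "sum g (L n) \<le> q ^ n * g []" for n
  proof (induction n)
    case 0
    have "L 0 = {[]}" by (auto simp: L_def)
    then show ?case by simp
  next
    case (Suc n)
    have "L (Suc n) = (\<lambda>(w, a). a # w) ` (L n \<times> X)"
      by (auto simp: L_def length_Suc_conv image_iff)
    then have "sum g (L (Suc n)) = (\<Sum>(w, a)\<in>L n \<times> X. g (a # w))"
      by (simp add: sum.reindex inj_on_def split_beta)
    also have "\<dots> = (\<Sum>w\<in>L n. \<Sum>a\<in>X. g (a # w))" by (simp add: sum.cartesian_product)
    also have "\<dots> \<le> (\<Sum>w\<in>L n. q * g w)"
      using X by (intro sum_mono step) (auto simp: L_def)
    also have "\<dots> \<le> q ^ Suc n * g []"
      using Suc q by (simp add: mult_left_mono mult.assoc flip: sum_distrib_left)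
    finally show ?case .
  qed
  have "F \<subseteq> (\<Union>n\<in>{..N}. L n)"
    using F by (auto simp: L_def X_def N_def)
  then have "sum g F \<le> sum g (\<Union>n\<in>{..N}. L n)"
    using finL nonneg by (intro sum_mono2) auto
  also have "\<dots> = (\<Sum>n\<le>N. sum g (L n))"
    using finL by (intro sum.UNION_disjoint) (auto simp: L_def)
  also have "\<dots> \<le> (\<Sum>n\<le>N. q ^ n * g [])" by (intro sum_mono level)
  also have "\<dots> = (\<Sum>n\<le>N. q ^ n) * g []" by (simp add: sum_distrib_right)
  also have "\<dots> \<le> (1 / (1 - q)) * g []"
  proof (rule mult_right_mono[OF _ nonneg])
    have "(\<Sum>n\<le>N. q ^ n) \<le> (\<Sum>n. q ^ n)"
      using q by (intro sum_le_suminf) auto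
    then show "(\<Sum>n\<le>N. q ^ n) \<le> 1 / (1 - q)" using q by (simp add: suminf_geometric)
  qed
  finally show ?thesis by simp
qed

text \<open>The length of the interval of all numbers whose expansion starts with the word, that is,
  the distance of \<open>word_val w 0\<close> and \<open>word_val w 1\<close>.\<close>

definition cyl_len :: "nat list \<Rightarrow> real" where
  "cyl_len w = 1 / (real (den w) * (real (den w) + real (pden w)))"

lemma cyl_len_pos:
  assumes "0 \<notin> set w"
  shows "cyl_len w > 0"
  using den_pos[OF assms] by (auto simp: cyl_len_def intro!: divide_pos_pos mult_pos_pos add_pos_nonneg)

lemma cyl_len_bounds:
  assumes "0 \<notin> set w"
  shows "1 / (2 * real (den w) ^ 2) \<le> cyl_len w" "cyl_len w \<le> 1 / real (den w) ^ 2"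
proof -
  have Q: "real (den w) > 0" "real (pden w) \<le> real (den w)"
    using den_pos[OF assms] pden_le_den[OF assms] by auto
  have "den w * (real (den w) + real (pden w)) \<le> den w * (2 * real (den w))"
    "den w * real (den w) \<le> den w * (real (den w) + real (pden w))"
    using Q by (auto intro!: mult_left_mono)
  then show "1 / (2 * real (den w) ^ 2) \<le> cyl_len w" "cyl_len w \<le> 1 / real (den w) ^ 2"
    unfolding cyl_len_def power2_eq_square using Q
    by (auto intro!: frac_le mult_pos_pos add_pos_nonneg simp: mult_ac)
qed

text \<open>The factor 1 / 2 makes sums over children contract for powers above 1 and expand for
  powers below 1, up to the truncation of the digits. The upper bound for \<alpha> = \<infinity>
  uses the former, the free levels of the trees the latter.\<close>

lemma cyl_len_Cons_le:
  assumes "0 \<notin> set (a # w)"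
  shows "cyl_len (a # w) \<le> cyl_len w / 2"
proof -
  have Q: "real (den w) > 0" "real a \<ge> 1" using den_pos[of w] assms by auto
  let ?Q = "real (den w)" and ?P = "real (pden w)"
  have aQ: "real a * ?Q \<ge> ?Q" using Q by (simp add: mult_le_cancel_right1)
  have "(?Q + ?P) * (2 * ?Q) \<le> real (den (a # w)) * (real (den (a # w)) + ?Q)"
  proof (rule mult_mono)
    have "real (den (a # w)) = real a * ?Q + ?P" by (simp add: den_Cons)
    then show "?Q + ?P \<le> real (den (a # w))" "2 * ?Q \<le> real (den (a # w)) + ?Q"
      using aQ by linarith+
  qed (use Q in auto)
  then have "1 / (real (den (a # w)) * (real (den (a # w)) + ?Q)) \<le> 1 / ((?Q + ?P) * (2 * ?Q))"
    using Q by (intro frac_le) (auto intro!: mult_pos_pos add_pos_nonneg)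
  then show ?thesis by (simp add: cyl_len_def mult_ac)
qed

text \<open>The sum telescopes; the subtracted term is the length of the part where the next digit
  exceeds \<open>m\<close>.\<close>

lemma sum_cyl_len_Cons:
  assumes "0 \<notin> set w"
  shows "(\<Sum>a=1..m. cyl_len (a # w)) =
    cyl_len w - 1 / (real (den w) * ((real m + 1) * real (den w) + real (pden w)))"
proof (induction m)
  case 0
  then show ?case by (simp add: cyl_len_def)
next
  case (Suc m)
  let ?Q = "real (den w)" and ?P = "real (pden w)"
  have Q: "?Q > 0" using den_pos[OF assms] by simp
  define z where "z = (real m + 1) * ?Q + ?P"
  have "(real m + 1) * ?Q > 0" by (rule mult_pos_pos) (use Q in auto)
  then have z: "z > 0" unfolding z_def by (rule add_pos_nonneg) simp
  have "cyl_len (Suc m # w) = 1 / (z * (z + ?Q))"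
    by (simp add: cyl_len_def den_Cons z_def algebra_simps)
  also have "\<dots> = 1 / (?Q * z) - 1 / (?Q * (z + ?Q))"
    using z Q by (simp add: divide_simps)
  finally show ?case using Suc by (simp add: z_def algebra_simps)
qed

lemma sum_cyl_len_Cons_le:
  assumes "0 \<notin> set w" "finite X" "0 \<notin> X"
  shows "(\<Sum>a\<in>X. cyl_len (a # w)) \<le> cyl_len w"
proof -
  have "X \<subseteq> {1..Max X}"
  proof
    fix a assume a: "a \<in> X"
    then have "a \<noteq> 0" using assms(3) by metis
    then show "a \<in> {1..Max X}" using a assms(2) by simp
  qed
  moreover have "0 \<le> cyl_len (a # w)" if "a \<in> {1..Max X}" for a
    using that assms(1) cyl_len_pos[of "a # w"] by simp
  ultimately have "(\<Sum>a\<in>X. cyl_len (a # w)) \<le> (\<Sum>a=1..Max X. cyl_len (a # w))"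
    by (intro sum_mono2) auto
  also have "\<dots> \<le> cyl_len w" unfolding sum_cyl_len_Cons[OF assms(1)] by simp
  finally show ?thesis .
qed

text \<open>Children have total length at most that of the parent and each at most half of it, so
  for the power \<sigma> / 2 > 1 every level contracts by 2 powr (1 - \<sigma> / 2). The squares of
  the inverse denominators would not do directly: their sum over the children can exceed the value
  at the parent.\<close>

lemma sum_den_powr_bounded:
  assumes "\<sigma> > 2"
  obtains B where "\<And>F. finite F \<Longrightarrow> F \<subseteq> {w. 0 \<notin> set w} \<Longrightarrow> (\<Sum>w\<in>F. real (den w) powr (- \<sigma>)) \<le> B"
proof
  let ?\<tau> = "\<sigma> / 2"
  let ?g = "\<lambda>w. if 0 \<in> set w then 0 else cyl_len w powr ?\<tau>"
  let ?q = "(1 / 2) powr (?\<tau> - 1) :: real"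
  fix F :: "nat list set" assume F: "finite F" "F \<subseteq> {w. 0 \<notin> set w}"
  have le: "real (den w) powr (- \<sigma>) \<le> 2 powr ?\<tau> * ?g w" if "w \<in> F" for w
  proof -
    have w: "0 \<notin> set w" using F that by auto
    have Q: "real (den w) > 0" using den_pos[OF w] by simp
    have "real (den w) powr (- \<sigma>) = (real (den w) powr (- 2)) powr ?\<tau>" by (simp add: powr_powr)
    also have "real (den w) powr (- 2) = 1 / real (den w) ^ 2"
      using Q by (simp add: powr_minus powr_numeral divide_simps)
    also have "(1 / real (den w) ^ 2) powr ?\<tau> \<le> (2 * cyl_len w) powr ?\<tau>"
      using cyl_len_bounds(1)[OF w] assms by (intro powr_mono2) (auto simp: field_simps)
    also have "\<dots> = 2 powr ?\<tau> * ?g w"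
      using w cyl_len_pos[OF w] by (simp add: powr_mult)
    finally show ?thesis .
  qed
  have q: "0 \<le> ?q" "?q < 1" using assms powr_less_mono'[of "1 / 2" 0 "?\<tau> - 1"] by auto
  have "(\<Sum>a\<in>X. ?g (a # w)) \<le> ?q * ?g w"
    if X: "finite X" "X \<subseteq> {0<..}" and wl: "w \<in> lists {0<..}" for X w
  proof -
    have w: "0 \<notin> set w" using wl by auto
    have "(\<Sum>a\<in>X. ?g (a # w)) \<le> (\<Sum>a\<in>X. cyl_len (a # w) * (?q * cyl_len w powr (?\<tau> - 1)))"
    proof (rule sum_mono)
      fix a assume "a \<in> X"
      then have aw: "0 \<notin> set (a # w)" using w X by auto
      have "?g (a # w) = cyl_len (a # w) * cyl_len (a # w) powr (?\<tau> - 1)"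
        using aw cyl_len_pos[OF aw] by (simp add: powr_diff)
      also have "\<dots> \<le> cyl_len (a # w) * (1 / 2 * cyl_len w) powr (?\<tau> - 1)"
        using cyl_len_Cons_le[OF aw] cyl_len_pos[OF aw] assms
        by (intro mult_left_mono powr_mono2) auto
      also have "(1 / 2 * cyl_len w) powr (?\<tau> - 1) = ?q * cyl_len w powr (?\<tau> - 1)"
        using cyl_len_pos[OF w] by (intro powr_mult)
      finally show "?g (a # w) \<le> cyl_len (a # w) * (?q * cyl_len w powr (?\<tau> - 1))" .
    qed
    also have "\<dots> = (\<Sum>a\<in>X. cyl_len (a # w)) * (?q * cyl_len w powr (?\<tau> - 1))"
      by (simp add: sum_distrib_right)
    also have "\<dots> \<le> cyl_len w * (?q * cyl_len w powr (?\<tau> - 1))"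
      using sum_cyl_len_Cons_le[OF w] X by (intro mult_right_mono) auto
    also have "\<dots> = ?q * ?g w" using w cyl_len_pos[OF w] by (simp add: powr_diff)
    finally show ?thesis .
  qed
  then have "sum ?g F \<le> ?g [] / (1 - ?q)"
    using F q by (intro sum_words_le_geometric[where D = "{0<..}"])
      (auto simp: subset_iff in_lists_conv_set intro: gr0I)
  then have "2 powr ?\<tau> * sum ?g F \<le> 2 powr ?\<tau> * (?g [] / (1 - ?q))"
    by (intro mult_left_mono) auto
  moreover have "(\<Sum>w\<in>F. real (den w) powr (- \<sigma>)) \<le> 2 powr ?\<tau> * sum ?g F"
    unfolding sum_distrib_left by (intro sum_mono le)
  ultimately show "(\<Sum>w\<in>F. real (den w) powr (- \<sigma>)) \<le> 2 powr ?\<tau> * (?g [] / (1 - ?q))" by linarith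
qed

text \<open>Each new digit contributes at most a powr (- \<sigma>), and for \<sigma> > 1 the sum of
  these over a \<ge> M is at most 1 / 2 once M is large. The bound 2 is 1 / (1 - 1 / 2). It is
  uniform in \<open>v\<close>, the beginning of the expansion where small digits may still
  occur.\<close>

lemma sum_den_powr_large_digits_bounded:
  assumes "\<sigma> > 1"
  obtains M where "M > 0" "\<And>F v. finite F \<Longrightarrow> F \<subseteq> (\<lambda>u. u @ v) ` lists {M..} \<Longrightarrow> 0 \<notin> set v \<Longrightarrow>
    (\<Sum>w\<in>F. real (den w) powr (- \<sigma>)) \<le> 2"
proof -
  have summable: "summable (\<lambda>a. real a powr (- \<sigma>))" using assms by (subst summable_real_powr_iff) auto
  then obtain N where N: "\<And>n. n \<ge> N \<Longrightarrow> norm (\<Sum>i. real (i + n) powr (- \<sigma>)) < 1 / 2"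
    using suminf_exist_split[OF _ summable, of "1 / 2"] by auto
  \<comment> \<open>The successor keeps the digit 0 out of the alphabet.\<close>
  define M where "M = Suc N"
  have tail: "(\<Sum>a\<in>X. real a powr (- \<sigma>)) \<le> 1 / 2" if X: "finite X" "X \<subseteq> {M..}" for X
  proof -
    have inj: "inj_on (\<lambda>a. a - M) X" using X(2) by (intro inj_onI) (metis atLeast_iff eq_diff_iff subsetD)
    have "(\<Sum>a\<in>X. real a powr (- \<sigma>)) = (\<Sum>i\<in>(\<lambda>a. a - M) ` X. real (i + M) powr (- \<sigma>))"
      using X by (subst sum.reindex[OF inj]) (auto intro!: sum.cong)
    also have "\<dots> \<le> (\<Sum>i. real (i + M) powr (- \<sigma>))"
      using X summable_ignore_initial_segment[OF summable, of M] by (intro sum_le_suminf) auto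
    also have "\<dots> \<le> 1 / 2" using N[of M] by (simp add: M_def)
    finally show ?thesis .
  qed
  have "(\<Sum>w\<in>F. real (den w) powr (- \<sigma>)) \<le> 2"
    if F: "finite F" "F \<subseteq> (\<lambda>u. u @ v) ` lists {M..}" and v: "0 \<notin> set v" for F v
  proof -
    let ?g = "\<lambda>u. real (den (u @ v)) powr (- \<sigma>)"
    obtain G where G: "finite G" "G \<subseteq> lists {M..}" "F = (\<lambda>u. u @ v) ` G"
      using F by (meson finite_subset_image)
    have "(\<Sum>a\<in>X. ?g (a # u)) \<le> 1 / 2 * ?g u"
      if X: "finite X" "X \<subseteq> {M..}" and u: "u \<in> lists {M..}" for X u
    proof -
      have "0 \<notin> set (u @ v)" using u v by (auto simp: M_def)
      then have Q: "real (den (u @ v)) > 0" using den_pos by simp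
      have "(\<Sum>a\<in>X. ?g (a # u)) \<le> (\<Sum>a\<in>X. real a powr (- \<sigma>) * ?g u)"
      proof (rule sum_mono)
        fix a assume "a \<in> X"
        then have a: "real a > 0" using X by (auto simp: M_def)
        have "real a * real (den (u @ v)) \<le> real (den (a # u @ v))"
          using den_ge_mult[of a "u @ v"] by (simp flip: of_nat_mult)
        then have "?g (a # u) \<le> (real a * real (den (u @ v))) powr (- \<sigma>)"
          using a Q assms by (auto intro!: powr_mono2' mult_pos_pos)
        also have "\<dots> = real a powr (- \<sigma>) * ?g u" by (simp add: powr_mult)
        finally show "?g (a # u) \<le> real a powr (- \<sigma>) * ?g u" .
      qed
      also have "\<dots> = (\<Sum>a\<in>X. real a powr (- \<sigma>)) * ?g u" by (simp add: sum_distrib_right)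
      also have "\<dots> \<le> 1 / 2 * ?g u" using tail[OF X] by (intro mult_right_mono) auto
      finally show ?thesis .
    qed
    then have "sum ?g G \<le> ?g [] / (1 - 1 / 2)"
      using G by (intro sum_words_le_geometric[where D = "{M..}"]) auto
    also have "\<dots> \<le> 1 / (1 - 1 / 2)"
    proof (rule divide_right_mono)
      have "real (den v) \<ge> 1" using den_pos[OF v] by simp
      then show "?g [] \<le> 1" using assms powr_mono2'[of "- \<sigma>" 1 "real (den v)"] by simp
    qed auto
    also have "sum ?g G = (\<Sum>w\<in>F. real (den w) powr (- \<sigma>))"
      unfolding G by (subst sum.reindex) (auto simp: inj_on_def)
    finally show ?thesis by simp
  qed
  then show thesis by (intro that[of M]) (auto simp: M_def)
qed

section \<open>The quadratic equation of the finite case\<close>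

definition root_u :: "real \<Rightarrow> real" where
  "root_u \<beta> = (\<beta> + sqrt (\<beta>\<^sup>2 + 4)) / 2"

lemma root_u_sq: "root_u \<beta> ^ 2 = \<beta> * root_u \<beta> + 1"
proof -
  have "(sqrt (\<beta>\<^sup>2 + 4))\<^sup>2 = \<beta>\<^sup>2 + 4" by simp
  then show ?thesis unfolding root_u_def by (simp add: power2_eq_square field_simps)
qed

lemma root_u_ge:
  assumes "\<beta> \<ge> 0"
  shows "root_u \<beta> \<ge> 1" "root_u \<beta> > \<beta>"
proof -
  have "sqrt (\<beta>\<^sup>2 + 4) \<ge> sqrt (2\<^sup>2)" by (subst real_sqrt_le_iff) simp
  then show "root_u \<beta> \<ge> 1" using assms by (simp add: root_u_def)
  have "sqrt (\<beta>\<^sup>2 + 4) > sqrt (\<beta>\<^sup>2)" by (subst real_sqrt_less_iff) simp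
  then show "root_u \<beta> > \<beta>" using assms by (simp add: root_u_def)
qed

lemma dim_eq_root_u: "2 / (\<beta> + 2 + sqrt (\<beta>\<^sup>2 + 4)) = 1 / (1 + root_u \<beta>)"
proof -
  have *: "\<beta> + 2 + sqrt (\<beta>\<^sup>2 + 4) = 2 * (1 + root_u \<beta>)" by (simp add: root_u_def)
  show ?thesis unfolding * by (simp only: divide_divide_eq_left[symmetric])
qed

text \<open>Keeps the critical strict inequality of the finite case when \<beta> is lowered and the
  summation exponent is raised by the same small amount.\<close>

lemma eventually_less_by_continuity:
  fixes f :: "real \<Rightarrow> real"
  assumes "isCont f \<beta>" "f \<beta> > y"
  obtains e where "e > 0" "\<And>b. \<bar>b - \<beta>\<bar> < e \<Longrightarrow> f b > y"
proof -
  have "eventually (\<lambda>b. f b > y) (at \<beta>)"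
    using order_tendstoD(1)[OF isContD[OF assms(1)] assms(2)] .
  then obtain e where "e > 0" "\<And>b. b \<noteq> \<beta> \<Longrightarrow> dist b \<beta> < e \<Longrightarrow> f b > y"
    unfolding eventually_at by auto
  then have "f b > y" if "\<bar>b - \<beta>\<bar> < e" for b
    using assms(2) \<open>\<bar>b - \<beta>\<bar> < e\<close> by (cases "b = \<beta>") (auto simp: dist_real_def)
  then show thesis using \<open>e > 0\<close> by (intro that[of e]) auto
qed

text \<open>All words contribute, so the exponent \<sigma> has to exceed 2. Since s * (1 + \<beta>)
  > 1, the sum over the last digit converges by itself.\<close>

theorem hausdorff_dim_G_set_le:
  assumes \<beta>: "0 \<le> \<beta>"
  shows "hausdorff_dim (G_set \<alpha> \<beta>) \<le> ereal (2 / (\<beta> + 2))"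
proof (rule hausdorff_dim_leI[of _ "2 / (\<beta> + 2) + 1"])
  fix s assume s: "2 / (\<beta> + 2) < s"
  have s0: "s > 0" using s \<beta> by (smt (verit) divide_nonneg_pos)
  have s1: "s * (2 + \<beta>) > 2" using s \<beta> by (simp add: field_simps)
  \<comment> \<open>This is 2 * (1 + \<beta>) \<ge> 2 + \<beta>, where \<beta> \<ge> 0
    enters.\<close>
  have s2: "s * (1 + \<beta>) > 1"
  proof -
    have "2 * (s * (1 + \<beta>)) \<ge> s * (2 + \<beta>)" using s0 \<beta> by (simp add: algebra_simps)
    then show ?thesis using s1 by linarith
  qed
  \<comment> \<open>Half of the available slack in both inequalities, so that they stay strict for b
    = \<beta> - \<eta>; the cap 1 gives b \<ge> - 1.\<close>
  define \<eta> where "\<eta> = min (min (s * (2 + \<beta>) - 2) (s * (1 + \<beta>) - 1) / (2 * s)) 1"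
  define b where "b = \<beta> - \<eta>"
  have "\<eta> > 0" using s0 s1 s2 by (auto simp: \<eta>_def)
  have "\<eta> \<le> min (s * (2 + \<beta>) - 2) (s * (1 + \<beta>) - 1) / (2 * s)"
    unfolding \<eta>_def by (rule min.cobounded1)
  then have "\<eta> * (2 * s) \<le> min (s * (2 + \<beta>) - 2) (s * (1 + \<beta>) - 1)"
    using s0 by (subst (asm) pos_le_divide_eq) auto
  then have \<eta>s: "\<eta> * (2 * s) \<le> s * (2 + \<beta>) - 2" "\<eta> * (2 * s) \<le> s * (1 + \<beta>) - 1" by auto
  have "\<eta> \<le> 1" unfolding \<eta>_def by (rule min.cobounded2)
  then have b: "b < \<beta>" "b \<ge> - 1" "s * (2 + b) > 2" "s * (1 + b) > 1"
  proof -
    have "s * (2 + b) = s * (2 + \<beta>) - \<eta> * s" "s * (1 + b) = s * (1 + \<beta>) - \<eta> * s"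
      by (auto simp: b_def algebra_simps)
    moreover have "\<eta> * (2 * s) = 2 * (\<eta> * s)" "\<eta> * s > 0" using \<open>\<eta> > 0\<close> s0 by auto
    ultimately show "s * (2 + b) > 2" "s * (1 + b) > 1" using \<eta>s s1 s2 by linarith+
    show "b < \<beta>" "b \<ge> - 1" using \<open>\<eta> > 0\<close> \<open>\<eta> \<le> 1\<close> \<beta> by (auto simp: b_def)
  qed
  obtain B where B: "\<And>F. finite F \<Longrightarrow> F \<subseteq> {w. 0 \<notin> set w} \<Longrightarrow>
      (\<Sum>w\<in>F. real (den w) powr (- (s * (2 + b)))) \<le> B"
    using sum_den_powr_bounded[OF b(3)] by blast
  \<comment> \<open>With this \<kappa> the cost exponent 1 + \<kappa> - s * (1 + b) is 0, and the
    second cover has exponent \<sigma> itself.\<close>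
  show "hausdorff_measure s (G_set \<alpha> \<beta>) = 0"
  proof (rule hausdorff_measure_large_products_eq_zero[where W = "{w. 0 \<notin> set w}" and b = b
        and c = \<beta> and \<kappa> = "s * (1 + b) - 1" and \<sigma> = "s * (2 + b)"])
    fix x assume x: "x \<in> G_set \<alpha> \<beta>"
    then have irr: "x \<in> {0..<1} - \<rat>" by (simp add: G_set_def)
    have "ereal b < ereal \<beta>" using b by simp
    also have "\<dots> \<le> log_growth x" using x by (simp add: G_set_def)
    finally show "infinite {n. cf_word (cf_quot x) n \<in> {w. 0 \<notin> set w} \<and>
      real (cf_quot x (Suc n) * cf_quot x (Suc (Suc n))) \<ge> real (cf_den (cf_quot x) (Suc n)) powr b}"
      using log_growth_frequently[OF irr, of b] zero_notin_cf_word[OF irr]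
      by (simp del: cf_den.simps)
  qed (use s0 b \<beta> B in \<open>auto simp: G_set_def\<close>)
qed (use \<beta> in auto)

text \<open>The terms of a convergent series tend to 0, which forces the digits to infinity.\<close>

lemma finite_conv_exponent_quot_tendsto:
  assumes x: "x \<in> {0..<1} - \<rat>" and "conv_exponent x \<noteq> \<infinity>"
  obtains N where "\<And>n. n \<ge> N \<Longrightarrow> cf_quot x (Suc n) \<ge> M"
proof -
  have "{ereal s | s. 0 \<le> s \<and> summable (\<lambda>n. real (cf_quot x (Suc n)) powr (- s))} \<noteq> {}"
    (is "?S \<noteq> {}")
  proof
    assume *: "?S = {}"
    have "conv_exponent x = \<infinity>" unfolding conv_exponent_def * by (simp add: top_ereal_def)
    then show False using assms(2) by contradiction
  qed
  then obtain s where s: "0 \<le> s" "summable (\<lambda>n. real (cf_quot x (Suc n)) powr (- s))" by auto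
  have "eventually (\<lambda>n. real (cf_quot x (Suc n)) powr (- s) < (real M + 1) powr (- s)) sequentially"
    using summable_LIMSEQ_zero[OF s(2)] by (rule order_tendstoD) auto
  then obtain N where N: "\<And>n. n \<ge> N \<Longrightarrow> real (cf_quot x (Suc n)) powr (- s) < (real M + 1) powr (- s)"
    by (auto simp: eventually_sequentially)
  have "cf_quot x (Suc n) \<ge> M" if "n \<ge> N" for n
  proof (rule ccontr)
    assume "\<not> cf_quot x (Suc n) \<ge> M"
    then have "(real M + 1) powr (- s) \<le> real (cf_quot x (Suc n)) powr (- s)"
      using cf_quot_pos[OF x, of "Suc n"] s(1) by (intro powr_mono2') auto
    then show False using N[OF that] by linarith
  qed
  then show thesis by (rule that)
qed

text \<open>Digits are eventually large, so \<sigma> > 1 suffices. With the threshold c = u - 1 both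
  covers meet this requirement for every s above 1 / (1 + u).\<close>

theorem hausdorff_dim_G_set_finite_le:
  assumes \<beta>: "0 \<le> \<beta>" and \<alpha>: "\<alpha> \<noteq> \<infinity>"
  shows "hausdorff_dim (G_set \<alpha> \<beta>) \<le> ereal (1 / (1 + root_u \<beta>))"
proof (rule hausdorff_dim_leI)
  let ?u = "root_u \<beta>"
  have u: "?u \<ge> 1" "?u > \<beta>" using root_u_ge[OF \<beta>] by auto
  show "1 / (1 + ?u) < 1 / (1 + \<beta>)" using u \<beta> by (intro divide_strict_left_mono) auto
  show "0 \<le> 1 / (1 + ?u)" using u by simp
  fix s assume s: "1 / (1 + ?u) < s" "s < 1 / (1 + \<beta>)"
  have s0: "s > 0" using s u by (smt (verit) divide_nonneg_pos)
  have s1: "s * (1 + ?u) > 1" using s u by (simp add: field_simps)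
  have s2: "s * (1 + \<beta>) < 1" using s \<beta> by (simp add: field_simps)
  \<comment> \<open>The exponent of the second cover before perturbation. By the quadratic equation
    it equals u * (s * (1 + u)) - (u - 1), which exceeds 1 exactly when s * (1 + u) does.\<close>
  have "s * (2 + \<beta>) - (?u - 1) * (1 - s * (1 + \<beta>)) = s * (1 + ?u + \<beta> * ?u) - (?u - 1)"
    by (simp add: algebra_simps)
  also have "1 + ?u + \<beta> * ?u = ?u * (1 + ?u)" using root_u_sq[of \<beta>] by (simp add: algebra_simps power2_eq_square)
  also have "s * (?u * (1 + ?u)) = ?u * (s * (1 + ?u))" by simp
  finally have crit: "s * (2 + \<beta>) - (?u - 1) * (1 - s * (1 + \<beta>)) > 1"
    using s1 u mult_strict_left_mono[OF s1, of ?u] by simp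
  \<comment> \<open>One parameter h both lowers \<beta> to b and serves as \<kappa>.\<close>
  obtain \<eta> where \<eta>: "\<eta> > 0"
    "\<And>h. \<bar>h - 0\<bar> < \<eta> \<Longrightarrow> s * (2 + (\<beta> - h)) - (?u - 1) * (1 + h - s * (1 + (\<beta> - h))) > 1"
    by (rule eventually_less_by_continuity[where f = "\<lambda>h. s * (2 + (\<beta> - h)) - (?u - 1) * (1 + h - s * (1 + (\<beta> - h)))" and \<beta> = 0 and y = 1])
      (use crit in \<open>auto intro!: continuous_intros\<close>)
  define h where "h = min (\<eta> / 2) 1"
  define b where "b = \<beta> - h"
  have h: "h > 0" "h \<le> 1" "\<bar>h - 0\<bar> < \<eta>" using \<eta>(1) by (auto simp: h_def min_def)
  define \<sigma> where "\<sigma> = min (s * (2 + (?u - 1))) (s * (2 + b) - (?u - 1) * (1 + h - s * (1 + b)))"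
  have "\<sigma> > 1" using \<eta>(2)[OF h(3)] s1 by (simp add: \<sigma>_def b_def)
  obtain M where M: "M > 0" "\<And>F v. finite F \<Longrightarrow> F \<subseteq> (\<lambda>u. u @ v) ` lists {M..} \<Longrightarrow> 0 \<notin> set v \<Longrightarrow>
    (\<Sum>w\<in>F. real (den w) powr (- \<sigma>)) \<le> 2"
    using sum_den_powr_large_digits_bounded[OF \<open>\<sigma> > 1\<close>] by blast
  \<comment> \<open>A bound \<open>M\<close> valid from an unknown position on becomes a countable
    union over the possible beginnings \<open>v\<close>.\<close>
  define A where "A v = {x \<in> G_set \<alpha> \<beta>. cf_word (cf_quot x) (length v) = v \<and>
      (\<forall>n\<ge>length v. cf_quot x (Suc n) \<ge> M)}" for v
  have "hausdorff_measure s (A v) = 0" for v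
  proof (cases "0 \<in> set v")
    case True
    have "x \<notin> A v" for x
      using zero_notin_cf_word[of x "length v"] True by (auto simp: A_def G_set_def)
    then have "A v = {}" by blast
    then show ?thesis using hausdorff_measure_empty[OF s0] by simp
  next
    case False
    show ?thesis
    proof (rule hausdorff_measure_large_products_eq_zero[where W = "(\<lambda>u. u @ v) ` lists {M..}" and b = b
        and c = "?u - 1" and \<kappa> = h and \<sigma> = \<sigma>])
      fix x assume x: "x \<in> A v"
      then have irr: "x \<in> {0..<1} - \<rat>" by (simp add: A_def G_set_def)
      have "ereal b < ereal \<beta>" using h by (simp add: b_def)
      also have "\<dots> \<le> log_growth x" using x by (simp add: A_def G_set_def)
      finally have "infinite {n. real (cf_quot x (Suc n) * cf_quot x (Suc (Suc n)))
         \<ge> real (cf_den (cf_quot x) (Suc n)) powr b}" (is "infinite ?N")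
        by (rule log_growth_frequently[OF irr])
      then have inf: "infinite (?N - {..<length v})" by (rule Diff_infinite_finite[rotated]) simp
      have mem: "cf_word (cf_quot x) n \<in> (\<lambda>u. u @ v) ` lists {M..}" if "n \<ge> length v" for n
      proof -
        have "cf_word (cf_quot x) n = cf_word (\<lambda>i. cf_quot x (i + length v)) (n - length v) @ v"
          using that x cf_word_add[of "cf_quot x" "length v" "n - length v"] by (simp add: A_def)
        moreover have "cf_quot x (i + length v) \<ge> M" if "i \<ge> 1" for i
        proof -
          have "cf_quot x (Suc (i - 1 + length v)) \<ge> M" using x by (simp add: A_def)
          then show ?thesis using that by simp
        qed
        then have "cf_word (\<lambda>i. cf_quot x (i + length v)) (n - length v) \<in> lists {M..}"
          by (auto simp: in_lists_conv_set set_cf_word)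
        ultimately show ?thesis by blast
      qed
      show "infinite {n. cf_word (cf_quot x) n \<in> (\<lambda>u. u @ v) ` lists {M..} \<and>
        real (cf_quot x (Suc n) * cf_quot x (Suc (Suc n))) \<ge> real (cf_den (cf_quot x) (Suc n)) powr b}"
        by (rule infinite_super[OF _ inf]) (use mem in \<open>auto simp only: Diff_iff mem_Collect_eq lessThan_iff not_less\<close>)
    next
      show "s * (1 + b) \<le> 1 + h"
      proof -
        have "s * (1 + b) \<le> s * (1 + \<beta>)" using s0 h by (simp add: b_def)
        then show ?thesis using s2 h by linarith
      qed
    next
      show "\<sigma> \<le> s * (2 + (?u - 1))" "\<sigma> \<le> s * (2 + b) - (?u - 1) * (1 + h - s * (1 + b))"
        by (auto simp: \<sigma>_def)
    next
      show "0 \<notin> set w" if "w \<in> (\<lambda>u. u @ v) ` lists {M..}" for w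
        using that False M(1) by (auto simp: in_lists_conv_set)
    next
      show "(\<Sum>w\<in>F. real (den w) powr (- \<sigma>)) \<le> 2" if "finite F" "F \<subseteq> (\<lambda>u. u @ v) ` lists {M..}" for F
        using M(2)[OF that False] .
    qed (use s0 u h \<beta> in \<open>auto simp: A_def G_set_def b_def\<close>)
  qed
  then have "hausdorff_measure s (\<Union>v. A v) = 0"
    by (rule hausdorff_measure_UN_countable_eq_zero[OF s0])
  moreover have "G_set \<alpha> \<beta> \<subseteq> (\<Union>v. A v)"
  proof
    fix x assume x: "x \<in> G_set \<alpha> \<beta>"
    then have irr: "x \<in> {0..<1} - \<rat>" and "conv_exponent x \<noteq> \<infinity>" using \<alpha> by (auto simp: G_set_def)
    then obtain N where "\<And>n. n \<ge> N \<Longrightarrow> cf_quot x (Suc n) \<ge> M"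
      using finite_conv_exponent_quot_tendsto by blast
    then have "x \<in> A (cf_word (cf_quot x) N)" using x by (auto simp: A_def)
    then show "x \<in> (\<Union>v. A v)" by blast
  qed
  ultimately show "hausdorff_measure s (G_set \<alpha> \<beta>) = 0" by (metis hausdorff_measure_mono le_zero_eq)
qed

section \<open>Mass distributions on trees of digits\<close>

primrec in_tree :: "(nat list \<Rightarrow> nat set) \<Rightarrow> nat list \<Rightarrow> bool" where
  "in_tree D [] \<longleftrightarrow> True"
| "in_tree D (a # w) \<longleftrightarrow> in_tree D w \<and> a \<in> D w"

definition cf_tree_set :: "(nat list \<Rightarrow> nat set) \<Rightarrow> real set" where
  "cf_tree_set D = {x \<in> {0..<1} - \<rat>. \<forall>n. in_tree D (cf_word (cf_quot x) n)}"

lemma cf_word_inject: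
  assumes x: "x \<in> {0..<1} - \<rat>" and y: "y \<in> {0..<1} - \<rat>"
    and eq: "\<And>n. cf_word (cf_quot x) n = cf_word (cf_quot y) n"
  shows "x = y"
proof (rule ccontr)
  assume "x \<noteq> y"
  then obtain n where n: "n > 0" "inverse (real n) < \<bar>x - y\<bar>"
    using ex_inverse_of_nat_less[of "\<bar>x - y\<bar>"] by auto
  let ?w = "cf_word (cf_quot x) n"
  have w: "0 \<notin> set ?w" by (rule zero_notin_cf_word[OF x])
  have "\<bar>x - y\<bar> = \<bar>word_val ?w (gauss_orbit n x) - word_val ?w (gauss_orbit n y)\<bar>"
    using word_val_cf_word[OF x, of n] word_val_cf_word[OF y, of n] eq by simp
  also have "\<dots> \<le> 1 / real (den ?w) ^ 2"
    using gauss_orbit_bounds[OF x, of n] gauss_orbit_bounds[OF y, of n]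
    by (intro word_val_diff_le[OF w]) auto
  also have "\<dots> \<le> 1 / real n"
  proof (rule divide_left_mono)
    have "real n * 1 \<le> real (den ?w) * real (den ?w)"
      using length_le_den[OF w] den_pos[OF w] n by (intro mult_mono) auto
    then show "real n \<le> real (den ?w) ^ 2" by (simp add: power2_eq_square)
  qed (use n den_pos[OF w] in auto)
  finally show False using n by (simp add: inverse_eq_divide)
qed

text \<open>The mass \<open>\<mu>\<close> only has to be superadditive. If the cylinders meeting a cover had less mass
  than the root, one could follow children with the same defect for ever, and the resulting branch
  would avoid the cover; neither a measure nor compactness is needed.\<close>

lemma hausdorff_measure_tree_nonzero:
  fixes D :: "nat list \<Rightarrow> nat set" and \<mu> :: "nat list \<Rightarrow> real" and s C :: real
  defines "K \<equiv> cf_tree_set D"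
  assumes C: "C > 0"
    and fin: "\<And>w. in_tree D w \<Longrightarrow> finite (D w)"
    and pos: "\<And>w. in_tree D w \<Longrightarrow> 0 \<notin> D w"
    and root: "\<mu> [] > 0" and nonneg: "\<And>w. 0 \<le> \<mu> w"
    and super: "\<And>w. in_tree D w \<Longrightarrow> \<mu> w \<le> (\<Sum>a\<in>D w. \<mu> (a # w))"
    and small: "\<And>x. x \<in> K \<Longrightarrow> (\<lambda>n. \<mu> (cf_word (cf_quot x) n)) \<longlonglongrightarrow> 0"
    and sep: "\<And>x y w a b. x \<in> K \<Longrightarrow> y \<in> K \<Longrightarrow> cf_word (cf_quot x) (Suc (length w)) = a # w \<Longrightarrow>
      cf_word (cf_quot y) (Suc (length w)) = b # w \<Longrightarrow> a < b \<Longrightarrow>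
      (\<Sum>d\<in>D w \<inter> {a..b}. \<mu> (d # w)) \<le> C * dist x y powr s"
    and s: "s > 0"
  shows "hausdorff_measure s K \<noteq> 0"
proof
  assume null: "hausdorff_measure s K = 0"
  have pos': "0 < ennreal (\<mu> [] / (2 * C))" using root C by simp
  obtain U :: "nat \<Rightarrow> real set" where U: "K \<subseteq> (\<Union>i. U i)" "\<And>i. bounded (U i)"
    "(\<Sum>i. ennreal (diam_pow s (U i))) < ennreal (\<mu> [] / (2 * C))"
    by (rule hausdorff_measure_zero_cover[OF null zero_less_one pos']) blast
  have Kirr: "x \<in> {0..<1} - \<rat>" if "x \<in> K" for x using that by (simp add: K_def cf_tree_set_def)
  have Ktree: "in_tree D (cf_word (cf_quot x) n)" if "x \<in> K" for x n
    using that by (simp add: K_def cf_tree_set_def)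
  \<comment> \<open>Each covering set is replaced by finitely many cylinders of comparable mass. A
    single point gets a deep cylinder of mass below \<eta>; otherwise the points are followed to
    their first branching.\<close>
  have piece: "\<exists>W. finite W \<and> (\<forall>x\<in>K \<inter> V. \<exists>n. cf_word (cf_quot x) n \<in> W) \<and>
      sum \<mu> W \<le> C * diam_pow s V + \<eta>" if V: "bounded V" and \<eta>: "\<eta> > 0" for V \<eta>
  proof -
    have rhs: "0 \<le> C * diam_pow s V" using C diam_pow_nonneg[of s V] by simp
    consider "K \<inter> V = {}" | x where "K \<inter> V = {x}" | x y where "x \<in> K \<inter> V" "y \<in> K \<inter> V" "x \<noteq> y"
      by blast
    then show ?thesis
    proof cases
      case 1
      then show ?thesis using rhs \<eta> by (intro exI[of _ "{}"]) auto
    next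
      case (2 x)
      then have "eventually (\<lambda>n. \<mu> (cf_word (cf_quot x) n) < \<eta>) sequentially"
        using small[of x] \<eta> by (intro order_tendstoD) auto
      then obtain n where "\<mu> (cf_word (cf_quot x) n) < \<eta>"
        by (meson eventually_sequentially order_refl)
      then show ?thesis using 2 rhs by (intro exI[of _ "{cf_word (cf_quot x) n}"]) auto
    next
      case (3 x y)
      define P where "P n \<longleftrightarrow> (\<forall>x\<in>K \<inter> V. \<forall>y\<in>K \<inter> V. cf_word (cf_quot x) n = cf_word (cf_quot y) n)" for n
      have "\<exists>n. \<not> P n"
      proof (rule ccontr)
        assume "\<not> (\<exists>n. \<not> P n)"
        then have eq: "cf_word (cf_quot x) n = cf_word (cf_quot y) n" for n
          using 3(1,2) unfolding P_def by blast
        have "x = y" by (rule cf_word_inject[OF Kirr Kirr eq]) (use 3(1,2) in auto)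
        then show False using 3(3) by simp
      qed
      \<comment> \<open>The first level at which the points of the set disagree; its predecessor
        \<open>m\<close> carries their common word.\<close>
      then obtain n where n: "\<not> P n" "\<And>k. k < n \<Longrightarrow> P k"
        using exists_least_iff[of "\<lambda>n. \<not> P n"] by blast
      have "P 0" by (simp add: P_def)
      then obtain m where "n = Suc m" using n(1) by (cases n) auto
      then have m: "P m" "\<not> P (Suc m)" using n by auto
      define w where "w = cf_word (cf_quot x) m"
      have w: "cf_word (cf_quot z) (Suc m) = cf_quot z (Suc m) # w" if "z \<in> K \<inter> V" for z
      proof -
        have "cf_word (cf_quot z) m = w" using m(1) 3(1) that unfolding P_def w_def by blast
        then show ?thesis by simp
      qed
      have lw: "length w = m" by (simp add: w_def)
      define X where "X = (\<lambda>z. cf_quot z (Suc m)) ` (K \<inter> V)"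
      have tw: "in_tree D w" using Ktree[of x m] 3(1) by (simp add: w_def)
      have "X \<subseteq> D w"
      proof -
        have "cf_quot z (Suc m) \<in> D w" if "z \<in> K \<inter> V" for z
          using Ktree[of z "Suc m"] w[OF that] that by simp
        then show ?thesis by (auto simp: X_def)
      qed
      then have X: "finite X" "X \<noteq> {}"
        using finite_subset[OF _ fin[OF tw]] 3(1) by (auto simp: X_def)
      define a b where "a = Min X" and "b = Max X"
      obtain z1 z2 where z12: "z1 \<in> K \<inter> V" "z2 \<in> K \<inter> V"
        "cf_word (cf_quot z1) (Suc m) \<noteq> cf_word (cf_quot z2) (Suc m)"
        using m(2) unfolding P_def by blast
      then have z: "z1 \<in> K \<inter> V" "z2 \<in> K \<inter> V" "cf_quot z1 (Suc m) \<noteq> cf_quot z2 (Suc m)"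
        unfolding w[OF z12(1)] w[OF z12(2)] by auto
      have "a < b"
      proof -
        have "cf_quot z1 (Suc m) \<in> X" "cf_quot z2 (Suc m) \<in> X" using z by (auto simp: X_def)
        then have "a \<le> cf_quot z1 (Suc m)" "a \<le> cf_quot z2 (Suc m)"
          "cf_quot z1 (Suc m) \<le> b" "cf_quot z2 (Suc m) \<le> b" using X by (auto simp: a_def b_def)
        then show ?thesis using z(3) by linarith
      qed
      obtain p where p: "p \<in> K \<inter> V" "cf_quot p (Suc m) = a"
        using Min_in[OF X] by (metis (no_types, lifting) X_def a_def imageE)
      obtain q where q: "q \<in> K \<inter> V" "cf_quot q (Suc m) = b"
        using Max_in[OF X] by (metis (no_types, lifting) X_def b_def imageE)
      define W where "W = (\<lambda>d. d # w) ` (D w \<inter> {a..b})"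
      have "sum \<mu> W = (\<Sum>d\<in>D w \<inter> {a..b}. \<mu> (d # w))"
        unfolding W_def by (subst sum.reindex) (auto simp: inj_on_def)
      also have "\<dots> \<le> C * dist p q powr s"
        using p q w[OF p(1)] w[OF q(1)] lw \<open>a < b\<close> by (intro sep) auto
      also have "\<dots> \<le> C * diam_pow s V"
      proof (rule mult_left_mono)
        have "dist p q \<le> diameter V" using V p q by (intro diameter_bounded_bound) auto
        then show "dist p q powr s \<le> diam_pow s V"
          using p s by (auto simp: diam_pow_def intro!: powr_mono2)
      qed (use C in simp)
      finally have "sum \<mu> W \<le> C * diam_pow s V + \<eta>" using \<eta> by simp
      moreover have "\<exists>n. cf_word (cf_quot z) n \<in> W" if zV: "z \<in> K \<inter> V" for z
      proof -
        have "cf_quot z (Suc m) \<in> X" using zV by (simp add: X_def)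
        then have "cf_quot z (Suc m) \<in> D w \<inter> {a..b}"
          using X \<open>X \<subseteq> D w\<close> by (auto simp: a_def b_def)
        then have "cf_word (cf_quot z) (Suc m) \<in> W" unfolding w[OF zV] W_def by (rule imageI)
        then show ?thesis by blast
      qed
      moreover have "finite W" using fin[OF tw] by (simp add: W_def)
      ultimately show ?thesis by (intro exI[of _ W]) blast
    qed
  qed
  \<comment> \<open>These errors add up to half of the root mass, and the choice of \<open>U\<close>
    keeps the diameter terms below the other half.\<close>
  define \<eta> where "\<eta> i = \<mu> [] / 2 * (1 / 2) ^ Suc i" for i
  have \<eta>pos: "\<eta> i > 0" for i using root by (simp add: \<eta>_def)
  have "\<forall>i. \<exists>W. finite W \<and> (\<forall>x\<in>K \<inter> U i. \<exists>n. cf_word (cf_quot x) n \<in> W) \<and>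
      sum \<mu> W \<le> C * diam_pow s (U i) + \<eta> i" using piece[OF U(2) \<eta>pos] by blast
  then obtain W where W: "\<And>i. finite (W i)"
    "\<And>i x. x \<in> K \<inter> U i \<Longrightarrow> \<exists>n. cf_word (cf_quot x) n \<in> W i"
    "\<And>i. sum \<mu> (W i) \<le> C * diam_pow s (U i) + \<eta> i" by metis
  \<comment> \<open>The mass of the chosen cylinders inside the cylinder of \<open>v\<close>; as
    words are reversed, \<open>u @ v\<close> extends \<open>v\<close>.\<close>
  define \<phi> where "\<phi> i v = sum \<mu> {w \<in> W i. \<exists>u. w = u @ v}" for i v
  define \<Phi> where "\<Phi> v = (\<Sum>i. ennreal (\<phi> i v))" for v
  have \<phi>0: "0 \<le> \<phi> i v" for i v unfolding \<phi>_def by (intro sum_nonneg nonneg)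
  have root_lt: "\<Phi> [] < ennreal (\<mu> [])"
  proof -
    have "\<Phi> [] \<le> (\<Sum>i. ennreal C * ennreal (diam_pow s (U i)) + ennreal (\<eta> i))"
      unfolding \<Phi>_def
    proof (intro suminf_le)
      fix i
      have "ennreal (\<phi> i []) \<le> ennreal (C * diam_pow s (U i) + \<eta> i)"
        using W(3)[of i] by (intro ennreal_leI) (simp add: \<phi>_def)
      also have "\<dots> = ennreal C * ennreal (diam_pow s (U i)) + ennreal (\<eta> i)"
        using C \<eta>pos[of i] diam_pow_nonneg[of s "U i"] by (simp add: ennreal_plus ennreal_mult)
      finally show "ennreal (\<phi> i []) \<le> ennreal C * ennreal (diam_pow s (U i)) + ennreal (\<eta> i)" .
    qed auto
    also have "\<dots> = ennreal C * (\<Sum>i. ennreal (diam_pow s (U i))) + (\<Sum>i. ennreal (\<eta> i))"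
      by (subst suminf_add[symmetric]) auto
    also have "(\<Sum>i. ennreal (\<eta> i)) = ennreal (\<mu> [] / 2)"
      unfolding \<eta>_def using root sums_mult[OF power_half_series, of "\<mu> [] / 2"]
      by (intro suminf_ennreal_eq) auto
    also have "ennreal C * (\<Sum>i. ennreal (diam_pow s (U i))) < ennreal C * ennreal (\<mu> [] / (2 * C))"
      using U(3) C by (intro ennreal_mult_strict_left_mono) auto
    also have "ennreal C * ennreal (\<mu> [] / (2 * C)) = ennreal (\<mu> [] / 2)"
      using C root by (simp flip: ennreal_mult)
    finally have "\<Phi> [] < ennreal (\<mu> [] / 2) + ennreal (\<mu> [] / 2)" by simp
    then show ?thesis using root by (simp flip: ennreal_plus)
  qed
  \<comment> \<open>The chosen cylinders below different children are disjoint families below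
    \<open>v\<close>. If no child had a defect, superadditivity would leave none at
    \<open>v\<close>.\<close>
  have step: "\<exists>a\<in>D v. \<Phi> (a # v) < ennreal (\<mu> (a # v))"
    if v: "in_tree D v" "\<Phi> v < ennreal (\<mu> v)" for v
  proof (rule ccontr)
    assume "\<not> ?thesis"
    then have ge: "ennreal (\<mu> (a # v)) \<le> \<Phi> (a # v)" if "a \<in> D v" for a
      using that by (auto simp: not_less)
    have "ennreal (\<mu> v) \<le> ennreal (\<Sum>a\<in>D v. \<mu> (a # v))" by (intro ennreal_leI super v)
    also have "\<dots> = (\<Sum>a\<in>D v. ennreal (\<mu> (a # v)))" using nonneg by (simp add: sum_ennreal)
    also have "\<dots> \<le> (\<Sum>a\<in>D v. \<Phi> (a # v))" by (intro sum_mono ge)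
    also have "\<dots> = (\<Sum>i. \<Sum>a\<in>D v. ennreal (\<phi> i (a # v)))"
      unfolding \<Phi>_def by (subst suminf_sum) auto
    also have "\<dots> \<le> (\<Sum>i. ennreal (\<phi> i v))"
    proof (intro suminf_le)
      fix i
      have "(\<Sum>a\<in>D v. \<phi> i (a # v)) = sum \<mu> (\<Union>a\<in>D v. {w \<in> W i. \<exists>u. w = u @ a # v})"
        unfolding \<phi>_def using W(1) fin[OF v(1)] by (subst sum.UNION_disjoint) auto
      also have "\<dots> \<le> \<phi> i v"
        unfolding \<phi>_def using W(1) nonneg by (intro sum_mono2) auto
      finally show "(\<Sum>a\<in>D v. ennreal (\<phi> i (a # v))) \<le> ennreal (\<phi> i v)"
        using \<phi>0 by (simp add: sum_ennreal ennreal_leI)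
    qed auto
    finally show False using v(2) by (simp add: \<Phi>_def)
  qed
  have "\<exists>f. \<forall>n. (in_tree D (f n) \<and> \<Phi> (f n) < ennreal (\<mu> (f n)) \<and> length (f n) = n) \<and>
      (\<exists>a. f (Suc n) = a # f n)"
  proof (rule dependent_nat_choice)
    show "\<exists>w. in_tree D w \<and> \<Phi> w < ennreal (\<mu> w) \<and> length w = 0" using root_lt by auto
    fix w n assume w: "in_tree D w \<and> \<Phi> w < ennreal (\<mu> w) \<and> length w = n"
    then obtain d where "d \<in> D w" "\<Phi> (d # w) < ennreal (\<mu> (d # w))" using step[of w] by blast
    with w show "\<exists>w'. (in_tree D w' \<and> \<Phi> w' < ennreal (\<mu> w') \<and> length w' = Suc n) \<and> (\<exists>a. w' = a # w)"
      by (intro exI[of _ "d # w"]) auto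
  qed
  then obtain f where f: "\<And>n. in_tree D (f n)" "\<And>n. \<Phi> (f n) < ennreal (\<mu> (f n))"
    "\<And>n. length (f n) = n" "\<And>n. \<exists>a. f (Suc n) = a # f n" by metis
  define a where "a n = hd (f n)" for n
  have f_Suc: "f (Suc n) = a (Suc n) # f n" for n using f(4)[of n] by (auto simp: a_def)
  have "a n > 0" if "n \<ge> 1" for n
  proof -
    obtain k where k: "n = Suc k" using \<open>n \<ge> 1\<close> by (cases n) auto
    have "a (Suc k) \<in> D (f k)" using f(1)[of "Suc k"] by (simp add: f_Suc)
    then show ?thesis using pos[OF f(1)[of k]] k by (cases "a n") auto
  qed
  then obtain x where x: "x \<in> {0..<1} - \<rat>" "\<And>n. n \<ge> 1 \<Longrightarrow> cf_quot x n = a n"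
    using cf_digits_realizable[of a] by blast
  have word: "cf_word (cf_quot x) n = f n" for n
  proof (induction n)
    case 0
    then show ?case using f(3)[of 0] by simp
  next
    case (Suc n)
    then show ?case by (simp add: f_Suc x(2))
  qed
  have xK: "x \<in> K" using x(1) f(1) by (simp add: K_def cf_tree_set_def word)
  \<comment> \<open>The branch point lies in the cover, so one of its words was chosen. That word
    counts with its full mass, leaving no room for a defect there.\<close>
  then obtain i where "x \<in> U i" using U(1) by blast
  then obtain n where n: "f n \<in> W i" using W(2)[of x i] xK by (auto simp: word)
  have "\<mu> (f n) \<le> \<phi> i (f n)"
    unfolding \<phi>_def using n W(1)[of i] nonneg by (intro member_le_sum) auto
  then have "ennreal (\<mu> (f n)) \<le> ennreal (\<phi> i (f n))" by (rule ennreal_leI)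
  also have "\<dots> \<le> \<Phi> (f n)"
    unfolding \<Phi>_def using sum_le_suminf[of "\<lambda>i. ennreal (\<phi> i (f n))" "{i}"] by simp
  finally show False using f(2)[of n] by simp
qed

section \<open>Trees mixing uniform and free digits\<close>

text \<open>Intervals of neighbouring digits touch, so the tails must be kept from opposite ends. In
  the coordinate 1 / t the points are a + s and b + t; their distance is at least (b - a) - (1 - g),
  hence at least g * (b - a) because b - a \<ge> 1.\<close>

lemma cf_tree_set_separation:
  fixes g :: real
  assumes x: "x \<in> {0..<1} - \<rat>" "cf_word (cf_quot x) (Suc (length w)) = a # w"
    and y: "y \<in> {0..<1} - \<rat>" "cf_word (cf_quot y) (Suc (length w)) = b # w"
    and ab: "a < b"
    and gap: "\<bar>gauss_orbit (Suc (length w)) x - gauss_orbit (Suc (length w)) y\<bar> \<le> 1 - g" "0 < g"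
    and N: "real b + 2 \<le> N"
  shows "g * (real b - real a) / (real (den w) ^ 2 * N ^ 2) \<le> dist x y"
proof -
  let ?n = "length w"
  define s t where "s = gauss_orbit (Suc ?n) x" and "t = gauss_orbit (Suc ?n) y"
  have w: "0 \<notin> set w" using zero_notin_cf_word[OF x(1), of "Suc ?n"] x(2) by simp
  have ax: "cf_quot x (Suc ?n) = a" "cf_word (cf_quot x) ?n = w" using x(2) by auto
  have by': "cf_quot y (Suc ?n) = b" "cf_word (cf_quot y) ?n = w" using y(2) by auto
  have a: "real a \<ge> 1" using cf_quot_pos[OF x(1), of "Suc ?n"] ax by simp
  have s: "0 < s" "s < 1" and t: "0 < t" "t < 1"
    using gauss_orbit_bounds[OF x(1), of "Suc ?n"] gauss_orbit_bounds[OF y(1), of "Suc ?n"]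
    unfolding s_def t_def by auto
  have "1 / gauss_orbit ?n x = real a + s" "1 / gauss_orbit ?n y = real b + t"
    using inverse_gauss_orbit[OF x(1), of ?n] inverse_gauss_orbit[OF y(1), of ?n]
    unfolding ax(1) by'(1) s_def t_def by auto
  then have ox: "gauss_orbit ?n x = 1 / (real a + s)" and oy: "gauss_orbit ?n y = 1 / (real b + t)"
    by (metis divide_divide_eq_right div_by_1 mult_1)+
  have gap': "\<bar>s - t\<bar> \<le> 1 - g" using gap(1) unfolding s_def t_def .
  define k where "k = real b - real a"
  have k: "k \<ge> 1" using ab by (simp add: k_def)
  have Q: "real (den w) > 0" using den_pos[OF w] by simp
  have gk: "g * k \<le> \<bar>(real a + s) - (real b + t)\<bar>"
  proof -
    have "(k - 1) * (1 - g) \<ge> 0" using k gap' by (intro mult_nonneg_nonneg) auto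
    then have "g * k \<le> k - (1 - g)" by (simp add: algebra_simps)
    also have "\<dots> \<le> \<bar>(real a + s) - (real b + t)\<bar>" using gap' unfolding k_def by linarith
    finally show ?thesis .
  qed
  have "g * k / (real (den w) ^ 2 * N ^ 2) \<le>
      \<bar>(real a + s) - (real b + t)\<bar> / (real (den w) ^ 2 * ((real a + s + 1) * (real b + t + 1)))"
  proof (rule frac_le)
    show "0 < real (den w) ^ 2 * ((real a + s + 1) * (real b + t + 1))"
      using Q a s t by (intro mult_pos_pos zero_less_power) auto
    have "(real a + s + 1) * (real b + t + 1) \<le> N * N"
      using s t N ab a by (intro mult_mono) auto
    then show "real (den w) ^ 2 * ((real a + s + 1) * (real b + t + 1)) \<le> real (den w) ^ 2 * N ^ 2"
      by (intro mult_left_mono) (auto simp: power2_eq_square)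
  qed (use gk in auto)
  also have "\<dots> \<le> \<bar>word_val w (1 / (real a + s)) - word_val w (1 / (real b + t))\<bar>"
    using a s t ab by (intro word_val_separation[OF w]) auto
  also have "\<dots> = dist x y"
    using word_val_cf_word[OF x(1), of ?n] word_val_cf_word[OF y(1), of ?n] ax by'
    by (simp add: dist_real_def ox oy)
  finally show ?thesis by (simp add: k_def)
qed

definition mixed_tree :: "nat set \<Rightarrow> (nat list \<Rightarrow> nat) \<Rightarrow> nat \<Rightarrow> nat list \<Rightarrow> nat set" where
  "mixed_tree S c M w = (if length w \<in> S then {c w..<2 * c w} else {1..M})"

text \<open>On free levels the weights are length ratios to a power below or equal to 1. They may
  add up to more than one, since the mass only has to be superadditive.\<close>

primrec mixed_mass :: "nat set \<Rightarrow> (nat list \<Rightarrow> nat) \<Rightarrow> real \<Rightarrow> nat list \<Rightarrow> real" where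
  "mixed_mass S c \<sigma> [] = 1"
| "mixed_mass S c \<sigma> (a # w) = mixed_mass S c \<sigma> w *
    (if length w \<in> S then 1 / real (c w) else (cyl_len (a # w) / cyl_len w) powr \<sigma>)"

lemma mixed_mass_nonneg: "0 \<le> mixed_mass S c \<sigma> w"
  by (induction w) auto

text \<open>Dropping the digits above \<open>M\<close> loses at most the fraction 2 / (M + 2) of the
  length, the worst case being \<open>pden w = den w\<close>. As all ratios are at most 1 / 2,
  passing to the power \<sigma> gains at least the factor 2 powr (1 - \<sigma>).\<close>

lemma sum_cyl_len_ratio_powr_ge_1:
  assumes \<sigma>: "\<sigma> \<le> 1" and M: "(1 - 2 / (real M + 2)) * 2 powr (1 - \<sigma>) \<ge> 1" and w: "0 \<notin> set w"
  shows "(\<Sum>a=1..M. (cyl_len (a # w) / cyl_len w) powr \<sigma>) \<ge> 1"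
proof -
  let ?Q = "real (den w)" and ?P = "real (pden w)" and ?L = "cyl_len w"
  have Q: "?Q > 0" "?P \<ge> 0" "?P \<le> ?Q" using den_pos[OF w] pden_le_den[OF w] by auto
  have L: "?L > 0" by (rule cyl_len_pos[OF w])
  have "(1 - 2 / (real M + 2)) \<le> (\<Sum>a=1..M. cyl_len (a # w) / ?L)"
  proof -
    define z where "z = (real M + 1) * ?Q + ?P"
    have z: "z > 0" using Q mult_pos_pos[of "real M + 1" ?Q] by (simp add: z_def add_pos_nonneg)
    have "(\<Sum>a=1..M. cyl_len (a # w) / ?L) = (?L - 1 / (?Q * z)) / ?L"
      unfolding z_def sum_cyl_len_Cons[OF w, symmetric] by (simp add: sum_divide_distrib)
    also have "\<dots> = 1 - (1 / (?Q * z)) / ?L" using L by (simp add: diff_divide_distrib)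
    also have "(1 / (?Q * z)) / ?L = (?Q + ?P) / z" using Q z by (simp add: cyl_len_def)
    finally have eq: "(\<Sum>a=1..M. cyl_len (a # w) / ?L) = 1 - (?Q + ?P) / z" .
    have "(?Q + ?P) / z \<le> 2 / (real M + 2)"
    proof -
      have "real M * ?P \<le> real M * ?Q" using Q by (intro mult_left_mono) auto
      then have "(?Q + ?P) * (real M + 2) \<le> 2 * z" by (simp add: z_def algebra_simps)
      then show ?thesis using z by (simp add: divide_simps mult_ac)
    qed
    then show ?thesis unfolding eq by linarith
  qed
  then have "(1 - 2 / (real M + 2)) * 2 powr (1 - \<sigma>) \<le> (\<Sum>a=1..M. cyl_len (a # w) / ?L) * 2 powr (1 - \<sigma>)"
    by (intro mult_right_mono) auto
  also have "\<dots> = (\<Sum>a=1..M. cyl_len (a # w) / ?L * 2 powr (1 - \<sigma>))" by (simp add: sum_distrib_right)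
  also have "\<dots> \<le> (\<Sum>a=1..M. (cyl_len (a # w) / ?L) powr \<sigma>)"
  proof (rule sum_mono)
    fix a assume "a \<in> {1..M}"
    then have aw: "0 \<notin> set (a # w)" using w by auto
    define r where "r = cyl_len (a # w) / ?L"
    have r: "r > 0" "r \<le> 1 / 2" using cyl_len_pos[OF aw] cyl_len_Cons_le[OF aw] L by (auto simp: r_def field_simps)
    have "r * 2 powr (1 - \<sigma>) = r * (1 / 2) powr (\<sigma> - 1)"
      by (simp add: powr_divide powr_diff)
    also have "\<dots> \<le> r * r powr (\<sigma> - 1)"
      using r \<sigma> by (intro mult_left_mono powr_mono2') auto
    also have "\<dots> = r powr \<sigma>" using r by (simp add: powr_diff)
    finally show "r * 2 powr (1 - \<sigma>) \<le> r powr \<sigma>" .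
  qed
  finally show ?thesis using M by linarith
qed

lemma in_tree_mixed_pos:
  assumes c: "\<And>w. in_tree (mixed_tree S c M) w \<Longrightarrow> length w \<in> S \<Longrightarrow> c w \<ge> 2"
    and w: "in_tree (mixed_tree S c M) w"
  shows "0 \<notin> set w"
  using w
proof (induction w)
  case (Cons a w)
  then have "a \<in> mixed_tree S c M w" "in_tree (mixed_tree S c M) w" by auto
  then have "a > 0" using c[of w] by (auto simp: mixed_tree_def split: if_splits)
  then show ?case using Cons by auto
qed simp

text \<open>The children at a uniform level fill only a length of about 1 / (q^2 * c), hence the
  factor \<open>c w\<close> in the first mass bound. At a free level they spread over a fixed
  proportion of the cylinder.\<close>

lemma hausdorff_measure_mixed_tree_nonzero:
  fixes S :: "nat set" and c :: "nat list \<Rightarrow> nat" and M :: nat and s \<sigma> C0 :: real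
  defines "D \<equiv> mixed_tree S c M" and "\<mu> \<equiv> mixed_mass S c \<sigma>"
  assumes s: "0 < s" "s \<le> 1" and \<sigma>: "0 \<le> \<sigma>" "\<sigma> \<le> 1"
    and M: "(1 - 2 / (real M + 2)) * 2 powr (1 - \<sigma>) \<ge> 1" "M \<ge> 1"
    and c: "\<And>w. in_tree D w \<Longrightarrow> length w \<in> S \<Longrightarrow> c w \<ge> 2"
    and mass_uniform: "\<And>w. in_tree D w \<Longrightarrow> length w \<in> S \<Longrightarrow>
      \<mu> w * (real (den w) ^ 2 * real (c w)) powr s \<le> C0"
    and mass_free: "\<And>w. in_tree D w \<Longrightarrow> length w \<notin> S \<Longrightarrow> \<mu> w * (real (den w) ^ 2) powr s \<le> C0"
  shows "hausdorff_measure s (cf_tree_set D) \<noteq> 0"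
proof -
  define g where "g = 1 / (real M + 1)"
  have g: "g > 0" "g \<le> 1 / 2" using M by (auto simp: g_def divide_simps)
  have pos: "0 \<notin> set w" if "in_tree D w" for w
    using in_tree_mixed_pos[of S c M w] c that by (simp add: D_def)
  have \<mu>0: "0 \<le> \<mu> w" for w by (simp add: \<mu>_def mixed_mass_nonneg)
  have Q1: "real (den w) \<ge> 1" if "in_tree D w" for w using den_pos[OF pos[OF that]] by simp
  have mass: "\<mu> w * (real (den w) ^ 2) powr s \<le> C0" if w: "in_tree D w" for w
  proof (cases "length w \<in> S")
    case True
    have "\<mu> w * (real (den w) ^ 2) powr s \<le> \<mu> w * (real (den w) ^ 2 * real (c w)) powr s"
    proof (intro mult_left_mono powr_mono2 \<mu>0)
      have "real (den w) ^ 2 * 1 \<le> real (den w) ^ 2 * real (c w)"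
        using c[OF w True] by (intro mult_left_mono) auto
      then show "real (den w) ^ 2 \<le> real (den w) ^ 2 * real (c w)" by simp
    qed (use s in auto)
    then show ?thesis using mass_uniform[OF w True] by linarith
  qed (use mass_free w in blast)
  have C0: "0 \<le> C0" using mass[of "[]"] by (simp add: \<mu>_def)
  \<comment> \<open>The 9 is the square of 3 in b + 2 \<le> 3 * c w, and \<open>M + 2\<close> bounds
    b + 2 at free levels; 1 / g is the loss in the separation, the leading 2 comes from k + 1 \<le>
    2 * k, and the final 1 makes \<open>C\<close> positive.\<close>
  define C where "C = 2 * C0 * (9 / g) powr s + real M * C0 * ((real M + 2) ^ 2 / g) powr s + 1"
  have C1: "2 * C0 * (9 / g) powr s \<le> C" and C2: "real M * C0 * ((real M + 2) ^ 2 / g) powr s \<le> C"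
    and C3: "C > 0" using C0 by (auto simp: C_def add_nonneg_pos)
  show ?thesis
  proof (rule hausdorff_measure_tree_nonzero[where \<mu> = \<mu> and C = C])
    show "finite (D w)" if "in_tree D w" for w by (simp add: D_def mixed_tree_def)
    show "0 \<notin> D w" if "in_tree D w" for w
      using c[OF that] by (auto simp: D_def mixed_tree_def)
    show "\<mu> [] > 0" by (simp add: \<mu>_def)
    show "\<mu> w \<le> (\<Sum>a\<in>D w. \<mu> (a # w))" if w: "in_tree D w" for w
    proof (cases "length w \<in> S")
      case True
      then show ?thesis using c[OF w] by (simp add: D_def mixed_tree_def \<mu>_def)
    next
      case False
      have "\<mu> w * 1 \<le> \<mu> w * (\<Sum>a=1..M. (cyl_len (a # w) / cyl_len w) powr \<sigma>)"
        by (intro mult_left_mono sum_cyl_len_ratio_powr_ge_1 \<sigma>(2) M(1) pos w \<mu>0)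
      then show ?thesis using False by (simp add: D_def mixed_tree_def \<mu>_def sum_distrib_left)
    qed
    show "(\<lambda>n. \<mu> (cf_word (cf_quot x) n)) \<longlonglongrightarrow> 0" if x: "x \<in> cf_tree_set D" for x
    proof (rule Lim_null_comparison)
      show "\<forall>\<^sub>F n in sequentially. norm (\<mu> (cf_word (cf_quot x) n)) \<le> C0 * real n powr (- (2 * s))"
      proof (rule eventually_sequentiallyI[of 1])
        fix n :: nat assume n: "1 \<le> n"
        let ?w = "cf_word (cf_quot x) n"
        have w: "in_tree D ?w" using x by (simp add: cf_tree_set_def)
        have Qn: "real (den ?w) \<ge> real n" using length_le_den[OF pos[OF w]] by simp
        have "\<mu> ?w * real n powr (2 * s) \<le> \<mu> ?w * (real (den ?w) ^ 2) powr s"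
        proof (rule mult_left_mono[OF _ \<mu>0])
          have "real n powr (2 * s) \<le> real (den ?w) powr (2 * s)"
            using Qn s by (intro powr_mono2) auto
          also have "\<dots> = (real (den ?w) ^ 2) powr s"
            using Q1[OF w] by (simp add: powr_powr flip: powr_numeral)
          finally show "real n powr (2 * s) \<le> (real (den ?w) ^ 2) powr s" .
        qed
        also have "\<dots> \<le> C0" by (rule mass[OF w])
        finally show "norm (\<mu> ?w) \<le> C0 * real n powr (- (2 * s))"
          using n \<mu>0[of ?w] by (simp add: powr_minus field_simps)
      qed
      have "(\<lambda>n. C0 * real n powr (- (2 * s))) \<longlonglongrightarrow> C0 * 0"
        using s by (intro tendsto_mult tendsto_const tendsto_neg_powr filterlim_real_sequentially) auto
      then show "(\<lambda>n. C0 * real n powr (- (2 * s))) \<longlonglongrightarrow> 0" by simp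
    qed
  next
    fix x y w a b
    assume x: "x \<in> cf_tree_set D" "cf_word (cf_quot x) (Suc (length w)) = a # w"
      and y: "y \<in> cf_tree_set D" "cf_word (cf_quot y) (Suc (length w)) = b # w" and ab: "a < b"
    let ?n = "Suc (length w)"
    have irr: "x \<in> {0..<1} - \<rat>" "y \<in> {0..<1} - \<rat>" using x y by (auto simp: cf_tree_set_def)
    have tree: "in_tree D w" "a \<in> D w" "b \<in> D w"
      using x y unfolding cf_tree_set_def by (metis (mono_tags, lifting) in_tree.simps(2) mem_Collect_eq)+
    have next_tree: "cf_quot z (Suc ?n) \<in> D (cf_word (cf_quot z) ?n)" "in_tree D (cf_word (cf_quot z) ?n)"
      if "z \<in> cf_tree_set D" for z
      using that unfolding cf_tree_set_def by (metis (mono_tags, lifting) cf_word.simps(2) in_tree.simps(2) mem_Collect_eq)+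
    \<comment> \<open>If the next level is uniform, the next digits are at least 2 and both tails
      lie in (0, 1 / 2]; otherwise they are at most \<open>M\<close> and both tails lie in [g,
      1).\<close>
    have gap: "\<bar>gauss_orbit ?n x - gauss_orbit ?n y\<bar> \<le> 1 - g"
    proof (cases "?n \<in> S")
      case True
      have "gauss_orbit ?n z \<le> 1 / 2" "0 < gauss_orbit ?n z" if z: "z \<in> cf_tree_set D" for z
      proof -
        have zi: "z \<in> {0..<1} - \<rat>" using z by (simp add: cf_tree_set_def)
        have "c (cf_word (cf_quot z) ?n) \<ge> 2" using next_tree(2)[OF z] True by (intro c) auto
        moreover have "c (cf_word (cf_quot z) ?n) \<le> cf_quot z (Suc ?n)"
          using next_tree(1)[OF z] True by (simp add: D_def mixed_tree_def del: cf_word.simps)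
        ultimately have "real (cf_quot z (Suc ?n)) \<ge> 2" by linarith
        then have "1 / real (cf_quot z (Suc ?n)) \<le> 1 / 2" by (intro divide_left_mono) auto
        then show "gauss_orbit ?n z \<le> 1 / 2" using gauss_orbit_le(1)[OF zi, of ?n] by linarith
        show "0 < gauss_orbit ?n z" by (rule gauss_orbit_bounds[OF zi])
      qed
      from this[OF x(1)] this[OF y(1)] show ?thesis using g by linarith
    next
      case False
      have "g \<le> gauss_orbit ?n z" "gauss_orbit ?n z < 1" if z: "z \<in> cf_tree_set D" for z
      proof -
        have zi: "z \<in> {0..<1} - \<rat>" using z by (simp add: cf_tree_set_def)
        have "cf_quot z (Suc ?n) \<le> M"
          using next_tree(1)[OF z] False by (simp add: D_def mixed_tree_def del: cf_word.simps)
        then have "g \<le> 1 / (real (cf_quot z (Suc ?n)) + 1)"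
          unfolding g_def by (intro divide_left_mono) auto
        then show "g \<le> gauss_orbit ?n z" using gauss_orbit_le(2)[OF zi, of ?n] by linarith
        show "gauss_orbit ?n z < 1" by (rule gauss_orbit_bounds[OF zi])
      qed
      from this[OF x(1)] this[OF y(1)] show ?thesis by linarith
    qed
    have Q: "real (den w) \<ge> 1" by (rule Q1[OF tree(1)])
    show "(\<Sum>d\<in>D w \<inter> {a..b}. \<mu> (d # w)) \<le> C * dist x y powr s"
    proof (cases "length w \<in> S")
      case True
      define k where "k = real b - real a"
      let ?c = "real (c w)"
      have cw: "?c \<ge> 2" using c[OF tree(1) True] by simp
      have Dw: "c w \<le> a" "b < 2 * c w" using tree(2,3) True by (auto simp: D_def mixed_tree_def)
      have k: "1 \<le> k" "k \<le> ?c" using ab Dw by (auto simp: k_def)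
      have sep: "g * k / (real (den w) ^ 2 * (3 * ?c) ^ 2) \<le> dist x y"
        unfolding k_def using Dw cw by (intro cf_tree_set_separation[OF irr(1) x(2) irr(2) y(2) ab gap g(1)]) auto
      have "(\<Sum>d\<in>D w \<inter> {a..b}. \<mu> (d # w)) \<le> (\<Sum>d\<in>{a..b}. \<mu> w / ?c)"
        using True \<mu>0[of w] by (intro sum_le_included[where i = id]) (auto simp: \<mu>_def D_def mixed_tree_def)
      also have "\<dots> = (k + 1) * \<mu> w / ?c" using ab by (simp add: k_def)
      also have "\<dots> \<le> 2 * \<mu> w * (k / ?c)"
      proof -
        have "(k + 1) * \<mu> w \<le> (2 * k) * \<mu> w" using k \<mu>0[of w] by (intro mult_right_mono) auto
        then have "(k + 1) * \<mu> w / ?c \<le> (2 * k) * \<mu> w / ?c" by (intro divide_right_mono) auto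
        then show ?thesis by (simp add: mult_ac)
      qed
      \<comment> \<open>The proportion of children involved is at most 1 and s \<le> 1, so one
        estimate covers every scale between a single child and the whole block.\<close>
      also have "\<dots> \<le> 2 * \<mu> w * (k / ?c) powr s"
      proof (intro mult_left_mono)
        have "(k / ?c) powr 1 \<le> (k / ?c) powr s" using k cw s by (intro powr_mono') auto
        then show "k / ?c \<le> (k / ?c) powr s" using k cw by simp
      qed (use \<mu>0 in auto)
      also have "\<dots> = 2 * (\<mu> w * (real (den w) ^ 2 * ?c) powr s) * (k / (real (den w) ^ 2 * ?c ^ 2)) powr s"
      proof -
        have "k / ?c = (real (den w) ^ 2 * ?c) * (k / (real (den w) ^ 2 * ?c ^ 2))"
          using Q cw by (simp add: field_simps power2_eq_square)
        then have "(k / ?c) powr s = (real (den w) ^ 2 * ?c) powr s * (k / (real (den w) ^ 2 * ?c ^ 2)) powr s"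
          by (simp only: powr_mult)
        then show ?thesis by simp
      qed
      also have "\<dots> \<le> 2 * C0 * (k / (real (den w) ^ 2 * ?c ^ 2)) powr s"
        using mass_uniform[OF tree(1) True] by (intro mult_right_mono mult_left_mono) auto
      also have "k / (real (den w) ^ 2 * ?c ^ 2) = 9 / g * (g * k / (real (den w) ^ 2 * (3 * ?c) ^ 2))"
        using g by (simp add: power_mult_distrib)
      also have "2 * C0 * (9 / g * (g * k / (real (den w) ^ 2 * (3 * ?c) ^ 2))) powr s =
          2 * C0 * (9 / g) powr s * (g * k / (real (den w) ^ 2 * (3 * ?c) ^ 2)) powr s"
        by (subst powr_mult) (simp only: mult.assoc)
      also have "\<dots> \<le> C * dist x y powr s"
        using C1 C3 sep k g s by (intro mult_mono powr_mono2) auto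
      finally show ?thesis .
    next
      case False
      have Dw: "a \<le> M" "b \<le> M" using tree(2,3) False by (auto simp: D_def mixed_tree_def)
      let ?r = "g / (real (den w) ^ 2 * (real M + 2) ^ 2)"
      have "?r \<le> g * (real b - real a) / (real (den w) ^ 2 * (real M + 2) ^ 2)"
        using ab g by (intro divide_right_mono) auto
      also have "\<dots> \<le> dist x y"
        using Dw by (intro cf_tree_set_separation[OF irr(1) x(2) irr(2) y(2) ab gap g(1)]) auto
      finally have sep: "?r \<le> dist x y" .
      have le1: "(cyl_len (d # w) / cyl_len w) powr \<sigma> \<le> 1" if "d \<in> {1..M}" for d
      proof -
        have dw: "0 \<notin> set (d # w)" using that pos[OF tree(1)] by auto
        have "0 \<le> cyl_len (d # w) / cyl_len w" "cyl_len (d # w) / cyl_len w \<le> 1"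
          using cyl_len_Cons_le[OF dw] cyl_len_pos[OF dw] cyl_len_pos[OF pos[OF tree(1)]]
          by (auto simp: divide_simps)
        then show ?thesis using \<sigma>(1) by (intro powr_le1) auto
      qed
      \<comment> \<open>There are at most \<open>M\<close> children, so bounding each mass by that
        of the parent loses only a constant.\<close>
      have "(\<Sum>d\<in>D w \<inter> {a..b}. \<mu> (d # w)) \<le> (\<Sum>d\<in>{1..M}. \<mu> (d # w))"
        using False \<mu>0 by (intro sum_mono2) (auto simp: D_def mixed_tree_def)
      also have "\<dots> \<le> (\<Sum>d\<in>{1..M}. \<mu> w)"
      proof (rule sum_mono)
        fix d assume "d \<in> {1..M}"
        then have "\<mu> w * (cyl_len (d # w) / cyl_len w) powr \<sigma> \<le> \<mu> w * 1"
          using le1 \<mu>0 by (intro mult_left_mono) auto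
        then show "\<mu> (d # w) \<le> \<mu> w" using False by (simp add: \<mu>_def)
      qed
      also have "\<dots> = real M * \<mu> w * 1" by simp
      also have "1 = (real (den w) ^ 2) powr s * (1 / real (den w) ^ 2) powr s"
        using Q by (simp flip: powr_mult)
      also have "real M * \<mu> w * ((real (den w) ^ 2) powr s * (1 / real (den w) ^ 2) powr s) =
          real M * (\<mu> w * (real (den w) ^ 2) powr s) * (1 / real (den w) ^ 2) powr s"
        by simp
      also have "\<dots> \<le> real M * C0 * (1 / real (den w) ^ 2) powr s"
        using mass[OF tree(1)] by (intro mult_right_mono mult_left_mono) auto
      also have "1 / real (den w) ^ 2 = (real M + 2) ^ 2 / g * ?r" using g by simp
      also have "real M * C0 * ((real M + 2) ^ 2 / g * ?r) powr s =
          real M * C0 * ((real M + 2) ^ 2 / g) powr s * ?r powr s"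
        by (subst powr_mult) (simp only: mult.assoc)
      also have "\<dots> \<le> C * dist x y powr s"
        using C2 C3 sep g s by (intro mult_mono powr_mono2) auto
      finally show ?thesis .
    qed
  qed (use s C3 \<mu>0 in auto)
qed

section \<open>Lower bound for infinite convergence exponent\<close>

lemma cf_den_ge_index:
  assumes "x \<in> {0..<1} - \<rat>"
  shows "n \<le> cf_den (cf_quot x) n" "cf_den (cf_quot x) n \<ge> 1"
  using length_le_den[OF zero_notin_cf_word[OF assms, of n]] den_pos[OF zero_notin_cf_word[OF assms, of n]]
  by (auto simp: den_cf_word)

text \<open>An error of smaller order than ln q disappears in the limit. It absorbs the constant
  factors of the sparse tree and the factors exponential in n of the block tree.\<close>

lemma log_growth_eqI:
  assumes x: "x \<in> {0..<1} - \<rat>"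
  defines "q \<equiv> \<lambda>n. real (cf_den (cf_quot x) n)"
    and "p \<equiv> \<lambda>n. real (cf_quot x n * cf_quot x (Suc n))"
  assumes e: "(\<lambda>n. e n / ln (q n)) \<longlonglongrightarrow> 0"
    and upper: "\<And>n. n \<ge> 1 \<Longrightarrow> ln (p n) \<le> \<beta> * ln (q n) + e n"
    and lower: "\<And>N. \<exists>n\<ge>N. ln (p n) \<ge> \<beta> * ln (q n) - e n"
  shows "log_growth x = ereal \<beta>"
proof (rule antisym)
  let ?f = "\<lambda>n. ln (p n) / ln (q n)"
  have lg: "log_growth x = limsup (\<lambda>n. ereal (?f n))" by (simp add: log_growth_def p_def q_def)
  have q: "ln (q n) > 0" if "n \<ge> 2" for n
    using cf_den_ge_index(1)[OF x, of n] that by (simp add: q_def)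
  have ev: "\<exists>N\<ge>2. \<forall>n\<ge>N. \<bar>e n\<bar> < d * ln (q n)" if d: "d > 0" for d
  proof -
    obtain N where N: "\<And>n. n \<ge> N \<Longrightarrow> norm (e n / ln (q n) - 0) < d"
      using LIMSEQ_D[OF e d] by blast
    have "\<bar>e n\<bar> < d * ln (q n)" if "n \<ge> max N 2" for n
      using N[of n] q[of n] that by (simp add: pos_divide_less_eq)
    then show ?thesis by (intro exI[of _ "max N 2"]) auto
  qed
  show "log_growth x \<le> ereal \<beta>"
  proof (rule ereal_le_epsilon2)
    fix d :: real assume d: "0 < d"
    obtain N where N: "N \<ge> 2" "\<And>n. n \<ge> N \<Longrightarrow> \<bar>e n\<bar> < d * ln (q n)" using ev[OF d] by blast
    have "?f n \<le> \<beta> + d" if "n \<ge> N" for n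
    proof -
      have "ln (p n) \<le> (\<beta> + d) * ln (q n)"
        using upper[of n] N(2)[OF that] N(1) that by (simp add: algebra_simps)
      then show ?thesis using q[of n] N(1) that by (simp add: pos_divide_le_eq)
    qed
    then have "log_growth x \<le> ereal (\<beta> + d)"
      unfolding lg by (intro Limsup_bounded eventually_sequentiallyI[of N]) auto
    then show "log_growth x \<le> ereal \<beta> + ereal d" by simp
  qed
  show "ereal \<beta> \<le> log_growth x"
  proof (rule ccontr)
    assume "\<not> ?thesis"
    then have "log_growth x < ereal \<beta>" by simp
    then obtain z where z: "log_growth x < ereal z" "ereal z < ereal \<beta>"
      using ereal_dense2 by blast
    have "\<forall>\<^sub>F n in sequentially. ereal (?f n) < ereal z"
      using z(1) unfolding lg by (rule Limsup_lessD)
    then obtain N where N: "\<And>n. n \<ge> N \<Longrightarrow> ?f n < z" by (auto simp: eventually_sequentially)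
    obtain N' where N': "N' \<ge> 2" "\<And>n. n \<ge> N' \<Longrightarrow> \<bar>e n\<bar> < (\<beta> - z) * ln (q n)"
      using ev[of "\<beta> - z"] z(2) by auto
    obtain n where n: "n \<ge> max N N'" "ln (p n) \<ge> \<beta> * ln (q n) - e n" using lower by blast
    have "ln (p n) < z * ln (q n)" using N[of n] q[of n] n N'(1) by (simp add: pos_divide_less_eq)
    moreover have "e n < (\<beta> - z) * ln (q n)" using N'(2)[of n] n by auto
    ultimately show False using n(2) by (simp add: algebra_simps)
  qed
qed

lemma ex_sparse_set:
  fixes F :: "nat \<Rightarrow> nat"
  obtains S where "infinite S" "0 \<notin> S" "\<And>n m. n \<in> S \<Longrightarrow> m \<in> S \<Longrightarrow> n < m \<Longrightarrow> F n \<le> m"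
proof -
  define r where "r = rec_nat 1 (\<lambda>_ n. n + 1 + F n)"
  have r: "r 0 = 1" "r (Suc k) = r k + 1 + F (r k)" for k by (simp_all add: r_def)
  have mono: "strict_mono r" by (rule strict_monoI_Suc) (simp add: r)
  show thesis
  proof (rule that[of "range r"])
    show "infinite (range r)"
      using mono by (simp add: finite_image_iff strict_mono_imp_inj_on)
    have "r k > 0" for k by (cases k) (simp_all add: r)
    then show "0 \<notin> range r" by (metis imageE less_irrefl)
    fix n m assume "n \<in> range r" "m \<in> range r" "n < m"
    then obtain i j where ij: "n = r i" "m = r j" by auto
    then have "i < j" using \<open>n < m\<close> mono by (simp add: strict_mono_less)
    then have "r (Suc i) \<le> r j" using mono by (simp add: strict_mono_less_eq)
    then show "F n \<le> m" using ij r(2)[of i] by simp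
  qed
qed

text \<open>The added 1 makes the digit at least 2, which keeps the tails at most 1 / 2 in the
  separation argument.\<close>

definition jump :: "real \<Rightarrow> nat list \<Rightarrow> nat" where
  "jump \<beta> w = nat \<lceil>real (den w) powr \<beta>\<rceil> + 1"

lemma jump_bounds:
  assumes "0 \<le> \<beta>" "0 \<notin> set w"
  shows "real (den w) powr \<beta> \<le> real (jump \<beta> w)" "jump \<beta> w \<ge> 2"
    "real (jump \<beta> w) \<le> 3 * real (den w) powr \<beta>"
proof -
  have "real (den w) \<ge> 1" using den_pos[OF assms(2)] by simp
  then have *: "real (den w) powr \<beta> \<ge> 1" using assms(1) by (rule ge_one_powr_ge_zero)
  then show "real (den w) powr \<beta> \<le> real (jump \<beta> w)" "real (jump \<beta> w) \<le> 3 * real (den w) powr \<beta>"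
    unfolding jump_def by linarith+
  show "jump \<beta> w \<ge> 2" using * unfolding jump_def by linarith
qed

text \<open>The bound \<open>h\<close> for the denominators does not depend on \<open>S\<close>, so \<open>S\<close> can be chosen after it.\<close>

locale sparse_jumps =
  fixes \<beta> s \<sigma> :: real and M :: nat and S :: "nat set" and h :: "nat \<Rightarrow> real" and \<delta> :: real
  assumes \<beta>: "0 \<le> \<beta>" and s: "0 < s" "s \<le> 1" and \<sigma>: "0 \<le> \<sigma>" "\<sigma> \<le> 1" and M: "M \<ge> 1"
    and \<delta>: "\<delta> = 2 * \<sigma> - (2 + \<beta>) * s" "\<delta> > 0"
    and h: "h 0 = 1" "\<And>n. h (Suc n) = (real M + 7) * h n powr (1 + \<beta>)"
    and S0: "0 \<notin> S"
    and sparse: "\<And>n m. n \<in> S \<Longrightarrow> m \<in> S \<Longrightarrow> n < m \<Longrightarrow> 72 * h n powr (\<delta> + 2 * \<beta>) \<le> real m powr \<delta>"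
begin

abbreviation "D \<equiv> mixed_tree S (jump \<beta>) M"
abbreviation "\<mu> \<equiv> mixed_mass S (jump \<beta>) \<sigma>"

lemma positive: "in_tree D w \<Longrightarrow> 0 \<notin> set w"
proof (induction w)
  case (Cons a w)
  then have w: "0 \<notin> set w" "a \<in> D w" by auto
  then have "a > 0" using jump_bounds(2)[OF \<beta> w(1)] by (auto simp: mixed_tree_def split: if_splits)
  then show ?case using w by simp
qed simp

text \<open>A jump digit is below 2 * jump \<le> 6 * q powr \<beta>. The constant M + 7 dominates
  both this and M + 1, which is the recursion of \<open>h\<close>.\<close>

lemma digit_le:
  assumes w: "in_tree D w" and a: "a \<in> D w"
  shows "length w \<in> S \<Longrightarrow> real a + 1 \<le> 6 * real (den w) powr \<beta>"
    and "length w \<notin> S \<Longrightarrow> a \<le> M"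
    and "real a + 1 \<le> (real M + 7) * real (den w) powr \<beta>"
proof -
  have "real (den w) \<ge> 1" using den_pos[OF positive[OF w]] by simp
  then have Q: "real (den w) powr \<beta> \<ge> 1" using \<beta> by (rule ge_one_powr_ge_zero)
  show *: "real a + 1 \<le> 6 * real (den w) powr \<beta>" if "length w \<in> S"
    using a that jump_bounds(3)[OF \<beta> positive[OF w]] by (auto simp: mixed_tree_def)
  show **: "a \<le> M" if "length w \<notin> S" using a that by (auto simp: mixed_tree_def)
  have ineqs: "(real M + 7) * 1 \<le> (real M + 7) * real (den w) powr \<beta>"
    "6 * real (den w) powr \<beta> \<le> (real M + 7) * real (den w) powr \<beta>"
    using Q by (auto intro!: mult_left_mono mult_right_mono)
  show "real a + 1 \<le> (real M + 7) * real (den w) powr \<beta>"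
  proof (cases "length w \<in> S")
    case False
    then have "real a \<le> real M" using ** by simp
    then have "real a + 1 \<le> (real M + 7) * 1" by simp
    then show ?thesis using ineqs(1) by (rule order_trans)
  qed (use * ineqs(2) in linarith)
qed

lemma den_le_h: "in_tree D w \<Longrightarrow> real (den w) \<le> h (length w)"
proof (induction w)
  case Nil
  then show ?case by (simp add: h)
next
  case (Cons a w)
  then have w: "in_tree D w" "a \<in> D w" and IH: "real (den w) \<le> h (length w)" by auto
  have Q: "real (den w) \<ge> 1" using den_pos[OF positive[OF w(1)]] by simp
  have "real (den (a # w)) \<le> (real a + 1) * real (den w)"
    by (rule real_den_le_mult[OF positive[OF w(1)]])
  also have "\<dots> \<le> ((real M + 7) * real (den w) powr \<beta>) * real (den w)"
    using digit_le(3)[OF w] by (intro mult_right_mono) auto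
  also have "\<dots> = (real M + 7) * real (den w) powr (1 + \<beta>)" using Q by (simp add: powr_add)
  also have "\<dots> \<le> h (length (a # w))"
    using IH Q \<beta> by (auto simp: h intro!: mult_left_mono powr_mono2)
  finally show ?case .
qed

text \<open>Off \<open>S\<close> the density \<open>\<mu> w / cyl_len w powr \<sigma>\<close> does not change, while the denominators grow;
  a long free stretch therefore absorbs the increase caused by the previous jump.\<close>

lemma density_bounds:
  assumes "in_tree D w"
  shows "(\<forall>n\<in>S. length w \<le> n \<longrightarrow> \<mu> w \<le> real n powr \<delta> * cyl_len w powr \<sigma>) \<and>
    \<mu> w \<le> 72 * real (den w) powr (\<delta> + \<beta> * s) * cyl_len w powr \<sigma>"
  using assms
proof (induction w)
  case Nil
  \<comment> \<open>Positions in \<open>S\<close> are at least 1, and the empty word has mass and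
    length 1.\<close>
  have "real n powr \<delta> \<ge> 1" if "n \<in> S" for n
    using that S0 \<delta> by (intro ge_one_powr_ge_zero) (auto simp: Suc_le_eq intro: gr0I)
  then show ?case by (simp add: cyl_len_def)
next
  case (Cons a w)
  then have w: "in_tree D w" "a \<in> D w"
    and IH1: "\<And>n. n \<in> S \<Longrightarrow> length w \<le> n \<Longrightarrow> \<mu> w \<le> real n powr \<delta> * cyl_len w powr \<sigma>"
    and IH2: "\<mu> w \<le> 72 * real (den w) powr (\<delta> + \<beta> * s) * cyl_len w powr \<sigma>" by auto
  have pos: "0 \<notin> set (a # w)" using positive[OF Cons.prems] .
  then have posw: "0 \<notin> set w" by simp
  let ?Q = "real (den w)" and ?R = "real (den (a # w))" and ?L = "cyl_len w" and ?L' = "cyl_len (a # w)"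
  have Q: "?Q \<ge> 1" using den_pos[OF posw] by simp
  have QR: "?Q \<le> ?R" using den_mono_Cons[OF pos] by simp
  have L: "?L > 0" "?L' > 0" using cyl_len_pos[OF posw] cyl_len_pos[OF pos] by auto
  have exp0: "\<delta> + \<beta> * s \<ge> 0" using \<delta> \<beta> s by simp
  show ?case
  proof (cases "length w \<in> S")
    case False
    have step: "\<mu> (a # w) \<le> z * ?L' powr \<sigma>" if "\<mu> w \<le> z * ?L powr \<sigma>" for z
    proof -
      have "\<mu> (a # w) = \<mu> w * (?L' / ?L) powr \<sigma>" using False by simp
      also have "\<dots> \<le> (z * ?L powr \<sigma>) * (?L' / ?L) powr \<sigma>"
        using that by (intro mult_right_mono) auto
      also have "\<dots> = z * ?L' powr \<sigma>" using L by (simp add: powr_divide)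
      finally show ?thesis .
    qed
    have "72 * ?Q powr (\<delta> + \<beta> * s) * ?L' powr \<sigma> \<le> 72 * ?R powr (\<delta> + \<beta> * s) * ?L' powr \<sigma>"
      using QR Q exp0 by (intro mult_right_mono mult_left_mono powr_mono2) auto
    then show ?thesis using step[OF IH1] step[OF IH2] by fastforce
  next
    case True
    let ?c = "real (jump \<beta> w)"
    have c: "?Q powr \<beta> \<le> ?c" "?c \<le> 3 * ?Q powr \<beta>" "?c > 0"
      using jump_bounds[OF \<beta> posw] by auto
    have a: "?c \<le> real a" "real a + 1 \<le> 6 * ?Q powr \<beta>"
      using w True digit_le(1)[OF w True] by (auto simp: mixed_tree_def)
    have "?R \<le> (real a + 1) * ?Q"
      by (rule real_den_le_mult[OF posw])
    also have "\<dots> \<le> 6 * ?Q powr \<beta> * ?Q" using a by (intro mult_right_mono) auto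
    finally have R: "?R \<le> 6 * ?Q powr \<beta> * ?Q" .
    \<comment> \<open>72 = 2 * 6^2: the 6 bounds the growth of the denominator, the 2 compares
      \<open>cyl_len\<close> with the inverse square.\<close>
    have ratio: "?L / ?L' \<le> 72 * ?Q powr (2 * \<beta>)"
    proof -
      have "?L / ?L' \<le> (1 / ?Q ^ 2) / (1 / (2 * ?R ^ 2))"
        using cyl_len_bounds(2)[OF posw] cyl_len_bounds(1)[OF pos] L Q QR by (intro frac_le) auto
      also have "\<dots> = 2 * ?R ^ 2 / ?Q ^ 2" by simp
      also have "\<dots> \<le> 2 * (6 * ?Q powr \<beta> * ?Q) ^ 2 / ?Q ^ 2"
        using R Q QR by (intro divide_right_mono mult_left_mono power_mono) auto
      also have "\<dots> = 72 * (?Q powr \<beta> * ?Q powr \<beta>)"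
        using Q by (simp add: power_mult_distrib power2_eq_square)
      also have "?Q powr \<beta> * ?Q powr \<beta> = ?Q powr (2 * \<beta>)" by (simp flip: powr_add)
      finally show ?thesis .
    qed
    \<comment> \<open>Splitting the mass among the children gains Q powr \<beta>, while the
      shrinking of the cylinders costs Q powr (2 * \<beta> * \<sigma>) in density. The factor n powr
      \<delta> is turned into Q powr \<delta> through \<open>length_le_den\<close>.\<close>
    have main: "\<mu> (a # w) \<le> 72 * ?Q powr (\<delta> + 2 * \<beta> * \<sigma> - \<beta>) * ?L' powr \<sigma>"
    proof -
      have "\<mu> w \<le> real (length w) powr \<delta> * ?L powr \<sigma>" using IH1[OF True] by simp
      also have "\<dots> \<le> ?Q powr \<delta> * ?L powr \<sigma>"
        using length_le_den[OF posw] \<delta> by (intro mult_right_mono powr_mono2) auto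
      finally have "\<mu> (a # w) \<le> (?Q powr \<delta> * ?L powr \<sigma>) * (1 / ?c)"
        using True c by (simp add: divide_right_mono)
      also have "\<dots> \<le> (?Q powr \<delta> * ?L powr \<sigma>) * (1 / ?Q powr \<beta>)"
        using c Q by (intro mult_left_mono divide_left_mono) auto
      also have "?L powr \<sigma> = (?L / ?L') powr \<sigma> * ?L' powr \<sigma>" using L by (simp flip: powr_mult)
      also have "(?Q powr \<delta> * ((?L / ?L') powr \<sigma> * ?L' powr \<sigma>)) * (1 / ?Q powr \<beta>) \<le>
          (?Q powr \<delta> * ((72 * ?Q powr (2 * \<beta>)) powr \<sigma> * ?L' powr \<sigma>)) * (1 / ?Q powr \<beta>)"
        using ratio L \<sigma> by (intro mult_right_mono mult_left_mono powr_mono2) auto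
      also have "(72 * ?Q powr (2 * \<beta>)) powr \<sigma> = 72 powr \<sigma> * ?Q powr (2 * \<beta> * \<sigma>)"
        by (simp add: powr_mult powr_powr)
      also have "?Q powr \<delta> * (72 powr \<sigma> * ?Q powr (2 * \<beta> * \<sigma>) * ?L' powr \<sigma>) * (1 / ?Q powr \<beta>) =
          72 powr \<sigma> * (?Q powr (\<delta> + 2 * \<beta> * \<sigma> - \<beta>) * ?L' powr \<sigma>)"
        using Q by (simp add: powr_diff powr_add)
      also have "\<dots> \<le> 72 powr 1 * (?Q powr (\<delta> + 2 * \<beta> * \<sigma> - \<beta>) * ?L' powr \<sigma>)"
        using \<sigma> by (intro mult_right_mono powr_mono) auto
      finally show ?thesis by simp
    qed
    show ?thesis
    proof (intro conjI ballI impI)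
      fix n assume n: "n \<in> S" "length (a # w) \<le> n"
      \<comment> \<open>Here \<open>h\<close> bounds the denominator by a quantity independent of
        \<open>S\<close>, and sparseness makes the next jump position large enough to absorb
        it.\<close>
      have "72 * ?Q powr (\<delta> + 2 * \<beta> * \<sigma> - \<beta>) \<le> 72 * h (length w) powr (\<delta> + 2 * \<beta>)"
      proof (intro mult_left_mono)
        have "\<beta> * \<sigma> \<le> \<beta> * 1" using \<sigma> \<beta> by (intro mult_left_mono) auto
        then have "?Q powr (\<delta> + 2 * \<beta> * \<sigma> - \<beta>) \<le> ?Q powr (\<delta> + 2 * \<beta>)"
          using Q \<beta> by (intro powr_mono) auto
        also have "\<dots> \<le> h (length w) powr (\<delta> + 2 * \<beta>)"
          using den_le_h[OF w(1)] Q \<delta> \<beta> by (intro powr_mono2) auto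
        finally show "?Q powr (\<delta> + 2 * \<beta> * \<sigma> - \<beta>) \<le> h (length w) powr (\<delta> + 2 * \<beta>)" .
      qed simp
      also have "\<dots> \<le> real n powr \<delta>" using n True by (intro sparse) auto
      finally have "72 * ?Q powr (\<delta> + 2 * \<beta> * \<sigma> - \<beta>) * ?L' powr \<sigma> \<le> real n powr \<delta> * ?L' powr \<sigma>"
        by (intro mult_right_mono) auto
      then show "\<mu> (a # w) \<le> real n powr \<delta> * ?L' powr \<sigma>" using main by linarith
    next
      \<comment> \<open>After the jump the denominator is at least Q powr (1 + \<beta>). In terms of
        it the exponent \<delta> + \<beta> * s suffices, with \<beta> * (1 - s) to spare.\<close>
      have "?Q powr (\<delta> + 2 * \<beta> * \<sigma> - \<beta>) \<le> (?Q powr (1 + \<beta>)) powr (\<delta> + \<beta> * s)"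
      proof -
        have "\<beta> * s \<le> \<beta> * 1" using s \<beta> by (intro mult_left_mono) auto
        moreover have "\<delta> + 2 * \<beta> * \<sigma> - \<beta> = (1 + \<beta>) * (\<delta> + \<beta> * s) - (\<beta> - \<beta> * s)"
          unfolding \<delta>(1) by (simp add: algebra_simps)
        ultimately have "\<delta> + 2 * \<beta> * \<sigma> - \<beta> \<le> (1 + \<beta>) * (\<delta> + \<beta> * s)" by linarith
        then show ?thesis unfolding powr_powr using Q by (intro powr_mono) auto
      qed
      also have "\<dots> \<le> ?R powr (\<delta> + \<beta> * s)"
      proof (intro powr_mono2)
        have "?Q powr (1 + \<beta>) = ?Q powr \<beta> * ?Q" using Q by (simp add: powr_add)
        also have "\<dots> \<le> real a * ?Q" using c a by (intro mult_right_mono) auto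
        also have "\<dots> \<le> ?R" using den_ge_mult[of a w] by (simp flip: of_nat_mult)
        finally show "?Q powr (1 + \<beta>) \<le> ?R" .
      qed (use exp0 in auto)
      finally have "72 * ?Q powr (\<delta> + 2 * \<beta> * \<sigma> - \<beta>) * ?L' powr \<sigma> \<le> 72 * ?R powr (\<delta> + \<beta> * s) * ?L' powr \<sigma>"
        by (intro mult_right_mono mult_left_mono) auto
      then show "\<mu> (a # w) \<le> 72 * ?R powr (\<delta> + \<beta> * s) * ?L' powr \<sigma>" using main by linarith
    qed
  qed
qed

text \<open>By the definition of \<delta> the powers of the denominator cancel: \<delta> - 2 *
  \<sigma> + (2 + \<beta>) * s = 0 at a jump and \<delta> + \<beta> * s - 2 * \<sigma> + 2 * s = 0
  elsewhere. Only constants remain.\<close>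

lemma mass_le:
  assumes w: "in_tree D w"
  shows "length w \<in> S \<Longrightarrow> \<mu> w * (real (den w) ^ 2 * real (jump \<beta> w)) powr s \<le> 72"
    and "length w \<notin> S \<Longrightarrow> \<mu> w * (real (den w) ^ 2) powr s \<le> 72"
proof -
  let ?Q = "real (den w)"
  have pos: "0 \<notin> set w" by (rule positive[OF w])
  have Q: "?Q \<ge> 1" using den_pos[OF pos] by simp
  have Q2: "?Q ^ 2 = ?Q powr 2" using Q by (simp add: powr_numeral)
  have "cyl_len w powr \<sigma> \<le> (?Q powr (- 2)) powr \<sigma>"
    using cyl_len_bounds(2)[OF pos] cyl_len_pos[OF pos] \<sigma> Q
    by (intro powr_mono2) (auto simp: powr_minus powr_numeral divide_simps)
  then have L: "cyl_len w powr \<sigma> \<le> ?Q powr (- 2 * \<sigma>)" by (simp add: powr_powr)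
  show "\<mu> w * (?Q ^ 2 * real (jump \<beta> w)) powr s \<le> 72" if "length w \<in> S"
  proof -
    have "\<mu> w \<le> real (length w) powr \<delta> * cyl_len w powr \<sigma>"
      using density_bounds[OF w] that by blast
    also have "\<dots> \<le> ?Q powr \<delta> * ?Q powr (- 2 * \<sigma>)"
      using length_le_den[OF pos] \<delta> L by (intro mult_mono powr_mono2) auto
    finally have 1: "\<mu> w \<le> ?Q powr \<delta> * ?Q powr (- 2 * \<sigma>)" .
    have "(?Q ^ 2 * real (jump \<beta> w)) powr s \<le> (?Q powr 2 * (3 * ?Q powr \<beta>)) powr s"
      unfolding Q2 using jump_bounds[OF \<beta> pos] s by (intro powr_mono2 mult_left_mono) auto
    also have "?Q powr 2 * (3 * ?Q powr \<beta>) = 3 * ?Q powr (2 + \<beta>)" by (simp add: powr_add)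
    also have "(3 * ?Q powr (2 + \<beta>)) powr s = 3 powr s * ?Q powr ((2 + \<beta>) * s)"
      by (simp add: powr_mult powr_powr)
    also have "\<dots> \<le> 3 powr 1 * ?Q powr ((2 + \<beta>) * s)"
      using s by (intro mult_right_mono powr_mono) auto
    finally have 2: "(?Q ^ 2 * real (jump \<beta> w)) powr s \<le> 3 * ?Q powr ((2 + \<beta>) * s)" by simp
    have "\<mu> w * (?Q ^ 2 * real (jump \<beta> w)) powr s \<le>
        (?Q powr \<delta> * ?Q powr (- 2 * \<sigma>)) * (3 * ?Q powr ((2 + \<beta>) * s))"
      using 1 2 by (intro mult_mono) auto
    also have "\<dots> = 3 * ?Q powr (\<delta> + (- 2 * \<sigma>) + (2 + \<beta>) * s)" by (simp only: powr_add mult_ac)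
    also have "\<delta> + (- 2 * \<sigma>) + (2 + \<beta>) * s = 0" by (simp add: \<delta>(1))
    finally show ?thesis using Q by simp
  qed
  show "\<mu> w * (?Q ^ 2) powr s \<le> 72" if "length w \<notin> S"
  proof -
    have "\<mu> w \<le> 72 * ?Q powr (\<delta> + \<beta> * s) * cyl_len w powr \<sigma>"
      using density_bounds[OF w] by blast
    also have "\<dots> \<le> 72 * ?Q powr (\<delta> + \<beta> * s) * ?Q powr (- 2 * \<sigma>)"
      using L by (intro mult_left_mono) auto
    finally have "\<mu> w * (?Q ^ 2) powr s \<le> (72 * ?Q powr (\<delta> + \<beta> * s) * ?Q powr (- 2 * \<sigma>)) * (?Q ^ 2) powr s"
      by (intro mult_right_mono) auto
    also have eq: "(?Q ^ 2) powr s = ?Q powr (2 * s)" unfolding Q2 by (simp only: powr_powr)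
    also have "(72 * ?Q powr (\<delta> + \<beta> * s) * ?Q powr (- 2 * \<sigma>)) * ?Q powr (2 * s) =
        72 * ?Q powr (\<delta> + \<beta> * s + (- 2 * \<sigma>) + 2 * s)" by (simp only: powr_add mult.assoc)
    also have "\<delta> + \<beta> * s + (- 2 * \<sigma>) + 2 * s = 0" by (simp add: \<delta>(1) algebra_simps)
    finally show ?thesis using Q unfolding eq by simp
  qed
qed

text \<open>Digits bounded by \<open>M\<close> recur for ever, so no series of negative powers of
  the digits converges. The gaps prevent two jumps in a row, so a product of neighbours has at most
  one factor of jump size.\<close>

lemma tree_set_subset_E_set:
  assumes inf: "infinite S" and gaps: "\<And>n. n \<in> S \<Longrightarrow> Suc n \<notin> S"
  shows "cf_tree_set D \<subseteq> E_set \<infinity> \<beta>"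
proof
  fix x assume x: "x \<in> cf_tree_set D"
  have irr: "x \<in> {0..<1} - \<rat>" using x by (simp add: cf_tree_set_def)
  let ?a = "cf_quot x" and ?w = "cf_word (cf_quot x)"
  have tree: "in_tree D (?w n)" for n using x by (simp add: cf_tree_set_def)
  have digit: "?a (Suc n) \<in> D (?w n)" for n using tree[of "Suc n"] by simp
  have small: "?a (Suc n) \<le> M" if "n \<notin> S" for n
    using digit_le(2)[OF tree digit, of n] that by simp
  have "conv_exponent x = \<infinity>"
  proof -
    have "\<not> summable (\<lambda>n. real (?a (Suc n)) powr (- t))" if t: "0 \<le> t" for t
    proof
      assume "summable (\<lambda>n. real (?a (Suc n)) powr (- t))"
      then have "(\<lambda>n. real (?a (Suc n)) powr (- t)) \<longlonglongrightarrow> 0" by (rule summable_LIMSEQ_zero)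
      moreover have "0 < real M powr (- t)" using M by simp
      ultimately have "\<forall>\<^sub>F n in sequentially. real (?a (Suc n)) powr (- t) < real M powr (- t)"
        by (rule order_tendstoD)
      then obtain N where N: "\<And>n. n \<ge> N \<Longrightarrow> real (?a (Suc n)) powr (- t) < real M powr (- t)"
        by (auto simp: eventually_sequentially)
      obtain n where n: "n \<ge> N" "n \<notin> S" using gaps[of N] by (metis le_SucI order_refl)
      have "real M powr (- t) \<le> real (?a (Suc n)) powr (- t)"
        using small[OF n(2)] cf_quot_pos[OF irr, of "Suc n"] t by (intro powr_mono2') auto
      then show False using N[OF n(1)] by linarith
    qed
    then have "{ereal t | t. 0 \<le> t \<and> summable (\<lambda>n. real (?a (Suc n)) powr (- t))} = {}" by blast
    then show ?thesis unfolding conv_exponent_def by (simp only: Inf_empty top_ereal_def)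
  qed
  moreover have "log_growth x = ereal \<beta>"
  proof (rule log_growth_eqI[OF irr])
    let ?q = "\<lambda>n. real (cf_den ?a n)"
    let ?K = "6 * real M ^ 2"
    have M1: "real M \<ge> 1" using M by simp
    have M2: "real M ^ 2 \<ge> real M" using M1 by (simp add: power2_eq_square)
    have q1: "?q n \<ge> 1" for n using cf_den_ge_index(2)[OF irr, of n] by simp
    have qw: "real (den (?w n)) = ?q n" for n by (simp add: den_cf_word)
    have a1: "real (?a n) \<ge> 1" for n using cf_quot_pos[OF irr, of n] by simp
    show "(\<lambda>n. ln ?K / ln (?q n)) \<longlonglongrightarrow> 0"
    proof (rule tendsto_divide_0[OF tendsto_const])
      have "filterlim ?q at_top sequentially"
        by (rule filterlim_at_top_mono[OF filterlim_real_sequentially])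
          (use cf_den_ge_index(1)[OF irr] in auto)
      then show "filterlim (\<lambda>n. ln (?q n)) at_infinity sequentially"
        by (intro filterlim_at_top_imp_at_infinity filterlim_compose[OF ln_at_top])
    qed
    show "ln (real (?a n * ?a (Suc n))) \<le> \<beta> * ln (?q n) + ln ?K" if n: "n \<ge> 1" for n
    proof -
      obtain m where m: "n = Suc m" using n by (cases n) auto
      have Qb: "?q n powr \<beta> \<ge> 1" using q1 \<beta> by (rule ge_one_powr_ge_zero)
      have "real (?a n) * real (?a (Suc n)) \<le> ?K * ?q n powr \<beta>"
      proof (cases "n \<in> S")
        case True
        then have "m \<notin> S" using gaps m by auto
        then have "real (?a n) \<le> real M" using small[of m] m by simp
        moreover have "real (?a (Suc n)) \<le> 6 * ?q n powr \<beta>"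
          using digit_le(1)[OF tree digit, of n] True by (simp add: qw)
        ultimately have "real (?a n) * real (?a (Suc n)) \<le> real M * (6 * ?q n powr \<beta>)"
          by (intro mult_mono) auto
        also have "\<dots> \<le> real M ^ 2 * (6 * ?q n powr \<beta>)" using M2 by (intro mult_right_mono) auto
        finally show ?thesis by simp
      next
        case False
        then have 1: "real (?a (Suc n)) \<le> real M" using small by simp
        \<comment> \<open>If position \<open>m\<close> was a jump, \<open>?a n\<close> is large only
          relative to the previous denominator, which is at most the present one.\<close>
        have 2: "real (?a n) \<le> real M * (6 * ?q n powr \<beta>)"
        proof (cases "m \<in> S")
          case True
          have "real (?a n) \<le> 6 * ?q m powr \<beta>"
            using digit_le(1)[OF tree digit, of m] True m by (simp add: qw)
          also have "\<dots> \<le> 6 * ?q n powr \<beta>"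
            using den_mono_Cons[OF zero_notin_cf_word[OF irr, of n, unfolded m cf_word.simps]] q1 \<beta>
            by (intro mult_left_mono powr_mono2) (auto simp: m simp flip: qw)
          also have "\<dots> \<le> real M * (6 * ?q n powr \<beta>)" using M1 Qb by (simp add: mult_le_cancel_right1)
          finally show ?thesis .
        next
          case False
          then have "real (?a n) \<le> real M * 1" using small[of m] m by simp
          also have "\<dots> \<le> real M * (6 * ?q n powr \<beta>)" using Qb by (intro mult_left_mono) auto
          finally show ?thesis .
        qed
        have "real (?a n) * real (?a (Suc n)) \<le> (real M * (6 * ?q n powr \<beta>)) * real M"
          using 1 2 by (intro mult_mono) auto
        then show ?thesis by (simp add: power2_eq_square mult_ac)
      qed
      then have "ln (real (?a n * ?a (Suc n))) \<le> ln (?K * ?q n powr \<beta>)"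
        using a1[of n] a1[of "Suc n"] by (intro ln_mono) auto
      also have "\<dots> = ln ?K + \<beta> * ln (?q n)"
        using M1 q1[of n] by (subst ln_mult_pos) (auto simp: ln_powr)
      finally show ?thesis by simp
    qed
    show "\<exists>n\<ge>N. \<beta> * ln (?q n) - ln ?K \<le> ln (real (?a n * ?a (Suc n)))" for N
    proof -
      obtain n where n: "n \<ge> N" "n \<in> S" using inf by (meson infinite_nat_iff_unbounded_le)
      have "?q n powr \<beta> \<le> real (jump \<beta> (?w n))"
        using jump_bounds(1)[OF \<beta> zero_notin_cf_word[OF irr]] by (simp add: qw)
      also have "\<dots> \<le> real (?a (Suc n))"
        using digit[of n] n(2) by (auto simp: mixed_tree_def)
      also have "\<dots> \<le> real (?a n) * real (?a (Suc n))"
        using a1[of n] by (simp add: mult_le_cancel_right1)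
      finally have "ln (?q n powr \<beta>) \<le> ln (real (?a n * ?a (Suc n)))"
        using q1[of n] by (intro ln_mono) auto
      then have "\<beta> * ln (?q n) \<le> ln (real (?a n * ?a (Suc n)))"
        using q1[of n] by (simp add: ln_powr)
      moreover have "ln ?K \<ge> 0"
      proof (rule ln_ge_zero)
        show "1 \<le> ?K" using M1 M2 by linarith
      qed
      ultimately show ?thesis using n(1) by (intro exI[of _ n]) linarith
    qed
  qed
  ultimately show "x \<in> E_set \<infinity> \<beta>" using irr by (simp add: E_set_def)
qed

end

theorem hausdorff_dim_E_set_infinity_ge:
  assumes \<beta>: "0 \<le> \<beta>"
  shows "ereal (2 / (\<beta> + 2)) \<le> hausdorff_dim (E_set \<infinity> \<beta>)"
proof (rule hausdorff_dim_ge_if_measure_nonzero)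
  show "2 / (\<beta> + 2) > 0" using \<beta> by simp
  fix s assume s: "0 < s" "s < 2 / (\<beta> + 2)"
  have s2: "(2 + \<beta>) * s < 2" using s \<beta> by (simp add: field_simps)
  have "2 * s \<le> (2 + \<beta>) * s" using s \<beta> by simp
  then have s1: "s \<le> 1" using s2 by linarith
  \<comment> \<open>The midpoint between (2 + \<beta>) * s / 2 and 1, so that both \<sigma> < 1 and
    \<delta> > 0.\<close>
  define \<sigma> where "\<sigma> = ((2 + \<beta>) * s / 2 + 1) / 2"
  define \<delta> where "\<delta> = 2 * \<sigma> - (2 + \<beta>) * s"
  have \<sigma>: "0 \<le> \<sigma>" "\<sigma> < 1" using s s2 \<beta> by (auto simp: \<sigma>_def)
  have \<delta>: "\<delta> > 0" using s2 by (simp add: \<delta>_def \<sigma>_def field_simps)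
  have "(2::real) powr (\<sigma> - 1) < 1" using \<sigma> by (simp add: powr_less_one)
  \<comment> \<open>\<open>M\<close> is so large that the length lost by truncation is at most 1 - 2
    powr (\<sigma> - 1), which the power \<sigma> regains.\<close>
  then obtain n where n: "inverse (real (Suc n)) < (1 - 2 powr (\<sigma> - 1)) / 2"
    using reals_Archimedean[of "(1 - 2 powr (\<sigma> - 1)) / 2"] by auto
  define M where "M = Suc n"
  have M_large: "(1 - 2 / (real M + 2)) * 2 powr (1 - \<sigma>) \<ge> 1" "M \<ge> 1"
  proof -
    have "2 / (real M + 2) \<le> 2 / real M" by (intro divide_left_mono) (auto simp: M_def)
    also have "\<dots> = 2 * inverse (real M)" by (simp add: divide_inverse)
    also have "\<dots> \<le> 1 - 2 powr (\<sigma> - 1)" using n by (simp add: M_def)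
    finally have "2 powr (\<sigma> - 1) * 2 powr (1 - \<sigma>) \<le> (1 - 2 / (real M + 2)) * 2 powr (1 - \<sigma>)"
      by (intro mult_right_mono) auto
    then show "(1 - 2 / (real M + 2)) * 2 powr (1 - \<sigma>) \<ge> 1" by (simp flip: powr_add)
  qed (simp add: M_def)
  define h where "h = rec_nat (1::real) (\<lambda>_ r. (real M + 7) * r powr (1 + \<beta>))"
  \<comment> \<open>The term n + 2 excludes consecutive elements of \<open>S\<close>; the other is
    \<open>sparse\<close> solved for m.\<close>
  define F where "F n = max (n + 2) (nat \<lceil>(72 * h n powr (\<delta> + 2 * \<beta>)) powr (1 / \<delta>)\<rceil>)" for n
  obtain S where S: "infinite S" "0 \<notin> S" "\<And>n m. n \<in> S \<Longrightarrow> m \<in> S \<Longrightarrow> n < m \<Longrightarrow> F n \<le> m"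
    using ex_sparse_set[of F] by blast
  interpret sparse_jumps \<beta> s \<sigma> M S h \<delta>
  proof
    fix n m assume "n \<in> S" "m \<in> S" "n < m"
    then have "F n \<le> m" by (rule S(3))
    then have "(72 * h n powr (\<delta> + 2 * \<beta>)) powr (1 / \<delta>) \<le> real m" unfolding F_def by linarith
    then have "((72 * h n powr (\<delta> + 2 * \<beta>)) powr (1 / \<delta>)) powr \<delta> \<le> real m powr \<delta>"
      using \<delta> by (intro powr_mono2) auto
    then show "72 * h n powr (\<delta> + 2 * \<beta>) \<le> real m powr \<delta>" using \<delta> by (simp add: powr_powr)
  qed (use \<beta> s s1 \<sigma> \<delta> M_large(2) S in \<open>auto simp: h_def \<delta>_def\<close>)
  have "hausdorff_measure s (cf_tree_set D) \<noteq> 0"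
  proof (rule hausdorff_measure_mixed_tree_nonzero)
    show "2 \<le> jump \<beta> w" if "in_tree D w" "length w \<in> S" for w
      by (rule jump_bounds(2)[OF \<beta> positive[OF that(1)]])
    show "\<mu> w * (real (den w) ^ 2 * real (jump \<beta> w)) powr s \<le> 72" if "in_tree D w" "length w \<in> S" for w
      by (rule mass_le(1)[OF that])
    show "\<mu> w * (real (den w) ^ 2) powr s \<le> 72" if "in_tree D w" "length w \<notin> S" for w
      by (rule mass_le(2)[OF that])
    show "1 \<le> (1 - 2 / (real M + 2)) * 2 powr (1 - \<sigma>)" by (rule M_large(1))
  qed (use s s1 \<sigma> M_large(2) in auto)
  moreover have "cf_tree_set D \<subseteq> E_set \<infinity> \<beta>"
  proof (rule tree_set_subset_E_set[OF S(1)])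
    fix n assume n: "n \<in> S"
    show "Suc n \<notin> S"
    proof
      assume "Suc n \<in> S"
      then have "F n \<le> Suc n" using S(3) n by blast
      then show False by (simp add: F_def)
    qed
  qed
  ultimately show "hausdorff_measure s (E_set \<infinity> \<beta>) \<noteq> 0"
    using hausdorff_measure_mono[of "cf_tree_set D" "E_set \<infinity> \<beta>" s] by auto
qed

section \<open>Lower bound for finite convergence exponent\<close>

text \<open>\<open>block_prod\<close> multiplies the lower ends of the digit ranges and stands for
  the denominator. These ends depend on the level only, so all words of a level have equal mass and,
  up to a factor 2 ^ n, equal denominators. The maximum with \<open>b n\<close> keeps the digits
  unbounded also for u = 1.\<close>

primrec block_prod :: "(nat \<Rightarrow> nat) \<Rightarrow> real \<Rightarrow> nat \<Rightarrow> nat" where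
  "block_prod b u 0 = 1"
| "block_prod b u (Suc n) = block_prod b u n *
    (if n mod 3 = 2 then b n else max (b n) (nat \<lceil>real (block_prod b u n) powr (u - 1)\<rceil>))"

definition block_base :: "(nat \<Rightarrow> nat) \<Rightarrow> real \<Rightarrow> nat \<Rightarrow> nat" where
  "block_base b u n =
    (if n mod 3 = 2 then b n else max (b n) (nat \<lceil>real (block_prod b u n) powr (u - 1)\<rceil>))"

lemma block_prod_Suc: "block_prod b u (Suc n) = block_prod b u n * block_base b u n"
  by (simp add: block_base_def)

declare block_prod.simps(2) [simp del]

text \<open>The digits at positions \<open>3 k + 2\<close> (counting from \<open>0\<close>) follow the sequence \<open>b\<close>, which
  fixes the convergence exponent; the two digits following them grow like
  \<open>q powr (u - 1)\<close> and realise the growth exponent \<open>u - 1 / u = \<beta>\<close>.\<close>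

locale block_digits =
  fixes b :: "nat \<Rightarrow> nat" and u \<beta> K :: real
  assumes u: "u \<ge> 1" "u ^ 2 = \<beta> * u + 1" and \<beta>: "\<beta> \<ge> 0"
    and b2: "\<And>n. b n \<ge> 2" and b_lim: "filterlim b at_top sequentially"
    and b_le: "\<And>n. ln (real (b n)) \<le> K * (real n + 1)"
begin

abbreviation "P \<equiv> block_prod b u"
abbreviation "c \<equiv> block_base b u"
abbreviation "D \<equiv> mixed_tree UNIV (\<lambda>w. c (length w)) 2"
abbreviation "\<mu> \<equiv> mixed_mass UNIV (\<lambda>w. c (length w)) 0"

lemma c_ge: "b n \<le> c n" "c n \<ge> 2"
  using b2[of n] by (auto simp: block_base_def)

lemma P_ge_1: "P n \<ge> 1"
proof (induction n)
  case (Suc n)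
  have "1 * 1 \<le> P n * c n" using Suc c_ge(2)[of n] by (intro mult_mono) auto
  then show ?case by (simp add: block_prod_Suc)
qed simp

lemma ln_P_Suc: "ln (real (P (Suc n))) = ln (real (P n)) + ln (real (c n))"
  using P_ge_1[of n] c_ge(2)[of n] by (simp add: block_prod_Suc ln_mult_pos)

lemma ln_P_nonneg: "0 \<le> ln (real (P n))"
  using P_ge_1[of n] by (intro ln_ge_zero) simp

lemma ln_c_le: "ln (real (c n)) \<le> ln (2 * real (b n)) + (u - 1) * ln (real (P n))"
proof -
  have "real (P n) \<ge> 1" using P_ge_1[of n] by simp
  then have z: "real (P n) powr (u - 1) \<ge> 1" using u by (intro ge_one_powr_ge_zero) auto
  have "real (c n) \<le> 2 * real (b n) * real (P n) powr (u - 1)"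
  proof -
    have "real (b n) * 1 \<le> real (b n) * (2 * real (P n) powr (u - 1))"
      using z by (intro mult_left_mono) auto
    moreover have "real (nat \<lceil>real (P n) powr (u - 1)\<rceil>) \<le> 1 * (2 * real (P n) powr (u - 1))"
      using z by linarith
    moreover have "1 * (2 * real (P n) powr (u - 1)) \<le> real (b n) * (2 * real (P n) powr (u - 1))"
      using b2[of n] by (intro mult_right_mono) auto
    ultimately show ?thesis by (auto simp: block_base_def max_def mult_ac)
  qed
  then have "ln (real (c n)) \<le> ln (2 * real (b n) * real (P n) powr (u - 1))"
    using c_ge(2)[of n] by (intro ln_mono) auto
  also have "\<dots> = ln (2 * real (b n)) + (u - 1) * ln (real (P n))"
    using b2[of n] P_ge_1[of n] by (subst ln_mult_pos) (auto simp: ln_powr)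
  finally show ?thesis .
qed

lemma ln_c_ge:
  assumes "n mod 3 \<noteq> 2"
  shows "(u - 1) * ln (real (P n)) \<le> ln (real (c n))"
proof -
  have P: "real (P n) \<ge> 1" using P_ge_1[of n] by simp
  have "real (P n) powr (u - 1) \<le> real (c n)"
    using assms unfolding block_base_def by (auto simp: max_def) linarith+
  then have "ln (real (P n) powr (u - 1)) \<le> ln (real (c n))"
    using P by (intro ln_mono) auto
  then show ?thesis using P by (simp add: ln_powr)
qed

text \<open>As the digits tend to infinity, ln P grows faster than linearly. Factors exponential in
  n, such as 2 ^ n and by \<open>b_le\<close> also b n, are therefore negligible powers of the
  denominator.\<close>

lemma linear_over_ln_P: "(\<lambda>n. A * (real n + 1) / ln (real (P n))) \<longlonglongrightarrow> 0"
proof (rule tendstoI)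
  fix e :: real assume e: "e > 0"
  \<comment> \<open>The 4 comes from n + 1 \<le> 4 * (n - N) for n \<ge> 2 * N + 1.\<close>
  define T where "T = 4 * (\<bar>A\<bar> + 1) / e"
  have T: "T > 0" using e by (simp add: T_def)
  have "filterlim (\<lambda>n. ln (real (b n))) at_top sequentially"
    using b_lim by (intro filterlim_compose[OF ln_at_top] filterlim_compose[OF filterlim_real_sequentially])
  then obtain N where N: "\<And>n. n \<ge> N \<Longrightarrow> T \<le> ln (real (b n))"
    unfolding filterlim_at_top eventually_sequentially by blast
  have grow: "T * (real n - real N) \<le> ln (real (P n))" if "n \<ge> N" for n
    using that
  proof (induction n rule: dec_induct)
    case base
    then show ?case using ln_P_nonneg by simp
  next
    case (step n)
    have "ln (real (b n)) \<le> ln (real (c n))" using c_ge(1)[of n] b2[of n] by (intro ln_mono) auto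
    then show ?case using step N[of n] by (simp add: ln_P_Suc algebra_simps)
  qed
  have "dist (A * (real n + 1) / ln (real (P n))) 0 < e" if n: "n \<ge> 2 * N + 1" for n
  proof -
    have "real (2 * N + 1) \<le> real n" using n by (rule of_nat_mono)
    then have "real n + 1 \<le> 4 * (real n - real N)" by simp
    then have "(\<bar>A\<bar> + 1) * (real n + 1) \<le> (\<bar>A\<bar> + 1) * (4 * (real n - real N))"
      by (intro mult_left_mono) auto
    also have "\<dots> = e * (T * (real n - real N))" using e by (simp add: T_def field_simps)
    also have "\<dots> \<le> e * ln (real (P n))" using grow[of n] n e by (intro mult_left_mono) auto
    finally have 1: "(\<bar>A\<bar> + 1) * (real n + 1) \<le> e * ln (real (P n))" .
    have "0 < (\<bar>A\<bar> + 1) * (real n + 1)" by (intro mult_pos_pos) auto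
    then have "0 < e * ln (real (P n))" using 1 by linarith
    then have "0 < ln (real (P n))" using e by (simp add: zero_less_mult_iff)
    moreover have "\<bar>A\<bar> * (real n + 1) < (\<bar>A\<bar> + 1) * (real n + 1)" by simp
    then have "\<bar>A\<bar> * (real n + 1) < e * ln (real (P n))" using 1 by linarith
    ultimately show ?thesis by (simp add: abs_mult pos_divide_less_eq)
  qed
  then show "\<forall>\<^sub>F n in sequentially. dist (A * (real n + 1) / ln (real (P n))) 0 < e"
    by (rule eventually_sequentiallyI)
qed

lemma tree_bounds:
  assumes "in_tree D w"
  shows "0 \<notin> set w \<and> real (P (length w)) \<le> real (den w) \<and>
    real (den w) \<le> 2 ^ length w * real (P (length w)) \<and> \<mu> w = 1 / real (P (length w))"
  using assms
proof (induction w)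
  case (Cons a w)
  then have IH: "0 \<notin> set w" "real (P (length w)) \<le> real (den w)"
    "real (den w) \<le> 2 ^ length w * real (P (length w))" "\<mu> w = 1 / real (P (length w))"
    and a: "c (length w) \<le> a" "a < 2 * c (length w)" by (auto simp: mixed_tree_def)
  let ?n = "length w"
  have "real (P (Suc ?n)) \<le> real (den (a # w))"
  proof -
    have "real (P (Suc ?n)) = real (c ?n) * real (P ?n)" by (simp add: block_prod_Suc)
    also have "\<dots> \<le> real a * real (den w)" using a IH by (intro mult_mono) auto
    also have "\<dots> \<le> real (den (a # w))" using den_ge_mult[of a w] by (simp flip: of_nat_mult)
    finally show ?thesis .
  qed
  moreover have "real (den (a # w)) \<le> 2 ^ Suc ?n * real (P (Suc ?n))"
  proof -
    have "real (den (a # w)) \<le> (real a + 1) * real (den w)" by (rule real_den_le_mult[OF IH(1)])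
    also have "\<dots> \<le> (2 * real (c ?n)) * (2 ^ ?n * real (P ?n))"
      using a IH by (intro mult_mono) auto
    also have "\<dots> = 2 ^ Suc ?n * real (P (Suc ?n))" by (simp add: block_prod_Suc)
    finally show ?thesis .
  qed
  ultimately show ?case using IH a c_ge(2)[of ?n] by (auto simp: block_prod_Suc)
qed simp

text \<open>Mass 1 / P sits on a length of about 1 / (P^2 * c), and c is at most about P powr (u -
  1). The ratio of the mass to the s-th power of the length is P powr (s * (1 + u) - 1) up to
  factors exponential in n, hence bounded.\<close>

lemma hausdorff_measure_block_tree_nonzero:
  assumes s: "0 < s" "s * (1 + u) < 1"
  shows "hausdorff_measure s (cf_tree_set D) \<noteq> 0"
proof -
  have s1: "s \<le> 1"
  proof -
    have "s * 1 \<le> s * (1 + u)" using s u by (intro mult_left_mono) auto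
    then show ?thesis using s by linarith
  qed
  define X where "X n = (1 / real (P n)) * ((2 ^ n * real (P n)) ^ 2 * real (c n)) powr s" for n
  have Xpos: "X n > 0" for n
    using P_ge_1[of n] c_ge(2)[of n] by (simp add: X_def)
  have ln_X: "ln (X n) \<le> s * (\<bar>K\<bar> + 3) * (real n + 1) - (1 - s * (1 + u)) * ln (real (P n))" for n
  proof -
    let ?p = "ln (real (P n))"
    have P: "real (P n) > 0" "real (c n) > 0" using P_ge_1[of n] c_ge(2)[of n] by auto
    have "ln (X n) = s * (2 * (real n * ln 2 + ?p) + ln (real (c n))) - ?p"
      using P by (simp add: X_def ln_mult_pos ln_powr ln_realpow ln_div)
    also have "\<dots> \<le> s * (2 * (real n * ln 2 + ?p) + (ln (2 * real (b n)) + (u - 1) * ?p)) - ?p"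
      using ln_c_le[of n] s by simp
    also have "\<dots> = s * (2 * (real n * ln 2) + ln (2 * real (b n))) - (1 - s * (1 + u)) * ?p"
      by (simp add: algebra_simps)
    also have "2 * (real n * ln 2) + ln (2 * real (b n)) \<le> (\<bar>K\<bar> + 3) * (real n + 1)"
    proof -
      have l2: "ln 2 \<le> (1::real)" using ln_le_minus_one[of "2::real"] by simp
      have "ln (2 * real (b n)) = ln 2 + ln (real (b n))" using b2[of n] by (subst ln_mult_pos) auto
      also have "\<dots> \<le> 1 + \<bar>K\<bar> * (real n + 1)"
      proof -
        have "K * (real n + 1) \<le> \<bar>K\<bar> * (real n + 1)" by (intro mult_right_mono) auto
        then show ?thesis using b_le[of n] l2 by linarith
      qed
      finally have "ln (2 * real (b n)) \<le> 1 + \<bar>K\<bar> * (real n + 1)" .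
      moreover have "real n * ln 2 \<le> real n * 1" using l2 by (intro mult_left_mono) auto
      ultimately show ?thesis by (simp add: algebra_simps)
    qed
    finally show ?thesis using s by (simp add: mult.assoc)
  qed
  have "\<forall>\<^sub>F n in sequentially. s * (\<bar>K\<bar> + 3) * (real n + 1) / ln (real (P n)) < 1 - s * (1 + u)"
    using linear_over_ln_P[of "s * (\<bar>K\<bar> + 3)"] s by (intro order_tendstoD) auto
  then obtain N where N: "\<And>n. n \<ge> N \<Longrightarrow> s * (\<bar>K\<bar> + 3) * (real n + 1) / ln (real (P n)) < 1 - s * (1 + u)"
    by (auto simp: eventually_sequentially)
  \<comment> \<open>From level \<open>N + 1\<close> on the ratio is at most 1; the finitely many
    earlier levels enter through the maximum.\<close>
  define C0 where "C0 = Max (insert 1 (X ` {..<N + 1}))"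
  have X_le: "X n \<le> C0" for n
  proof (cases "n < N + 1")
    case True
    then show ?thesis unfolding C0_def by (intro Max_ge) auto
  next
    case False
    have "ln (real (P n)) > 0"
    proof -
      obtain m where m: "n = Suc m" using False by (cases n) auto
      have "ln (real (c m)) > 0" using c_ge(2)[of m] by simp
      then show ?thesis using ln_P_nonneg[of m] by (simp add: m ln_P_Suc)
    qed
    then have "s * (\<bar>K\<bar> + 3) * (real n + 1) \<le> (1 - s * (1 + u)) * ln (real (P n))"
      using N[of n] False by (simp add: pos_divide_less_eq)
    then have "ln (X n) \<le> 0" using ln_X[of n] by linarith
    then have "X n \<le> 1" using Xpos[of n] by simp
    also have "1 \<le> C0" unfolding C0_def by (intro Max_ge) auto
    finally show ?thesis .
  qed
  \<comment> \<open>All levels are uniform. The parameters 2 and 0 of \<open>D\<close> and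
    \<open>\<mu>\<close> meet the expansion condition with equality: (1 - 2 / 4) * 2 = 1.\<close>
  show ?thesis
  proof (rule hausdorff_measure_mixed_tree_nonzero[where ?C0.0 = C0])
    fix w assume w: "in_tree D w"
    have "(real (den w) ^ 2 * real (c (length w))) powr s \<le>
        ((2 ^ length w * real (P (length w))) ^ 2 * real (c (length w))) powr s"
      using tree_bounds[OF w] s by (intro powr_mono2 mult_right_mono power_mono) auto
    then have "\<mu> w * (real (den w) ^ 2 * real (c (length w))) powr s \<le> X (length w)"
      using tree_bounds[OF w] by (auto simp: X_def intro!: divide_right_mono)
    then show "\<mu> w * (real (den w) ^ 2 * real (c (length w))) powr s \<le> C0"
      using X_le[of "length w"] by linarith
  qed (use s s1 c_ge in auto)
qed

text \<open>Measured against the denominator after it, a digit of size P powr (u - 1) has exponent 1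
  - 1 / u; the following one has exponent u - 1. Their sum u - 1 / u is \<beta>, and no position
  exceeds it.\<close>

lemma log_growth_block_tree:
  assumes x: "x \<in> cf_tree_set D"
  shows "log_growth x = ereal \<beta>"
proof -
  have irr: "x \<in> {0..<1} - \<rat>" using x by (simp add: cf_tree_set_def)
  let ?a = "cf_quot x" and ?q = "\<lambda>n. real (cf_den (cf_quot x) n)"
  have tree: "in_tree D (cf_word ?a n)" for n using x by (simp add: cf_tree_set_def)
  have q: "real (P n) \<le> ?q n" "?q n \<le> 2 ^ n * real (P n)" for n
    using tree_bounds[OF tree, of n] by (simp_all add: den_cf_word)
  have a: "c n \<le> ?a (Suc n)" "?a (Suc n) < 2 * c n" for n
    using tree[of "Suc n"] by (simp_all add: mixed_tree_def)
  have lnP: "ln (real (P n)) \<le> ln (?q n)" "ln (?q n) \<le> real n * ln 2 + ln (real (P n))" for n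
  proof -
    have P: "real (P n) > 0" using P_ge_1[of n] by simp
    show "ln (real (P n)) \<le> ln (?q n)" using q(1)[of n] P by (intro ln_mono) auto
    have "ln (?q n) \<le> ln (2 ^ n * real (P n))" using q[of n] P by (intro ln_mono) auto
    also have "\<dots> = real n * ln 2 + ln (real (P n))" using P by (simp add: ln_mult_pos ln_realpow)
    finally show "ln (?q n) \<le> real n * ln 2 + ln (real (P n))" .
  qed
  have l2: "0 \<le> ln (2::real)" "ln 2 \<le> (1::real)" using ln_le_minus_one[of "2::real"] by auto
  define A where "A = 4 + 2 * \<bar>K\<bar> + \<beta>"
  have A0: "A \<ge> 0" using \<beta> by (simp add: A_def)
  have lnb: "ln (2 * real (b n)) \<le> 1 + \<bar>K\<bar> * (real n + 1)" for n
  proof -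
    have "K * (real n + 1) \<le> \<bar>K\<bar> * (real n + 1)" by (intro mult_right_mono) auto
    moreover have "ln (2 * real (b n)) = ln 2 + ln (real (b n))" using b2[of n] by (subst ln_mult_pos) auto
    ultimately show ?thesis using b_le[of n] l2 by linarith
  qed
  have \<beta>u: "(1 - 1 / u) + (u - 1) = \<beta>"
    using u by (simp add: field_simps power2_eq_square)
  show ?thesis
  proof (rule log_growth_eqI[OF irr, where e = "\<lambda>n. A * (real n + 1)"])
    show "(\<lambda>n. A * (real n + 1) / ln (?q n)) \<longlonglongrightarrow> 0"
    proof (rule Lim_null_comparison[OF _ linear_over_ln_P[of A]])
      show "\<forall>\<^sub>F n in sequentially. norm (A * (real n + 1) / ln (?q n)) \<le> A * (real n + 1) / ln (real (P n))"
      proof (rule eventually_sequentiallyI[of 1])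
        fix n :: nat assume n: "1 \<le> n"
        obtain m where m: "n = Suc m" using n by (cases n) auto
        have "ln (real (c m)) > 0" using c_ge(2)[of m] by simp
        then have pos: "0 < ln (real (P n))" using ln_P_nonneg[of m] by (simp add: m ln_P_Suc)
        then have "A * (real n + 1) / ln (?q n) \<le> A * (real n + 1) / ln (real (P n))"
          using lnP(1)[of n] A0 by (intro divide_left_mono mult_pos_pos) auto
        moreover have "0 \<le> A * (real n + 1) / ln (?q n)" using A0 pos lnP(1)[of n] by simp
        ultimately show "norm (A * (real n + 1) / ln (?q n)) \<le> A * (real n + 1) / ln (real (P n))" by simp
      qed
    qed
    show "ln (real (?a n * ?a (Suc n))) \<le> \<beta> * ln (?q n) + A * (real n + 1)" if n: "n \<ge> 1" for n
    proof -
      obtain m where m: "n = Suc m" using n by (cases n) auto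
      let ?L = "ln (real (P n))" and ?p = "ln (real (P m))" and ?g = "ln (real (c m))"
      have pos: "real (?a n) > 0" "real (?a (Suc n)) > 0" using cf_quot_pos[OF irr] by auto
      have "ln (real (?a n)) \<le> ln (2 * real (c m))" "ln (real (?a (Suc n))) \<le> ln (2 * real (c n))"
        using pos a(2)[of m] a(2)[of n] m by (auto intro!: ln_mono)
      moreover have "ln (2 * real (c m)) = ln 2 + ?g" "ln (2 * real (c n)) = ln 2 + ln (real (c n))"
        using c_ge(2)[of m] c_ge(2)[of n] by (auto simp: ln_mult_pos)
      moreover have "ln (real (?a n * ?a (Suc n))) = ln (real (?a n)) + ln (real (?a (Suc n)))"
        using pos by (simp add: ln_mult_pos)
      ultimately have 1: "ln (real (?a n * ?a (Suc n))) \<le> 2 + ?g + ln (real (c n))"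
        using l2 by linarith
      \<comment> \<open>P n = P m * c m turns the bound of c m by the previous product into one by
        the present product.\<close>
      have 2: "?g \<le> ln (2 * real (b m)) + (1 - 1 / u) * ?L"
      proof -
        have B: "ln (2 * real (b m)) \<ge> 0" using b2[of m] by (intro ln_ge_zero) simp
        have "u * ?g = ?g + (u - 1) * ?g" by (simp add: algebra_simps)
        also have "\<dots> \<le> ln (2 * real (b m)) + (u - 1) * ?p + (u - 1) * ?g"
          using ln_c_le[of m] by simp
        also have "\<dots> = ln (2 * real (b m)) + (u - 1) * ?L"
          by (simp add: m ln_P_Suc algebra_simps)
        also have "\<dots> \<le> u * ln (2 * real (b m)) + (u - 1) * ?L"
          using B u by (simp add: mult_le_cancel_right1)
        also have "\<dots> = u * (ln (2 * real (b m)) + (1 - 1 / u) * ?L)"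
          using u by (simp add: field_simps)
        finally show ?thesis using u by simp
      qed
      have "ln (real (?a n * ?a (Suc n))) \<le>
          2 + ln (2 * real (b m)) + ln (2 * real (b n)) + ((1 - 1 / u) + (u - 1)) * ?L"
        using 1 2 ln_c_le[of n] by (simp only: distrib_right)
      also have "((1 - 1 / u) + (u - 1)) * ?L \<le> \<beta> * ln (?q n)"
        unfolding \<beta>u using lnP(1)[of n] \<beta> by (intro mult_left_mono) auto
      also have "2 + ln (2 * real (b m)) + ln (2 * real (b n)) \<le> A * (real n + 1)"
      proof -
        have "\<bar>K\<bar> * (real m + 1) \<le> \<bar>K\<bar> * (real n + 1)" using m by (intro mult_left_mono) auto
        then have "2 + ln (2 * real (b m)) + ln (2 * real (b n)) \<le> 4 + 2 * (\<bar>K\<bar> * (real n + 1))"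
          using lnb[of m] lnb[of n] by linarith
        also have "\<dots> \<le> A * (real n + 1)"
          using \<beta> by (simp add: A_def algebra_simps)
        finally show ?thesis .
      qed
      finally show ?thesis by simp
    qed
    show "\<exists>n\<ge>N. \<beta> * ln (?q n) - A * (real n + 1) \<le> ln (real (?a n * ?a (Suc n)))" for N
    proof -
      \<comment> \<open>The digits \<open>?a n\<close> and \<open>?a (Suc n)\<close> belong to the
        levels \<open>m\<close> and \<open>n\<close>, here 3 * N and 3 * N + 1, which are both
        fast.\<close>
      define m where "m = 3 * N"
      define n where "n = Suc m"
      let ?L = "ln (real (P n))" and ?p = "ln (real (P m))" and ?g = "ln (real (c m))"
      have mods: "m mod 3 \<noteq> 2" "n mod 3 \<noteq> 2" by (simp_all add: m_def n_def mod_Suc)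
      have pos: "real (c m) > 0" "real (c n) > 0" using c_ge(2)[of m] c_ge(2)[of n] by auto
      have "(u - 1) * ?L \<le> u * ?g"
      proof -
        have "(u - 1) * ?L = (u - 1) * ?p + (u - 1) * ?g" by (simp add: n_def ln_P_Suc algebra_simps)
        also have "\<dots> \<le> ?g + (u - 1) * ?g" using ln_c_ge[OF mods(1)] by simp
        finally show ?thesis by (simp add: algebra_simps)
      qed
      then have 1: "(1 - 1 / u) * ?L \<le> ?g" using u by (simp add: field_simps)
      have "\<beta> * ?L = (1 - 1 / u) * ?L + (u - 1) * ?L" unfolding \<beta>u[symmetric] by (rule distrib_right)
      also have "\<dots> \<le> ?g + ln (real (c n))" using 1 ln_c_ge[OF mods(2)] by linarith
      also have "\<dots> \<le> ln (real (?a n)) + ln (real (?a (Suc n)))"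
        using a(1)[of m] a(1)[of n] pos by (intro add_mono ln_mono) (auto simp: n_def)
      also have "\<dots> = ln (real (?a n * ?a (Suc n)))"
        using cf_quot_pos[OF irr] by (simp add: ln_mult_pos)
      finally have 2: "\<beta> * ?L \<le> ln (real (?a n * ?a (Suc n)))" .
      have "\<beta> * ln (?q n) \<le> \<beta> * (real n * ln 2 + ?L)"
        using lnP(2)[of n] \<beta> by (intro mult_left_mono) auto
      also have "\<dots> = \<beta> * (real n * ln 2) + \<beta> * ?L" by (rule distrib_left)
      also have "\<beta> * (real n * ln 2) \<le> A * (real n + 1)"
      proof (rule mult_mono)
        have "real n * ln 2 \<le> real n * 1" using l2 by (intro mult_left_mono) auto
        then show "real n * ln 2 \<le> real n + 1" by simp
      qed (use \<beta> A0 l2 in \<open>auto simp: A_def\<close>)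
      finally have "\<beta> * ln (?q n) - A * (real n + 1) \<le> ln (real (?a n * ?a (Suc n)))"
        using 2 by linarith
      then show ?thesis by (intro exI[of _ n]) (auto simp: n_def m_def)
    qed
  qed
qed

text \<open>Every digit is at least \<open>b n\<close>, which gives convergence above
  \<open>r\<close>. Along the slow positions the digits are below 2 * b, which gives divergence
  below \<open>r\<close>.\<close>

lemma conv_exponent_block_tree:
  assumes x: "x \<in> cf_tree_set D" and r: "0 \<le> r"
    and summable: "\<And>s. s > r \<Longrightarrow> summable (\<lambda>n. real (b n) powr (- s))"
    and divergent: "\<And>s. 0 \<le> s \<Longrightarrow> s < r \<Longrightarrow> \<not> summable (\<lambda>k. real (b (3 * k + 2)) powr (- s))"
  shows "conv_exponent x = ereal r"
proof -
  have irr: "x \<in> {0..<1} - \<rat>" using x by (simp add: cf_tree_set_def)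
  let ?a = "cf_quot x"
  have "in_tree D (cf_word ?a (Suc n))" for n using x unfolding cf_tree_set_def by blast
  then have a: "c n \<le> ?a (Suc n)" "?a (Suc n) < 2 * c n" for n :: nat
    by (simp_all add: mixed_tree_def)
  have conv: "summable (\<lambda>n. real (?a (Suc n)) powr (- s))" if s: "s > r" for s
  proof (rule summable_comparison_test'[OF summable[OF s]])
    fix n
    have "b n \<le> ?a (Suc n)" using a(1)[of n] c_ge(1)[of n] by simp
    then show "norm (real (?a (Suc n)) powr (- s)) \<le> real (b n) powr (- s)"
      using b2[of n] s r by (auto intro!: powr_mono2')
  qed
  have div: "\<not> summable (\<lambda>n. real (?a (Suc n)) powr (- s))" if s: "0 \<le> s" "s < r" for s
  proof
    assume "summable (\<lambda>n. real (?a (Suc n)) powr (- s))"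
    then have "summable ((\<lambda>n. real (?a (Suc n)) powr (- s)) \<circ> (\<lambda>k. 3 * k + 2))"
      by (intro summable_reindex) (auto simp: inj_on_def)
    then have "summable (\<lambda>k. 2 powr s * (real (?a (Suc (3 * k + 2))) powr (- s)))"
      unfolding o_def by (rule summable_mult)
    then have "summable (\<lambda>k. real (b (3 * k + 2)) powr (- s))"
    proof (rule summable_comparison_test')
      fix k :: nat
      let ?n = "3 * k + 2"
      have "?n mod 3 = 2" by presburger
      then have "c ?n = b ?n" unfolding block_base_def by (rule if_P)
      then have "real (?a (Suc ?n)) \<le> 2 * real (b ?n)" using a(2)[of ?n] by simp
      then have "(2 * real (b ?n)) powr (- s) \<le> real (?a (Suc ?n)) powr (- s)"
        using cf_quot_pos[OF irr, of "Suc ?n"] s by (intro powr_mono2') auto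
      then have "2 powr s * (2 * real (b ?n)) powr (- s) \<le> 2 powr s * real (?a (Suc ?n)) powr (- s)"
        by (intro mult_left_mono) auto
      also have "2 powr s * (2 * real (b ?n)) powr (- s) = real (b ?n) powr (- s)"
        by (simp add: powr_mult flip: powr_add mult.assoc)
      finally show "norm (real (b ?n) powr (- s)) \<le> 2 powr s * real (?a (Suc ?n)) powr (- s)" by simp
    qed
    then show False using divergent[OF s] by contradiction
  qed
  show ?thesis unfolding conv_exponent_def
  proof (rule antisym)
    show "Inf {ereal s | s. 0 \<le> s \<and> summable (\<lambda>n. real (?a (Suc n)) powr (- s))} \<le> ereal r"
    proof (rule ereal_le_epsilon2)
      fix e :: real assume "0 < e"
      then have "Inf {ereal s | s. 0 \<le> s \<and> summable (\<lambda>n. real (?a (Suc n)) powr (- s))} \<le> ereal (r + e)"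
        using conv[of "r + e"] r by (intro Inf_lower) auto
      then show "Inf {ereal s | s. 0 \<le> s \<and> summable (\<lambda>n. real (?a (Suc n)) powr (- s))} \<le> ereal r + ereal e"
        by simp
    qed
    show "ereal r \<le> Inf {ereal s | s. 0 \<le> s \<and> summable (\<lambda>n. real (?a (Suc n)) powr (- s))}"
    proof (rule Inf_greatest, clarify)
      fix s assume "0 \<le> s" "summable (\<lambda>n. real (?a (Suc n)) powr (- s))"
      then show "ereal r \<le> ereal s" using div[of s] by (cases "s < r") auto
    qed
  qed
qed

end

text \<open>Geometric digits have exponent 0 with ln b still linear in n. Digits like n powr (1 / r)
  have exponent r, also along every third position.\<close>

lemma ex_digits_with_exponent:
  assumes r: "(0::real) \<le> r"
  obtains b :: "nat \<Rightarrow> nat" and K where "\<And>n. b n \<ge> 2" "filterlim b at_top sequentially"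
    "\<And>n. ln (real (b n)) \<le> K * (real n + 1)"
    "\<And>s. s > r \<Longrightarrow> summable (\<lambda>n. real (b n) powr (- s))"
    "\<And>s. 0 \<le> s \<Longrightarrow> s < r \<Longrightarrow> \<not> summable (\<lambda>k. real (b (3 * k + 2)) powr (- s))"
proof (cases "r = 0")
  case True
  define b :: "nat \<Rightarrow> nat" where "b n = 2 ^ Suc n" for n
  have 1: "b n \<ge> 2" for n by (simp add: b_def)
  have 2: "filterlim b at_top sequentially"
  proof (rule filterlim_at_top_mono[OF filterlim_ident])
    have "n \<le> b n" for n using less_exp[of "Suc n"] unfolding b_def by linarith
    then show "\<forall>\<^sub>F n in sequentially. n \<le> b n" by simp
  qed
  have 3: "ln (real (b n)) \<le> ln 2 * (real n + 1)" for n
    by (simp add: b_def ln_mult_pos ln_realpow algebra_simps)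
  have 4: "summable (\<lambda>n. real (b n) powr (- s))" if "s > r" for s
  proof -
    have "(2::real) powr (- s) < 1" using that True by (simp add: powr_less_one)
    then have "summable (\<lambda>n. (2 powr (- s)) * (2 powr (- s)) ^ n :: real)"
      by (intro summable_mult summable_geometric) auto
    moreover have "real (b n) powr (- s) = (2 powr (- s)) * (2 powr (- s)) ^ n" for n
    proof -
      have "real (b n) = 2 powr (real (Suc n))" unfolding b_def by (subst powr_realpow) simp_all
      then have "real (b n) powr (- s) = (2 powr (- s)) powr real (Suc n)"
        by (simp only: powr_powr mult.commute)
      also have "\<dots> = (2 powr (- s)) ^ Suc n" by (subst powr_realpow) simp_all
      finally show ?thesis by simp
    qed
    ultimately show ?thesis by simp
  qed
  show thesis by (rule that[OF 1 2 3 4]) (use True in auto)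
next
  case False
  then have r: "r > 0" using assms by simp
  define b :: "nat \<Rightarrow> nat" where "b n = nat \<lceil>(real n + 1) powr (1 / r)\<rceil> + 1" for n
  have z: "(real n + 1) powr (1 / r) \<ge> 1" for n using r by (intro ge_one_powr_ge_zero) auto
  have 1: "b n \<ge> 2" for n using z[of n] unfolding b_def by linarith
  have lo: "(real n + 1) powr (1 / r) \<le> real (b n)" for n unfolding b_def by linarith
  have hi: "real (b n) \<le> 3 * (real n + 1) powr (1 / r)" for n using z[of n] unfolding b_def by linarith
  have 2: "filterlim b at_top sequentially"
  proof -
    have "filterlim (\<lambda>n. (real n + 1) powr (1 / r)) at_top sequentially"
      using r by real_asymp
    then have "filterlim (\<lambda>n. real (b n)) at_top sequentially"
      by (rule filterlim_at_top_mono) (use lo in auto)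
    then show ?thesis by (simp add: filterlim_sequentially_iff_filterlim_real)
  qed
  have 3: "ln (real (b n)) \<le> (2 + 1 / r) * (real n + 1)" for n
  proof -
    have "ln (real (b n)) \<le> ln (3 * (real n + 1) powr (1 / r))"
      using 1[of n] hi[of n] by (intro ln_mono) auto
    also have "\<dots> = ln 3 + 1 / r * ln (real n + 1)"
      by (subst ln_mult_pos) (auto simp: ln_powr)
    also have "\<dots> \<le> 2 + 1 / r * (real n + 1)"
    proof (rule add_mono)
      show "ln 3 \<le> (2::real)" using ln_le_minus_one[of "3::real"] by simp
      show "1 / r * ln (real n + 1) \<le> 1 / r * (real n + 1)"
        using r ln_le_minus_one[of "real n + 1"] by (intro mult_left_mono) auto
    qed
    also have "\<dots> \<le> (2 + 1 / r) * (real n + 1)" using r by (simp add: distrib_right)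
    finally show ?thesis .
  qed
  have 4: "summable (\<lambda>n. real (b n) powr (- s))" if s: "s > r" for s
  proof (rule summable_comparison_test')
    have "summable (\<lambda>n. real (Suc n) powr (- (s / r)))"
      using s r by (subst summable_Suc_iff) (auto simp: summable_real_powr_iff)
    then show "summable (\<lambda>n. (real n + 1) powr (- (s / r)))" by (simp add: add.commute)
    fix n
    have "real (b n) powr (- s) \<le> ((real n + 1) powr (1 / r)) powr (- s)"
      using lo[of n] s r by (intro powr_mono2') auto
    then show "norm (real (b n) powr (- s)) \<le> (real n + 1) powr (- (s / r))" by (simp add: powr_powr)
  qed
  have 5: "\<not> summable (\<lambda>k. real (b (3 * k + 2)) powr (- s))" if s: "0 \<le> s" "s < r" for s
  proof
    \<comment> \<open>One 3 is the constant in \<open>hi\<close>, the other comes from 3 * k + 2 + 1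
      = 3 * Suc k.\<close>
    let ?C = "3 powr (- s) * 3 powr (- (s / r))"
    have scale: "(3 * (3 * y) powr (1 / r)) powr (- s) = ?C * y powr (- (s / r))" for y :: real
      by (simp add: powr_mult powr_powr)
    assume "summable (\<lambda>k. real (b (3 * k + 2)) powr (- s))"
    then have "summable (\<lambda>k. ?C * real (Suc k) powr (- (s / r)))"
    proof (rule summable_comparison_test')
      fix k
      have "real (3 * k + 2) + 1 = 3 * real (Suc k)" by simp
      then have "(3 * (3 * real (Suc k)) powr (1 / r)) powr (- s) \<le> real (b (3 * k + 2)) powr (- s)"
        using hi[of "3 * k + 2"] 1[of "3 * k + 2"] s by (intro powr_mono2') auto
      also have "(3 * (3 * real (Suc k)) powr (1 / r)) powr (- s) = ?C * real (Suc k) powr (- (s / r))"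
        by (rule scale)
      finally show "norm (?C * real (Suc k) powr (- (s / r))) \<le> real (b (3 * k + 2)) powr (- s)" by simp
    qed
    then have "summable (\<lambda>k. inverse ?C * (?C * real (Suc k) powr (- (s / r))))" by (rule summable_mult)
    then have "summable (\<lambda>k. real (Suc k) powr (- (s / r)))" by (simp add: field_simps)
    then have "summable (\<lambda>k. real k powr (- (s / r)))" by (subst (asm) summable_Suc_iff)
    then show False using s r by (simp add: summable_real_powr_iff)
  qed
  show thesis by (rule that[OF 1 2 3 4 5])
qed

theorem hausdorff_dim_E_set_finite_ge:
  assumes \<beta>: "0 \<le> \<beta>" and r: "0 \<le> r"
  shows "ereal (1 / (1 + root_u \<beta>)) \<le> hausdorff_dim (E_set (ereal r) \<beta>)"
proof (rule hausdorff_dim_ge_if_measure_nonzero)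
  let ?u = "root_u \<beta>"
  have u: "?u \<ge> 1" by (rule root_u_ge[OF \<beta>])
  show "1 / (1 + ?u) > 0" using u by simp
  obtain b :: "nat \<Rightarrow> nat" and K where b: "\<And>n. b n \<ge> 2" "filterlim b at_top sequentially"
    "\<And>n. ln (real (b n)) \<le> K * (real n + 1)"
    "\<And>s. s > r \<Longrightarrow> summable (\<lambda>n. real (b n) powr (- s))"
    "\<And>s. 0 \<le> s \<Longrightarrow> s < r \<Longrightarrow> \<not> summable (\<lambda>k. real (b (3 * k + 2)) powr (- s))"
    using ex_digits_with_exponent[OF r] by blast
  interpret block_digits b ?u \<beta> K
    using u root_u_sq \<beta> b(1-3) by unfold_locales
  fix s assume s: "0 < s" "s < 1 / (1 + ?u)"
  then have "s * (1 + ?u) < 1" using u by (simp add: field_simps)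
  then have "hausdorff_measure s (cf_tree_set D) \<noteq> 0"
    by (rule hausdorff_measure_block_tree_nonzero[OF s(1)])
  moreover have "cf_tree_set D \<subseteq> E_set (ereal r) \<beta>"
  proof
    fix x assume x: "x \<in> cf_tree_set D"
    then show "x \<in> E_set (ereal r) \<beta>"
      using log_growth_block_tree[OF x] conv_exponent_block_tree[OF x r b(4,5)]
      by (simp add: E_set_def cf_tree_set_def)
  qed
  ultimately show "hausdorff_measure s (E_set (ereal r) \<beta>) \<noteq> 0"
    using hausdorff_measure_mono[of "cf_tree_set D" "E_set (ereal r) \<beta>" s] by auto
qed

text \<open>Since \<open>E_set\<close> is contained in \<open>G_set\<close>, an upper bound for the
  larger and an equal lower bound for the smaller set settle both dimensions.\<close>

theorem theorem1p3:
  fixes \<alpha> :: ereal and \<beta> :: real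
  assumes "0 \<le> \<alpha>" and "0 \<le> \<beta>"
  shows "hausdorff_dim (G_set \<alpha> \<beta>) = hausdorff_dim (E_set \<alpha> \<beta>)
    \<and> hausdorff_dim (E_set \<alpha> \<beta>) =
        ereal (if \<alpha> = \<infinity> then 2 / (\<beta> + 2) else 2 / (\<beta> + 2 + sqrt (\<beta>\<^sup>2 + 4)))"
proof -
  let ?d = "ereal (if \<alpha> = \<infinity> then 2 / (\<beta> + 2) else 2 / (\<beta> + 2 + sqrt (\<beta>\<^sup>2 + 4)))"
  have "hausdorff_dim (G_set \<alpha> \<beta>) \<le> ?d"
    using hausdorff_dim_G_set_le[OF assms(2), of \<alpha>] hausdorff_dim_G_set_finite_le[OF assms(2), of \<alpha>]
    by (cases "\<alpha> = \<infinity>") (auto simp: dim_eq_root_u)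
  moreover have "?d \<le> hausdorff_dim (E_set \<alpha> \<beta>)"
  proof (cases \<alpha>)
    case (real r)
    then show ?thesis using hausdorff_dim_E_set_finite_ge[OF assms(2), of r] assms(1)
      by (simp add: dim_eq_root_u)
  next
    case PInf
    then show ?thesis using hausdorff_dim_E_set_infinity_ge[OF assms(2)] by simp
  qed (use assms(1) in auto)
  moreover have "hausdorff_dim (E_set \<alpha> \<beta>) \<le> hausdorff_dim (G_set \<alpha> \<beta>)"
    by (rule hausdorff_dim_mono) (auto simp: E_set_def G_set_def)
  ultimately show ?thesis by (meson order.antisym order.trans)
qed

end
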